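(* Let $m\le n$ be positive integers, let $U$ be an open subset of $\mathbb R^n$, let $V$ be an $m$-dimensional varifold in $U$ such that $\|\delta V\|$ is a Radon measure and $\Theta^m(\|V\|,z)\ge1$ for $\|V\|$ almost all $z$; if $m>1$ suppose additionally that $\mathbf h(V;\cdot)\in\mathbf L_m^{\mathrm{loc}}(\|V\|,\mathbb R^n)$ and $\delta V(g)=-\int g(z)\bullet\mathbf h(V;z)\,d\|V\|z$ for $g\in C_c^\infty(U,\mathbb R^n)$. Let $C$ be a connected component of $\operatorname{spt}\|V\|$ and let $w,z\in C$. Then there exist $-\infty<a\le b<\infty$ and a Lipschitzian function $g:\{t:a\le t\le b\}\to\operatorname{spt}\|V\|$ such that $g(a)=w$ and $g(b)=z$.
   Context: $\mathbf G(n,m)$ is the set of $m$-dimensional linear subspaces of $\mathbb R^n$; $S_\natural$ is the orthogonal projection onto $S$; $\sigma\bullet\tau=\operatorname{trace}(\sigma^*\circ\tau)$. $B(z,r)$ is the closed ball; $\alpha(m)$ is the Lebesgue measure of the unit ball of $\mathbb R^m$; $\Theta^m(\phi,z)=\lim_{r\to0+}\phi(B(z,r))/(\alpha(m)r^m)$. $\mathbf L^{\mathrm{loc}}_m$ means $m$-th power integrable on compact subsets of $U$. An $m$-dimensional varifold $V$ in $U$ is a Radon measure over $U\times\mathbf G(n,m)$, with weight $\|V\|(A)=V(A\times\mathbf G(n,m))$, whose support relative to $U$ is $\operatorname{spt}\|V\|$; first variation $\delta V(g)=\int Dg(z)\bullet S_\natural\,dV(z,S)$ for $g\in C_c^\infty(U,\mathbb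 R^n)$, with total variation measure $\|\delta V\|$. $\mathbf h(V;\cdot)$ is the generalised mean curvature vector, i.e. $-\mathbf h(V;\cdot)\|V\|$ is the part of $\delta V$ absolutely continuous with respect to $\|V\|$. *)

theory Defs
  imports "HOL-Analysis.Analysis"
begin

section \<open>Radon measures\<close>

definition borel_of :: "'a topology \<Rightarrow> 'a measure" where
  "borel_of X = sigma (topspace X) {A. openin X A}"

text \<open>
  Radon measures over a locally compact Hausdorff space \<open>X\<close> in the sense of Federer, with the
  regular outer measure replaced by its restriction to the Borel sets, which determines it.
\<close>

definition radon_measure :: "'a topology \<Rightarrow> 'a measure \<Rightarrow> bool" where
  "radon_measure X \<mu> \<longleftrightarrow>
     space \<mu> = topspace X \<and> sets \<mu> = sets (borel_of X) \<and>
     (\<forall>K. compactin X K \<longrightarrow> emeasure \<mu> K < \<infinity>) \<and>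
     (\<forall>G. openin X G \<longrightarrow> emeasure \<mu> G = (SUP K \<in> {K. compactin X K \<and> K \<subseteq> G}. emeasure \<mu> K)) \<and>
     (\<forall>A\<in>sets \<mu>. emeasure \<mu> A = (INF G \<in> {G. openin X G \<and> A \<subseteq> G}. emeasure \<mu> G))"

definition spt :: "'a::topological_space set \<Rightarrow> 'a measure \<Rightarrow> 'a set" where
  "spt U \<mu> = U - \<Union>{G. open G \<and> G \<subseteq> U \<and> emeasure \<mu> G = 0}"

text \<open>
  \<open>has_density m \<mu> z d\<close> means that the \<open>m\<close>-dimensional density of \<open>\<mu>\<close> at \<open>z\<close> exists and equals
  \<open>d\<close>. If \<open>\<mu>\<close> lives on an open set containing \<open>z\<close>, then \<open>cball z r\<close> is a subset of that
  set for all small \<open>r\<close>.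
\<close>

definition has_density :: "nat \<Rightarrow> 'a::metric_space measure \<Rightarrow> 'a \<Rightarrow> ennreal \<Rightarrow> bool" where
  "has_density m \<mu> z d \<longleftrightarrow>
     ((\<lambda>r. emeasure \<mu> (cball z r) / ennreal (unit_ball_vol (real m) * r ^ m)) \<longlongrightarrow> d) (at_right 0)"

section \<open>The Grassmannian and varifolds\<close>

definition orth_proj :: "(real^'n) set \<Rightarrow> real^'n \<Rightarrow> real^'n" where
  "orth_proj S x = (THE y. y \<in> S \<and> (\<forall>v\<in>S. orthogonal (x - y) v))"

definition grassmannian :: "nat \<Rightarrow> (real^'n) set set" where
  "grassmannian m = {S. subspace S \<and> dim S = m}"

text \<open>
  As usual, \<open>S\<close> is identified with its orthogonal projection; so the topology of the
  Grassmannian is the one induced from the (finite-dimensional) space of linear endomorphisms.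
\<close>

definition grassmann_topology :: "nat \<Rightarrow> (real^'n) set topology" where
  "grassmann_topology m =
     pullback_topology (grassmannian m) (\<lambda>S. matrix (orth_proj S)) euclidean"

definition varifold ::
    "nat \<Rightarrow> (real^'n) set \<Rightarrow> ((real^'n) \<times> (real^'n) set) measure \<Rightarrow> bool" where
  "varifold m U V \<longleftrightarrow>
     radon_measure (prod_topology (top_of_set U) (grassmann_topology m)) V"

definition weight ::
    "(real^'n) set \<Rightarrow> ((real^'n) \<times> (real^'n) set) measure \<Rightarrow> (real^'n) measure" where
  "weight U V = distr V (borel_of (top_of_set U)) fst"

section \<open>First variation\<close>

primrec C_k_on :: "nat \<Rightarrow> ('a::real_normed_vector \<Rightarrow> 'b::real_normed_vector) \<Rightarrow> 'a set \<Rightarrow> bool" where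
  "C_k_on 0 f U = continuous_on U f"
| "C_k_on (Suc k) f U =
     ((\<forall>x\<in>U. f differentiable (at x)) \<and>
      (\<forall>v. C_k_on k (\<lambda>x. frechet_derivative f (at x) v) U))"

text \<open>
  The smooth vector fields with compact support in \<open>U\<close>, extended by zero to the whole space.
\<close>

definition test_fields :: "(real^'n) set \<Rightarrow> (real^'n \<Rightarrow> real^'n) set" where
  "test_fields U = {g. (\<forall>k. C_k_on k g UNIV) \<and>
     compact (closure {x. g x \<noteq> 0}) \<and> closure {x. g x \<noteq> 0} \<subseteq> U}"

definition lin_inner :: "(real^'n \<Rightarrow> real^'n) \<Rightarrow> (real^'n \<Rightarrow> real^'n) \<Rightarrow> real" where
  "lin_inner \<sigma> \<tau> = trace (matrix (adjoint \<sigma> \<circ> \<tau>))"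

definition first_variation ::
    "((real^'n) \<times> (real^'n) set) measure \<Rightarrow> (real^'n \<Rightarrow> real^'n) \<Rightarrow> real" where
  "first_variation V g =
     (\<integral>p. lin_inner (frechet_derivative g (at (fst p))) (orth_proj (snd p)) \<partial>V)"

text \<open>
  The total variation of a linear functional \<open>T\<close> on \<open>test_fields U\<close>: on open sets it is the
  supremum of \<open>T g\<close> over test fields \<open>g\<close> supported there with \<open>\<bar>g\<bar> \<le> 1\<close>, and it is
  extended to all subsets of \<open>U\<close> by outer regularity. The truncation of negative values by \<open>ennreal\<close>
  is harmless, since \<open>g = 0\<close> is admissible.
\<close>

definition total_variation ::
    "(real^'n) set \<Rightarrow> ((real^'n \<Rightarrow> real^'n) \<Rightarrow> real) \<Rightarrow> (real^'n) set \<Rightarrow> ennreal" where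
  "total_variation U T A =
     (INF G \<in> {G. open G \<and> A \<subseteq> G \<and> G \<subseteq> U}.
        SUP g \<in> {g \<in> test_fields U. closure {x. g x \<noteq> 0} \<subseteq> G \<and> (\<forall>x. norm (g x) \<le> 1)}.
          ennreal (T g))"

definition is_variation_measure ::
    "(real^'n) set \<Rightarrow> ((real^'n \<Rightarrow> real^'n) \<Rightarrow> real) \<Rightarrow> (real^'n) measure \<Rightarrow> bool" where
  "is_variation_measure U T \<mu> \<longleftrightarrow>
     sets \<mu> = sets (borel_of (top_of_set U)) \<and>
     (\<forall>A\<in>sets \<mu>. emeasure \<mu> A = total_variation U T A)"

section \<open>Generalised mean curvature\<close>

definition singular_measures :: "'a measure \<Rightarrow> 'a measure \<Rightarrow> bool" where
  "singular_measures \<mu> \<nu> \<longleftrightarrow>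
     (\<exists>N \<in> sets \<mu> \<inter> sets \<nu>. emeasure \<nu> N = 0 \<and> emeasure \<mu> (space \<mu> - N) = 0)"

text \<open>
  \<open>h\<close> is a (Borel) version of the generalised mean curvature vector of \<open>V\<close>, that is, the Lebesgue
  decomposition of the vector-valued measure \<open>\<delta>V\<close> with respect to \<open>\<parallel>V\<parallel>\<close> has the
  absolutely continuous part \<open>- h \<parallel>V\<parallel>\<close>; its singular part is given by its polar
  decomposition \<open>\<eta> \<sigma>\<close>. This determines \<open>h\<close> uniquely up to equality \<open>\<parallel>V\<parallel>\<close> almost everywhere.
\<close>

definition generalised_mean_curvature ::
    "(real^'n) set \<Rightarrow> ((real^'n) \<times> (real^'n) set) measure \<Rightarrow> (real^'n \<Rightarrow> real^'n) \<Rightarrow> bool" where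
  "generalised_mean_curvature U V h \<longleftrightarrow>
     h \<in> borel_measurable (weight U V) \<and>
     (\<forall>K. compact K \<and> K \<subseteq> U \<longrightarrow> set_integrable (weight U V) K h) \<and>
     (\<exists>\<sigma> \<eta>. radon_measure (top_of_set U) \<sigma> \<and> singular_measures \<sigma> (weight U V) \<and>
        \<eta> \<in> borel_measurable \<sigma> \<and> (AE z in \<sigma>. norm (\<eta> z) = 1) \<and>
        (\<forall>g\<in>test_fields U. first_variation V g =
           - (\<integral>z. g z \<bullet> h z \<partial>weight U V) + (\<integral>z. g z \<bullet> \<eta> z \<partial>\<sigma>)))"

definition L_loc :: "nat \<Rightarrow> (real^'n) set \<Rightarrow> (real^'n) measure \<Rightarrow> (real^'n \<Rightarrow> real^'n) \<Rightarrow> bool" where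
  "L_loc p U \<mu> h \<longleftrightarrow> h \<in> borel_measurable \<mu> \<and>
     (\<forall>K. compact K \<and> K \<subseteq> U \<longrightarrow> set_integrable \<mu> K (\<lambda>z. norm (h z) ^ p))"

end

theory Submission
  imports Defs "HOL-Library.Ramsey"
begin

text \<open>
  Testing the first variation with radial fields \<open>u(x) \<phi>(\<bar>x - \<xi>\<bar>\<^sup>2/t\<^sup>2) (x - \<xi>)\<close> gives a monotonicity formula
  weighted by a cutoff function \<open>u\<close>; together with the density hypothesis and Vitali's covering
  lemma it yields a weak isoperimetric inequality
  \<open>\<parallel>V\<parallel>{u = 1} \<le> C \<parallel>V\<parallel>(Q)\<^sup>1\<^sup>/\<^sup>m (sup \<bar>Du\<bar> \<parallel>V\<parallel>(Q) + \<nu>(Q))\<close>, where \<open>u\<close> is supported in \<open>Q\<close> and \<open>\<nu>\<close> is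
  \<open>\<parallel>\<delta>V\<parallel>\<close> if \<open>m = 1\<close> and \<open>\<bar>h\<bar> \<parallel>V\<parallel>\<close> otherwise. Only the gradient of \<open>u\<close> on \<open>spt \<parallel>V\<parallel>\<close> enters. Hence
  \<open>u\<close> can be built from the intrinsic distance \<open>d\<close> on \<open>spt \<parallel>V\<parallel>\<close> that is defined by chains with steps
  shorter than \<open>\<delta>\<close>, with constants independent of \<open>\<delta>\<close>, and an iteration of De Giorgi type shows
  \<open>\<parallel>V\<parallel>{d < S} \<ge> c S\<^sup>m\<close> whenever \<open>\<nu>\<close> is small, relative to \<open>\<parallel>V\<parallel>\<close>, near \<open>{d < S}\<close>.

  If points \<open>y\<^sub>i\<close> of \<open>spt \<parallel>V\<parallel>\<close> converge to \<open>x\<close> and none can be joined to \<open>x\<close> by short chains,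
  then their intrinsic balls avoid \<open>x\<close>, so \<open>\<nu>\<close> is small near them (a possible atom of \<open>\<nu>\<close> at \<open>x\<close> does
  no harm), and the mass bound allows only finitely many disjoint ones. Hence infinitely many \<open>y\<^sub>j\<close>
  are joined to a single \<open>y\<^sub>i\<close> by chains of bounded length, and letting \<open>y\<^sub>j\<close> tend to \<open>x\<close> joins \<open>y\<^sub>i\<close>
  to \<open>x\<close>, a contradiction. So the classes of points that can be joined by
  Lipschitzian curves are relatively open in \<open>spt \<parallel>V\<parallel>\<close>.
\<close>

section \<open>Calculus of \<open>C_k_on\<close> and smooth step functions\<close>

text \<open>A distance defined by curves might be infinite between distinct points and would give no
  function to differentiate. Chains with steps shorter than \<delta> may jump through the ambient
  space, so their distance is 1-Lipschitz at scale \<delta> on the support; every estimate must then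
  survive \<delta> \<rightarrow> 0, which is why constants are fixed before the function, the scale
  and the set. The iteration needs the variation of a set to be at most \<epsilon> times the power 1
  - 1/m of its mass: this makes the variation term a multiple of the mass, it follows from m-th
  power integrability of h, and for m = 1 it just says that the variation is small. Such smallness
  is available only near a point and away from it, so the argument is by contradiction at one point,
  and Ramsey's theorem splits it into two cases: either all of the points selected are joined to
  each other, or no two of them are. Smooth radial profiles replace characteristic functions of
  balls, and the mean value theorem on dyadic intervals replaces integration in the radius.\<close>

lemma C_k_on_SucI:
  assumes "\<And>x. (f has_derivative f' x) (at x)" and "\<And>v. C_k_on k (\<lambda>x. f' x v) UNIV"
  shows "C_k_on (Suc k) f UNIV"
proof -
  have "frechet_derivative f (at x) = f' x" for x
    using assms(1) frechet_derivative_at by metis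
  then show ?thesis using assms by (auto simp: differentiable_def)
qed

lemma C_k_on_SucD:
  assumes "C_k_on (Suc k) f UNIV"
  shows "(f has_derivative frechet_derivative f (at x)) (at x)"
    and "C_k_on k (\<lambda>x. frechet_derivative f (at x) v) UNIV"
  using assms by (auto simp: frechet_derivative_works)

text \<open>The recursion speaks of the top order only, so lower orders are recovered by induction,
  with differentiability giving continuity at the bottom. Product and chain rules keep
  undifferentiated factors and rely on this.\<close>

lemma C_k_on_Suc: "C_k_on (Suc k) f UNIV \<Longrightarrow> C_k_on k f UNIV"
proof (induction k arbitrary: f)
  case 0
  then show ?case
    by (auto simp: continuous_on_eq_continuous_at differentiable_imp_continuous_within)
next
  case (Suc k)
  show ?case
    by (rule C_k_on_SucI[where f' = "\<lambda>x. frechet_derivative f (at x)"])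
      (rule C_k_on_SucD(1)[OF Suc.prems] Suc.IH[OF C_k_on_SucD(2)[OF Suc.prems]])+
qed

lemma C_k_on_const: "C_k_on k (\<lambda>x. c) UNIV"
proof (induction k arbitrary: c)
  case (Suc k)
  show ?case by (rule C_k_on_SucI[where f' = "\<lambda>x v. 0"]) (use Suc in auto)
qed simp

lemma C_k_on_bounded_linear:
  assumes "bounded_linear f"
  shows "C_k_on k f UNIV"
proof (cases k)
  case 0
  then show ?thesis using assms by (simp add: linear_continuous_on)
next
  case (Suc j)
  show ?thesis unfolding Suc
    by (rule C_k_on_SucI[where f' = "\<lambda>x. f"])
      (use assms in \<open>auto simp: C_k_on_const bounded_linear_imp_has_derivative\<close>)
qed

lemma C_k_on_add:
  "C_k_on k f UNIV \<Longrightarrow> C_k_on k g UNIV \<Longrightarrow> C_k_on k (\<lambda>x. f x + g x) UNIV"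
proof (induction k arbitrary: f g)
  case 0
  then show ?case by (auto intro: continuous_intros)
next
  case (Suc k)
  show ?case
    by (rule C_k_on_SucI[where f' = "\<lambda>x v. frechet_derivative f (at x) v + frechet_derivative g (at x) v"])
      (rule has_derivative_add Suc.IH C_k_on_SucD[OF Suc.prems(1)] C_k_on_SucD[OF Suc.prems(2)])+
qed

lemma C_k_on_bilinear:
  assumes "bounded_bilinear b"
  shows "C_k_on k f UNIV \<Longrightarrow> C_k_on k g UNIV \<Longrightarrow> C_k_on k (\<lambda>x. b (f x) (g x)) UNIV"
proof (induction k arbitrary: f g)
  case 0
  then show ?case by (auto intro: bounded_bilinear.continuous_on[OF assms])
next
  case (Suc k)
  show ?case
    by (rule C_k_on_SucI[where f' = "\<lambda>x v. b (f x) (frechet_derivative g (at x) v)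
          + b (frechet_derivative f (at x) v) (g x)"])
      (rule bounded_bilinear.FDERIV[OF assms] C_k_on_add Suc.IH
        C_k_on_SucD[OF Suc.prems(1)] C_k_on_SucD[OF Suc.prems(2)]
        C_k_on_Suc[OF Suc.prems(1)] C_k_on_Suc[OF Suc.prems(2)])+
qed

lemmas C_k_on_scaleR = C_k_on_bilinear[OF bounded_bilinear_scaleR]
lemmas C_k_on_mult = C_k_on_bilinear[OF bounded_bilinear_mult]
lemmas C_k_on_inner = C_k_on_bilinear[OF bounded_bilinear_inner]

lemma C_k_on_uminus: "C_k_on k f UNIV \<Longrightarrow> C_k_on k (\<lambda>x. - f x) UNIV"
  using C_k_on_scaleR[OF C_k_on_const[of k "-1::real"], of f] by simp

lemma C_k_on_diff:
  "C_k_on k f UNIV \<Longrightarrow> C_k_on k g UNIV \<Longrightarrow> C_k_on k (\<lambda>x. f x - g x) UNIV"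
  using C_k_on_add[OF _ C_k_on_uminus, of k f g] by simp

lemma C_k_on_sum:
  "(\<And>i. i \<in> I \<Longrightarrow> C_k_on k (f i) UNIV) \<Longrightarrow> C_k_on k (\<lambda>x. \<Sum>i\<in>I. f i x) UNIV"
  by (induction I rule: infinite_finite_induct) (auto simp: C_k_on_const intro: C_k_on_add)

lemma C_k_on_prod:
  fixes f :: "'i \<Rightarrow> 'a::real_normed_vector \<Rightarrow> real"
  shows "(\<And>i. i \<in> I \<Longrightarrow> C_k_on k (f i) UNIV) \<Longrightarrow> C_k_on k (\<lambda>x. \<Prod>i\<in>I. f i x) UNIV"
  by (induction I rule: infinite_finite_induct) (auto simp: C_k_on_const intro: C_k_on_mult)

text \<open>For a real inner function the derivative of \<open>\<phi>\<close> acts as multiplication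
  by \<open>?d\<close>, so the chain rule yields a product. The induction is over all
  \<open>\<phi>\<close> because it is applied to \<open>?d\<close>.\<close>

lemma C_k_on_compose_real:
  fixes f :: "'a::real_normed_vector \<Rightarrow> real" and \<phi> :: "real \<Rightarrow> 'b::real_normed_vector"
  shows "C_k_on k \<phi> UNIV \<Longrightarrow> C_k_on k f UNIV \<Longrightarrow> C_k_on k (\<lambda>x. \<phi> (f x)) UNIV"
proof (induction k arbitrary: \<phi>)
  case 0
  then show ?case using continuous_on_compose2[of UNIV \<phi> UNIV f] by simp
next
  case (Suc k)
  let ?d = "\<lambda>t. frechet_derivative \<phi> (at t) 1"
  have lin: "frechet_derivative \<phi> (at t) r = r *\<^sub>R ?d t" for t r
  proof -
    have "frechet_derivative \<phi> (at t) (r *\<^sub>R 1) = r *\<^sub>R ?d t"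
      by (rule linear_scale[OF has_derivative_linear[OF C_k_on_SucD(1)[OF Suc.prems(1)]]])
    then show ?thesis by (simp only: real_scaleR_def mult_1_right)
  qed
  show ?case
  proof (rule C_k_on_SucI[where f' = "\<lambda>x v. frechet_derivative f (at x) v *\<^sub>R ?d (f x)"])
    show "((\<lambda>x. \<phi> (f x)) has_derivative (\<lambda>v. frechet_derivative f (at x) v *\<^sub>R ?d (f x))) (at x)" for x
      by (rule has_derivative_eq_rhs[OF has_derivative_compose[OF C_k_on_SucD(1)[OF Suc.prems(2)]
          C_k_on_SucD(1)[OF Suc.prems(1)]]]) (intro ext lin)
    show "C_k_on k (\<lambda>x. frechet_derivative f (at x) v *\<^sub>R ?d (f x)) UNIV" for v
      by (intro C_k_on_scaleR Suc.IH[of ?d] C_k_on_SucD(2)[OF Suc.prems(1)]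
          C_k_on_SucD(2)[OF Suc.prems(2)] C_k_on_Suc[OF Suc.prems(2)])
  qed
qed

lemma C_k_on_inverse:
  fixes f :: "'a::real_normed_vector \<Rightarrow> real"
  assumes "\<And>x. f x \<noteq> 0"
  shows "C_k_on k f UNIV \<Longrightarrow> C_k_on k (\<lambda>x. inverse (f x)) UNIV"
proof (induction k)
  case 0
  then have "continuous_on UNIV f" by simp
  then have "continuous_on UNIV (\<lambda>x. inverse (f x))"
    by (rule continuous_on_inverse) (simp add: assms)
  then show ?case by simp
next
  case (Suc k)
  have IH: "C_k_on k (\<lambda>x. inverse (f x)) UNIV" by (rule Suc.IH[OF C_k_on_Suc[OF Suc.prems]])
  show ?case
  proof (rule C_k_on_SucI)
    show "((\<lambda>x. inverse (f x)) has_derivative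
      (\<lambda>v. - (inverse (f x) * frechet_derivative f (at x) v * inverse (f x)))) (at x)" for x
      using Deriv.has_derivative_inverse[OF assms C_k_on_SucD(1)[OF Suc.prems]] .
    show "C_k_on k (\<lambda>x. - (inverse (f x) * frechet_derivative f (at x) v * inverse (f x))) UNIV" for v
      by (rule C_k_on_uminus[OF C_k_on_mult[OF C_k_on_mult[OF IH C_k_on_SucD(2)[OF Suc.prems]] IH]])
  qed
qed

text \<open>The extra power of 1/t closes the family under differentiation, so that a single
  induction over all \<open>n\<close> proves smoothness.\<close>

definition flat :: "nat \<Rightarrow> real \<Rightarrow> real" where
  "flat n t = (if t \<le> 0 then 0 else exp (- inverse t) * inverse t ^ n)"

text \<open>Substituting s = 1/t reduces the claim to the exponential outgrowing powers. As
  \<open>flat n 0 = 0\<close>, this is the difference quotient at 0.\<close>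

lemma flat_over_tendsto_0: "((\<lambda>t. flat n t / t) \<longlongrightarrow> 0) (at 0)"
proof -
  have "((\<lambda>s::real. s ^ Suc n / exp s) \<longlongrightarrow> 0) at_top"
    by (rule tendsto_power_div_exp_0)
  then have "((\<lambda>t::real. inverse t ^ Suc n / exp (inverse t)) \<longlongrightarrow> 0) (at_right 0)"
    using filterlim_compose filterlim_inverse_at_top_right by blast
  moreover have "\<forall>\<^sub>F t::real in at_right 0. inverse t ^ Suc n / exp (inverse t) = flat n t / t"
    using eventually_at_right_less[of 0]
    by eventually_elim (simp add: flat_def exp_minus divide_inverse mult_ac)
  ultimately have "((\<lambda>t. flat n t / t) \<longlongrightarrow> 0) (at_right 0)"
    by (rule Lim_transform_eventually)
  moreover have "((\<lambda>t. flat n t / t) \<longlongrightarrow> 0) (at_left 0)"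
    by (rule tendsto_eventually) (auto simp: flat_def eventually_at_filter)
  ultimately show ?thesis by (simp add: filterlim_split_at)
qed

lemma flat_has_derivative:
  "(flat n has_real_derivative (flat (n + 2) t - real n * flat (n + 1) t)) (at t)"
proof -
  consider "t < 0" | "t = 0" | "t > 0" by linarith
  then show ?thesis
  proof cases
    case 1
    have "((\<lambda>_. 0) has_real_derivative 0) (at t)" by simp
    then have "(flat n has_real_derivative 0) (at t)"
      by (rule has_field_derivative_transform_within_open[where S = "{..<0}"])
        (use 1 in \<open>auto simp: flat_def\<close>)
    then show ?thesis using 1 by (simp add: flat_def)
  next
    case 2
    then show ?thesis using flat_over_tendsto_0[of n]
      by (simp add: has_field_derivative_iff flat_def)
  next
    case 3
    define s where "s = inverse t"
    \<comment> \<open>For n = 0 the exponent \<open>n - Suc 0\<close> is truncated to 0; the factor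
      \<open>real n\<close> then makes both sides vanish.\<close>
    have "real n * (s ^ 2 * s ^ (n - Suc 0)) = real n * s ^ (n + 1)"
      by (cases n) (auto simp: power2_eq_square)
    moreover have "((\<lambda>t. inverse t) has_real_derivative (- (s ^ 2))) (at t)"
      using DERIV_inverse[of t] 3 by (simp add: power2_eq_square s_def)
    then have "((\<lambda>t. exp (- inverse t) * inverse t ^ n) has_real_derivative
        (exp (- s) * (- (- (s ^ 2)))) * s ^ n + (real n * ((- (s ^ 2)) * s ^ (n - Suc 0))) * exp (- s)) (at t)"
      unfolding s_def
      by (intro DERIV_mult DERIV_power DERIV_chain2[OF DERIV_exp] DERIV_minus)
    moreover have "exp (- s) * (- (- (s ^ 2))) * s ^ n + real n * (- (s ^ 2) * s ^ (n - Suc 0)) * exp (- s)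
        = exp (- s) * s ^ (n + 2) - (real n * (s ^ 2 * s ^ (n - Suc 0))) * exp (- s)"
      by (simp add: power2_eq_square algebra_simps)
    ultimately have "((\<lambda>t. exp (- inverse t) * inverse t ^ n) has_real_derivative
        (flat (n + 2) t - real n * flat (n + 1) t)) (at t)"
      using 3 by (simp only: flat_def s_def[symmetric]) (simp add: mult_ac)
    then show ?thesis
      by (rule has_field_derivative_transform_within_open[where S = "{0<..}"])
        (use 3 in \<open>auto simp: flat_def\<close>)
  qed
qed

lemma C_k_on_flat: "C_k_on k (flat n) UNIV"
proof (induction k arbitrary: n)
  case 0
  show ?case using DERIV_isCont[OF flat_has_derivative]
    by (simp add: continuous_on_eq_continuous_at)
next
  case (Suc k)
  show ?case
  proof (rule C_k_on_SucI[where f' = "\<lambda>t v. (flat (n + 2) t - real n * flat (n + 1) t) * v"])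
    show "(flat n has_derivative (\<lambda>v. (flat (n + 2) t - real n * flat (n + 1) t) * v)) (at t)" for t
      using flat_has_derivative by (simp add: has_field_derivative_def)
    show "C_k_on k (\<lambda>t. (flat (n + 2) t - real n * flat (n + 1) t) * v) UNIV" for v
      by (intro C_k_on_mult C_k_on_diff C_k_on_const Suc)
  qed
qed

section \<open>A smooth transition from 0 to 1\<close>

definition smooth_step :: "real \<Rightarrow> real" where
  "smooth_step t = flat 0 t * inverse (flat 0 t + flat 0 (1 - t))"

lemma flat_nonneg: "flat n t \<ge> 0"
  by (simp add: flat_def)

lemma flat_0_sum_pos: "flat 0 t + flat 0 (1 - t) > 0"
  by (auto simp: flat_def intro: add_pos_pos)

lemma C_k_on_smooth_step: "C_k_on k smooth_step UNIV"
proof -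
  have "C_k_on k (\<lambda>t. flat 0 (1 - t)) UNIV"
    by (intro C_k_on_compose_real[OF C_k_on_flat] C_k_on_diff C_k_on_const
        C_k_on_bounded_linear bounded_linear_ident)
  then show ?thesis unfolding smooth_step_def[abs_def]
    using flat_0_sum_pos
    by (intro C_k_on_mult C_k_on_inverse C_k_on_add C_k_on_flat) (simp add: less_imp_neq [symmetric])
qed

lemma smooth_step_eq_0: "t \<le> 0 \<Longrightarrow> smooth_step t = 0"
  by (simp add: smooth_step_def flat_def)

lemma smooth_step_eq_1: "t \<ge> 1 \<Longrightarrow> smooth_step t = 1"
  by (simp add: smooth_step_def flat_def)

definition smooth_step' :: "real \<Rightarrow> real" where
  "smooth_step' t = frechet_derivative smooth_step (at t) 1"

lemma smooth_step_has_derivative [derivative_intros]: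
  "(smooth_step has_real_derivative smooth_step' t) (at t)"
proof -
  have d: "(smooth_step has_derivative frechet_derivative smooth_step (at t)) (at t)"
    using C_k_on_SucD(1)[OF C_k_on_smooth_step] .
  have "frechet_derivative smooth_step (at t) (r *\<^sub>R 1) = r *\<^sub>R smooth_step' t" for r
    unfolding smooth_step'_def by (rule linear_scale[OF has_derivative_linear[OF d]])
  then have "frechet_derivative smooth_step (at t) = (*) (smooth_step' t)"
    by (simp add: fun_eq_iff mult.commute)
  with d show ?thesis by (simp add: has_field_derivative_def)
qed

lemma C_k_on_smooth_step': "C_k_on k smooth_step' UNIV"
  using C_k_on_SucD(2)[OF C_k_on_smooth_step[of "Suc k"], of 1]
  unfolding smooth_step'_def[abs_def] .

lemma smooth_step'_nonneg: "smooth_step' t \<ge> 0"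
proof -
  have e: "(flat 0 has_real_derivative flat 2 s) (at s)" for s
    using flat_has_derivative[of 0 s] by (simp add: numeral_2_eq_2)
  have e2: "((\<lambda>t. flat 0 (1 - t)) has_real_derivative - flat 2 (1 - t)) (at t)"
    by (rule DERIV_chain2[OF e, where Db="-1", simplified]) (auto intro!: derivative_eq_intros)
  have nz: "flat 0 t + flat 0 (1 - t) \<noteq> 0" using flat_0_sum_pos[of t] by linarith
  \<comment> \<open>Quotient rule for b/d, where d is the sum in \<open>nz\<close> and b is
    \<open>flat 0 t\<close>. Since d - b is \<open>flat 0 (1 - t)\<close>, the numerator becomes a
    sum of products of nonnegative terms.\<close>
  have *: "a * inverse d + - (inverse d * (a + - c) * inverse d) * b = (a * (d - b) + b * c) * (inverse d)\<^sup>2"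
    if "d \<noteq> 0" for a b c d :: real
    using that by (simp add: field_simps power2_eq_square)
  have "(smooth_step has_real_derivative
      flat 2 t * inverse (flat 0 t + flat 0 (1 - t)) +
      - (inverse (flat 0 t + flat 0 (1 - t)) * (flat 2 t + - flat 2 (1 - t))
         * inverse (flat 0 t + flat 0 (1 - t))) * flat 0 t) (at t)"
    unfolding smooth_step_def[abs_def]
    by (rule DERIV_mult DERIV_inverse' DERIV_add e e2 nz)+
  then have "smooth_step' t = (flat 2 t * flat 0 (1 - t) + flat 0 t * flat 2 (1 - t))
       * (inverse (flat 0 t + flat 0 (1 - t)))\<^sup>2"
    unfolding *[OF nz] using DERIV_unique[OF smooth_step_has_derivative] by simp
  then show ?thesis by (simp add: flat_nonneg)
qed

lemma smooth_step_mono: "s \<le> t \<Longrightarrow> smooth_step s \<le> smooth_step t"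
  by (rule DERIV_nonneg_imp_nondecreasing, assumption, rule exI, rule conjI,
      rule smooth_step_has_derivative, rule smooth_step'_nonneg)

lemma smooth_step_nonneg: "smooth_step t \<ge> 0"
  by (simp add: smooth_step_def flat_nonneg)

lemma smooth_step_le_1: "smooth_step t \<le> 1"
  using smooth_step_mono[of t "max t 1"] smooth_step_eq_1[of "max t 1"] by simp

text \<open>The step attains its minimum 0 on t \<le> 0 and its maximum 1 on t \<ge> 1, so the
  derivative vanishes there, also at the two endpoints.\<close>

lemma smooth_step'_eq_0: "t \<le> 0 \<or> t \<ge> 1 \<Longrightarrow> smooth_step' t = 0"
  using DERIV_local_min[OF smooth_step_has_derivative, of 1 t]
    DERIV_local_max[OF smooth_step_has_derivative, of 1 t]
    smooth_step_nonneg smooth_step_le_1 smooth_step_eq_0[of t] smooth_step_eq_1[of t] by auto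

lemma smooth_step'_bounded:
  obtains K where "K > 0" "\<And>t. smooth_step' t \<le> K"
proof -
  have "compact (smooth_step' ` {0..1})"
    using C_k_on_smooth_step'[of 0]
    by (intro compact_continuous_image) (auto intro: continuous_on_subset)
  then obtain K where "\<forall>s\<in>smooth_step' ` {0..1}. norm s \<le> K"
    using compact_imp_bounded bounded_iff by blast
  then have K: "\<And>t. t \<in> {0..1} \<Longrightarrow> \<bar>smooth_step' t\<bar> \<le> K" by simp
  have "smooth_step' t \<le> max K 1" for t
    using K[of t] smooth_step'_eq_0[of t] by (cases "t \<in> {0..1}") auto
  then show ?thesis by (intro that[of "max K 1"]) auto
qed

section \<open>Smooth cutoff functions\<close>

text \<open>Integer translates telescope, which makes them a partition of unity of the line.\<close>

definition hat :: "real \<Rightarrow> real" where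
  "hat t = smooth_step (t + 1) - smooth_step t"

definition hat' :: "real \<Rightarrow> real" where
  "hat' t = smooth_step' (t + 1) - smooth_step' t"

lemma hat_has_derivative: "(hat has_real_derivative hat' t) (at t)"
proof -
  have "((\<lambda>t. smooth_step (t + 1)) has_real_derivative smooth_step' (t + 1)) (at t)"
    by (rule DERIV_chain2[OF smooth_step_has_derivative, where Db = 1, simplified])
      (auto intro!: derivative_eq_intros)
  then show ?thesis
    unfolding hat_def[abs_def] hat'_def by (intro DERIV_diff smooth_step_has_derivative)
qed

lemma hat_nonneg: "hat t \<ge> 0"
  by (simp add: hat_def smooth_step_mono)

lemma hat_le_1: "hat t \<le> 1"
  using smooth_step_le_1[of "t + 1"] smooth_step_nonneg[of t] by (simp add: hat_def)

lemma hat_eq_0: "\<bar>t\<bar> \<ge> 1 \<Longrightarrow> hat t = 0"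
  by (cases "t \<ge> 0") (auto simp: hat_def smooth_step_eq_0 smooth_step_eq_1)

lemma hat'_eq_0: "\<bar>t\<bar> \<ge> 1 \<Longrightarrow> hat' t = 0"
  by (cases "t \<ge> 0") (auto simp: hat'_def smooth_step'_eq_0)

lemma C_k_on_hat: "C_k_on k hat UNIV"
proof -
  have "C_k_on k (\<lambda>t. smooth_step (t + 1)) UNIV"
    by (intro C_k_on_compose_real[OF C_k_on_smooth_step] C_k_on_add C_k_on_const
        C_k_on_bounded_linear bounded_linear_ident)
  then show ?thesis
    unfolding hat_def[abs_def] by (intro C_k_on_diff C_k_on_smooth_step)
qed

lemma hat'_bounded:
  obtains K where "K > 0" "\<And>t. \<bar>hat' t\<bar> \<le> K"
proof -
  obtain K where "K > 0" "\<And>t. smooth_step' t \<le> K"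
    using smooth_step'_bounded by metis
  then have "\<bar>hat' t\<bar> \<le> K" for t
    using smooth_step'_nonneg[of t] smooth_step'_nonneg[of "t + 1"]
    unfolding hat'_def by (smt (verit))
  then show ?thesis using that \<open>K > 0\<close> by blast
qed

text \<open>The sum telescopes to a difference of two steps. Letting \<open>t\<close> run one unit
  beyond the cell [a, a + 1] on both sides makes one index set valid on a neighbourhood, so that the
  identity can be differentiated.\<close>

lemma sum_hat:
  fixes a :: int
  assumes "real_of_int a - 1 \<le> t" "t \<le> real_of_int a + 2"
  shows "(\<Sum>k\<in>{a - 1..a + 2}. hat (t - of_int k)) = 1"
proof -
  have "{a - 1..a + 2} = {a - 1, a, a + 1, a + 2}" by auto
  then have "(\<Sum>k\<in>{a - 1..a + 2}. hat (t - of_int k)) =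
      smooth_step (t - of_int a + 2) - smooth_step (t - of_int a - 2)"
    by (simp add: hat_def algebra_simps)
  also have "\<dots> = 1"
    using assms by (simp add: smooth_step_eq_0 smooth_step_eq_1)
  finally show ?thesis .
qed

section \<open>Lattice partition of unity in several variables\<close>

definition bump :: "real \<Rightarrow> ('n \<Rightarrow> int) \<Rightarrow> real^'n \<Rightarrow> real" where
  "bump e p x = (\<Prod>i\<in>UNIV. hat (x $ i / e - of_int (p i)))"

definition bump' :: "real \<Rightarrow> ('n \<Rightarrow> int) \<Rightarrow> real^'n \<Rightarrow> real^'n \<Rightarrow> real" where
  "bump' e p x v = (\<Sum>i\<in>UNIV. hat' (x $ i / e - of_int (p i)) * (v $ i / e) *
      (\<Prod>j\<in>UNIV - {i}. hat (x $ j / e - of_int (p j))))"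

lemma bump_has_derivative: "(bump e p has_derivative bump' e p x) (at x)"
proof -
  have "((\<lambda>x. hat (x $ i / e - of_int (p i))) has_derivative
      (\<lambda>v. hat' (x $ i / e - of_int (p i)) * (v $ i / e))) (at x)" for i
  proof -
    have "bounded_linear (\<lambda>v::real^'a. v $ i / e)"
      by (intro bounded_linear_divide bounded_linear_compose[OF bounded_linear_divide] bounded_linear_vec_nth)
    then have "((\<lambda>x. x $ i / e - of_int (p i)) has_derivative (\<lambda>v. v $ i / e)) (at x)"
      using has_derivative_diff[OF bounded_linear_imp_has_derivative has_derivative_const] by fastforce
    from has_derivative_compose[OF this] show ?thesis
      using hat_has_derivative[unfolded has_field_derivative_def] by blast
  qed
  then show ?thesis
    unfolding bump_def[abs_def] bump'_def[abs_def] by (intro has_derivative_prod)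
qed

lemma C_k_on_bump: "C_k_on k (bump e p) UNIV"
proof -
  have "bounded_linear (\<lambda>v::real^'a. v $ i / e)" for i
    by (intro bounded_linear_divide bounded_linear_compose[OF bounded_linear_divide] bounded_linear_vec_nth)
  then show ?thesis
    unfolding bump_def[abs_def]
    by (intro C_k_on_prod C_k_on_compose_real[OF C_k_on_hat] C_k_on_diff C_k_on_const
        C_k_on_bounded_linear)
qed

lemma bump_nonneg: "bump e p x \<ge> 0"
  by (auto simp: bump_def intro: prod_nonneg hat_nonneg)

lemma bump'_bound:
  fixes x v :: "real^'n"
  assumes "e > 0" and "\<And>t. \<bar>hat' t\<bar> \<le> K"
  shows "\<bar>bump' e p x v\<bar> \<le> real CARD('n) * K / e * norm v"
proof -
  have K: "K \<ge> 0" using assms(2)[of 0] by linarith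
  have "\<bar>bump' e p x v\<bar> \<le> (\<Sum>i\<in>(UNIV :: 'n set). K / e * norm v)"
    unfolding bump'_def
  proof (rule order_trans[OF sum_abs], rule sum_mono)
    fix i :: 'n
    have 1: "\<bar>\<Prod>j\<in>UNIV - {i}. hat (x $ j / e - of_int (p j))\<bar> \<le> 1"
      by (simp add: abs_prod hat_nonneg hat_le_1 prod_le_1)
    have 2: "\<bar>v $ i / e\<bar> \<le> norm v / e"
      using component_le_norm_cart[of v i] assms(1) by (simp add: divide_right_mono)
    have "\<bar>hat' (x $ i / e - of_int (p i)) * (v $ i / e) * (\<Prod>j\<in>UNIV - {i}. hat (x $ j / e - of_int (p j)))\<bar>
      \<le> (K * (norm v / e)) * 1"
      unfolding abs_mult using assms(1) K by (intro mult_mono assms(2) 1 2) auto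
    then show "\<bar>hat' (x $ i / e - of_int (p i)) * (v $ i / e) * (\<Prod>j\<in>UNIV - {i}. hat (x $ j / e - of_int (p j)))\<bar>
      \<le> K / e * norm v" by simp
  qed
  then show ?thesis by simp
qed

text \<open>Bumps that are nonzero at \<open>x\<close> have index floor or floor + 1 in each
  coordinate; the margin of one keeps the sum over this set equal to 1 on a ball around
  \<open>x\<close>. The number of indices depends on the dimension only, not on
  \<open>e\<close>.\<close>

definition lattice_nbhd :: "real \<Rightarrow> real^'n \<Rightarrow> ('n \<Rightarrow> int) set" where
  "lattice_nbhd e x = (\<Pi>\<^sub>E i\<in>UNIV. {\<lfloor>x $ i / e\<rfloor> - 1..\<lfloor>x $ i / e\<rfloor> + 2})"

lemma finite_lattice_nbhd: "finite (lattice_nbhd e x)"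
  by (auto simp: lattice_nbhd_def intro: finite_PiE)

lemma card_lattice_nbhd: "card (lattice_nbhd e (x::real^'n)) = 4 ^ CARD('n)"
  by (simp add: lattice_nbhd_def card_PiE)

lemma not_in_lattice_nbhd:
  assumes "p \<notin> lattice_nbhd e x"
  shows "bump e p x = 0" "bump' e p x v = 0"
proof -
  obtain i where "p i \<notin> {\<lfloor>x $ i / e\<rfloor> - 1..\<lfloor>x $ i / e\<rfloor> + 2}"
    using assms by (auto simp: lattice_nbhd_def PiE_iff)
  then have i: "\<bar>x $ i / e - of_int (p i)\<bar> \<ge> 1" by (auto; linarith)
  then show "bump e p x = 0"
    unfolding bump_def by (intro prod_zero bexI[of _ i] hat_eq_0) auto
  have "hat' (x $ j / e - of_int (p j)) * (v $ j / e) *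
      (\<Prod>l\<in>UNIV - {j}. hat (x $ l / e - of_int (p l))) = 0" for j
  proof (cases "i = j")
    case False
    then have "(\<Prod>l\<in>UNIV - {j}. hat (x $ l / e - of_int (p l))) = 0"
      using i by (intro prod_zero bexI[of _ i] hat_eq_0) auto
    then show ?thesis by simp
  qed (use i hat'_eq_0 in auto)
  then show "bump' e p x v = 0" unfolding bump'_def by (intro sum.neutral ballI)
qed

lemma sum_bump:
  fixes x y :: "real^'n"
  assumes "e > 0" "dist x y < e / 2"
  shows "(\<Sum>p\<in>lattice_nbhd e x. bump e p y) = 1"
proof -
  have "(\<Sum>k\<in>{\<lfloor>x $ i / e\<rfloor> - 1..\<lfloor>x $ i / e\<rfloor> + 2}. hat (y $ i / e - of_int k)) = 1" for i
  proof (rule sum_hat)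
    have "\<bar>x $ i - y $ i\<bar> < e / 2"
      using component_le_norm_cart[of "x - y" i] assms(2) by (simp add: dist_norm)
    then have "\<bar>x $ i / e - y $ i / e\<bar> < 1 / 2"
      using assms(1) by (simp add: diff_divide_distrib[symmetric] divide_less_eq abs_divide)
    then show "real_of_int \<lfloor>x $ i / e\<rfloor> - 1 \<le> y $ i / e" "y $ i / e \<le> real_of_int \<lfloor>x $ i / e\<rfloor> + 2"
      by linarith+
  qed
  then show ?thesis
    unfolding lattice_nbhd_def bump_def by (subst prod_sum_PiE[symmetric]) auto
qed

text \<open>By \<open>sum_bump\<close> the same finite family adds up to the constant 1 near
  \<open>x\<close>. Hence subtracting a constant from all coefficients leaves the gradient at
  \<open>x\<close> unchanged.\<close>

lemma sum_bump':
  fixes x :: "real^'n"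
  assumes "e > 0"
  shows "(\<Sum>p\<in>lattice_nbhd e x. bump' e p x v) = 0"
proof -
  have "((\<lambda>y. \<Sum>p\<in>lattice_nbhd e x. bump e p y) has_derivative
      (\<lambda>v. \<Sum>p\<in>lattice_nbhd e x. bump' e p x v)) (at x)"
    by (intro has_derivative_sum bump_has_derivative)
  moreover have "((\<lambda>y. \<Sum>p\<in>lattice_nbhd e x. bump e p y) has_derivative (\<lambda>v. 0)) (at x)"
    by (rule has_derivative_transform_within_open[where s = "ball x (e / 2)" and f = "\<lambda>_. 1"])
      (use assms sum_bump in auto)
  ultimately have "(\<lambda>v. \<Sum>p\<in>lattice_nbhd e x. bump' e p x v) = (\<lambda>v. 0)"
    by (rule has_derivative_unique)
  then show ?thesis by (rule fun_cong)
qed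

definition lattice_point :: "real \<Rightarrow> ('n \<Rightarrow> int) \<Rightarrow> real^'n" where
  "lattice_point e p = (\<chi> i. e * of_int (p i))"

lemma dist_lattice_point:
  fixes x :: "real^'n"
  assumes "e > 0" "p \<in> lattice_nbhd e x"
  shows "dist (lattice_point e p) x \<le> 2 * real CARD('n) * e"
proof -
  have "\<bar>(lattice_point e p - x) $ i\<bar> \<le> 2 * e" for i
  proof -
    have "\<lfloor>x $ i / e\<rfloor> - 1 \<le> p i" "p i \<le> \<lfloor>x $ i / e\<rfloor> + 2"
      using assms(2) by (auto simp: lattice_nbhd_def PiE_iff)
    then have "\<bar>of_int (p i) - x $ i / e\<bar> \<le> 2" by linarith
    then have "\<bar>e * (of_int (p i) - x $ i / e)\<bar> \<le> e * 2"
      unfolding abs_mult using assms(1) by (intro mult_mono) auto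
    moreover have "e * (of_int (p i) - x $ i / e) = (lattice_point e p - x) $ i"
      using assms(1) by (simp add: lattice_point_def algebra_simps)
    ultimately show ?thesis by simp
  qed
  then have "(\<Sum>i\<in>UNIV. \<bar>(lattice_point e p - x) $ i\<bar>) \<le> (\<Sum>i\<in>(UNIV::'n set). 2 * e)"
    by (intro sum_mono)
  then show ?thesis
    using norm_le_l1_cart[of "lattice_point e p - x"] by (simp add: dist_norm)
qed

lemma finite_lattice_points:
  assumes "bounded S" "e > 0"
  shows "finite {p :: 'n::finite \<Rightarrow> int. lattice_point e p \<in> S}"
proof -
  obtain B where B: "\<And>x. x \<in> S \<Longrightarrow> norm x \<le> B"
    using assms(1) unfolding bounded_iff by blast
  have "{p :: 'n \<Rightarrow> int. lattice_point e p \<in> S} \<subseteq> (\<Pi>\<^sub>E i\<in>UNIV. {- \<lceil>B / e\<rceil>..\<lceil>B / e\<rceil>})"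
  proof (clarsimp simp: PiE_iff)
    fix p :: "'n \<Rightarrow> int" and i
    assume "lattice_point e p \<in> S"
    then have "\<bar>e * of_int (p i)\<bar> \<le> B"
      using B component_le_norm_cart[of "lattice_point e p" i]
      by (fastforce simp: lattice_point_def)
    then have "\<bar>of_int (p i)\<bar> \<le> B / e"
      using assms(2) by (simp add: abs_mult field_simps)
    then show "- \<lceil>B / e\<rceil> \<le> p i \<and> p i \<le> \<lceil>B / e\<rceil>" by linarith
  qed
  moreover have "finite (\<Pi>\<^sub>E i\<in>(UNIV::'n set). {- \<lceil>B / e\<rceil>..\<lceil>B / e\<rceil>})"
    by (intro finite_PiE) auto
  ultimately show ?thesis by (rule finite_subset)
qed

text \<open>A smoothing of \<open>c\<close> as seen from \<open>T\<close>, which will be the support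
  of the weight: gradient and plateau are controlled there, and \<open>\<tau>\<close> measures how
  far the smoothing spreads.\<close>

definition smooth_cutoff ::
    "(real^'n) set \<Rightarrow> (real^'n \<Rightarrow> real) \<Rightarrow> real \<Rightarrow> real \<Rightarrow> (real^'n \<Rightarrow> real) \<Rightarrow> bool" where
  "smooth_cutoff T c \<Lambda> \<tau> u \<longleftrightarrow> (\<forall>k. C_k_on k u UNIV) \<and> (\<forall>x. 0 \<le> u x \<and> u x \<le> 1) \<and>
     (\<forall>x\<in>T. \<forall>v. \<bar>frechet_derivative u (at x) v\<bar> \<le> \<Lambda> * norm v) \<and>
     (\<forall>x\<in>T. (\<forall>p\<in>T. dist p x < \<tau> \<longrightarrow> c p = 1) \<longrightarrow> u x = 1) \<and>
     closure {x. u x \<noteq> 0} \<subseteq> (\<Union>q\<in>{q\<in>T. c q \<noteq> 0}. ball q \<tau>)"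

text \<open>The cutoff is a combination of lattice bumps whose coefficients are values of \<open>c\<close> at nearby
  points of \<open>T\<close>. Since the bumps add up to 1, its gradient at \<open>x\<close> involves only differences
  \<open>c p - c x\<close>, so the bound does not depend on the mesh size.\<close>

lemma ex_smooth_cutoff:
  "\<exists>K>0. \<forall>(T :: (real^'n) set) c L \<delta> \<tau>. 0 < \<delta> \<longrightarrow> 0 < \<tau> \<longrightarrow> 0 \<le> L \<longrightarrow>
     (\<forall>p. 0 \<le> c p \<and> c p \<le> 1) \<longrightarrow>
     (\<forall>p\<in>T. \<forall>q\<in>T. dist p q < \<delta> \<longrightarrow> \<bar>c p - c q\<bar> \<le> L * dist p q) \<longrightarrow>
     bounded {p\<in>T. c p \<noteq> 0} \<longrightarrow> (\<exists>u. smooth_cutoff T c (K * L) \<tau> u)"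
proof -
  obtain K where K: "K > 0" "\<And>t. \<bar>hat' t\<bar> \<le> K"
    using hat'_bounded by metis
  define n where "n = real CARD('n)"
  have n: "n \<ge> 1" by (simp add: n_def Suc_leI)
  define K' where "K' = 4 ^ CARD('n) * (4 * n * n * K)"
  have "K' > 0" using K n by (simp add: K'_def)
  have main: "\<exists>u. smooth_cutoff T c (K' * L) \<tau> u"
    if \<delta>: "0 < \<delta>" and \<tau>: "0 < \<tau>" and L: "0 \<le> L"
      and c01: "\<forall>p. 0 \<le> c p \<and> c p \<le> (1::real)"
      and lip: "\<forall>p\<in>T. \<forall>q\<in>T. dist p q < \<delta> \<longrightarrow> \<bar>c p - c q\<bar> \<le> L * dist p q"
      and bdd: "bounded {p\<in>T. c p \<noteq> 0}"
    for T :: "(real^'n) set" and c L \<delta> \<tau>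
  proof -
    \<comment> \<open>A point of \<open>T\<close>, a lattice point and its representative in
      \<open>T\<close> are linked by two distances of at most 2ne; their sum 4ne is a quarter of
      \<open>min \<delta> \<tau>\<close>, below the Lipschitz scale and below
      \<open>\<tau> / 2\<close>.\<close>
    define e where "e = min \<delta> \<tau> / (16 * n)"
    have e: "e > 0" using \<delta> \<tau> n by (simp add: e_def)
    have "16 * (n * e) = min \<delta> \<tau>" using n by (simp add: e_def)
    then have ne: "4 * (n * e) < \<delta>" "4 * (n * e) < \<tau> / 2" using \<delta> \<tau> by linarith+
    define near where "near p q \<longleftrightarrow> q \<in> T \<and> dist (lattice_point e p) q \<le> 2 * n * e"
      for p :: "'n \<Rightarrow> int" and q
    \<comment> \<open>A lattice point may lie off \<open>T\<close>, so its coefficient is read off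
      at a nearby point of \<open>T\<close>. Bumps without such a point vanish on \<open>T\<close>
      and receive the coefficient 0.\<close>
    define s where "s p = (SOME q. near p q)" for p
    define c' where "c' p = (if \<exists>q. near p q then c (s p) else 0)" for p
    have s: "near p (s p)" if "near p q" for p q
      using that unfolding s_def by (rule someI)
    have c'01: "0 \<le> c' p \<and> c' p \<le> 1" for p
      using c01 by (simp add: c'_def)
    have c'0: "\<exists>q\<in>T. c q \<noteq> 0 \<and> dist (lattice_point e p) q \<le> 2 * n * e" if "c' p \<noteq> 0" for p
      using that s by (auto simp: c'_def near_def split: if_splits)
    define P where "P = {p. c' p \<noteq> 0}"
    have "finite P"
    proof -
      obtain B where B: "\<And>q. q \<in> T \<Longrightarrow> c q \<noteq> 0 \<Longrightarrow> norm q \<le> B"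
        using bdd unfolding bounded_iff by blast
      have "P \<subseteq> {p. lattice_point e p \<in> cball 0 (B + 2 * n * e)}"
      proof (intro subsetI CollectI)
        fix p assume "p \<in> P"
        then obtain q where "norm q \<le> B" "dist (lattice_point e p) q \<le> 2 * n * e"
          using c'0 B by (auto simp: P_def)
        then show "lattice_point e p \<in> cball 0 (B + 2 * n * e)"
          using norm_triangle_sub[of "lattice_point e p" q] by (simp add: dist_norm)
      qed
      then show ?thesis
        by (rule finite_subset) (intro finite_lattice_points e bounded_cball)
    qed
    define u where "u x = (\<Sum>p\<in>P. c' p * bump e p x)" for x
    have u: "u x = (\<Sum>p\<in>lattice_nbhd e x. c' p * bump e p x)" for x
      unfolding u_def using \<open>finite P\<close> finite_lattice_nbhd
      by (intro sum.mono_neutral_cong) (auto simp: P_def not_in_lattice_nbhd)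
    have uder: "(u has_derivative (\<lambda>v. \<Sum>p\<in>P. c' p * bump' e p x v)) (at x)" for x
      unfolding u_def[abs_def]
      by (intro has_derivative_sum has_derivative_mult_right bump_has_derivative)
    have der: "frechet_derivative u (at x) v = (\<Sum>p\<in>lattice_nbhd e x. c' p * bump' e p x v)" for x v
      unfolding frechet_derivative_at[OF uder, symmetric]
      using \<open>finite P\<close> finite_lattice_nbhd
      by (intro sum.mono_neutral_cong) (auto simp: P_def not_in_lattice_nbhd)
    have sum1: "(\<Sum>p\<in>lattice_nbhd e x. bump e p x) = 1" for x :: "real^'n"
      using sum_bump[of e x x] e by simp
    have near_x: "s p \<in> T" "dist (s p) x \<le> 4 * (n * e)" "c' p = c (s p)"
      if "p \<in> lattice_nbhd e x" "x \<in> T" for p x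
    proof -
      have d: "dist (lattice_point e p) x \<le> 2 * n * e"
        using dist_lattice_point[OF e that(1)] by (simp add: n_def)
      then have "near p x" using that by (simp add: near_def)
      then show "s p \<in> T" "c' p = c (s p)"
        using s by (auto simp: near_def c'_def)
      show "dist (s p) x \<le> 4 * (n * e)"
        using s[OF \<open>near p x\<close>] d dist_triangle[of "s p" x "lattice_point e p"]
        by (simp add: near_def dist_commute)
    qed
    show ?thesis
      unfolding smooth_cutoff_def
    proof (intro exI[of _ u] conjI allI ballI impI)
      show "C_k_on k u UNIV" for k
        unfolding u_def[abs_def] by (intro C_k_on_sum C_k_on_mult C_k_on_const C_k_on_bump)
      show "0 \<le> u x" for x
        unfolding u_def using c'01 by (intro sum_nonneg mult_nonneg_nonneg bump_nonneg) auto
      have "u x \<le> (\<Sum>p\<in>lattice_nbhd e x. bump e p x)" for x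
        unfolding u using c'01 bump_nonneg by (intro sum_mono mult_left_le_one_le) auto
      then show "u x \<le> 1" for x by (simp add: sum1)
      show "u x = 1" if "x \<in> T" "\<forall>p\<in>T. dist p x < \<tau> \<longrightarrow> c p = 1" for x
      proof -
        have "c' p = 1" if "p \<in> lattice_nbhd e x" for p
          using near_x[OF that \<open>x \<in> T\<close>] ne \<tau> \<open>\<forall>p\<in>T. dist p x < \<tau> \<longrightarrow> c p = 1\<close> by auto
        then show ?thesis unfolding u using sum1[of x] by simp
      qed
      show "\<bar>frechet_derivative u (at x) v\<bar> \<le> K' * L * norm v" if "x \<in> T" for x v
      proof -
        have "frechet_derivative u (at x) v =
            (\<Sum>p\<in>lattice_nbhd e x. (c' p - c x) * bump' e p x v)"
          using sum_bump'[OF e, of x v]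
          by (simp add: der left_diff_distrib sum_subtractf sum_distrib_left[symmetric])
        also have "\<bar>\<dots>\<bar> \<le> (\<Sum>p\<in>lattice_nbhd e x. (L * (4 * (n * e))) * (n * K / e * norm v))"
        proof (rule order_trans[OF sum_abs], rule sum_mono, unfold abs_mult)
          fix p assume p: "p \<in> lattice_nbhd e x"
          have "\<bar>c' p - c x\<bar> \<le> L * dist (s p) x"
            using near_x[OF p that] ne lip that by auto
          also have "\<dots> \<le> L * (4 * (n * e))"
            using near_x[OF p that] L by (intro mult_left_mono)
          finally show "\<bar>c' p - c x\<bar> * \<bar>bump' e p x v\<bar> \<le> (L * (4 * (n * e))) * (n * K / e * norm v)"
            using bump'_bound[OF e K(2), of p x v] L n e by (intro mult_mono) (auto simp: n_def)
        qed
        also have "\<dots> = K' * L * norm v"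
          using e by (simp add: card_lattice_nbhd K'_def)
        finally show ?thesis .
      qed
      show "closure {x. u x \<noteq> 0} \<subseteq> (\<Union>q\<in>{q\<in>T. c q \<noteq> 0}. ball q \<tau>)"
      proof
        fix y assume "y \<in> closure {x. u x \<noteq> 0}"
        then obtain x where x: "u x \<noteq> 0" "dist x y < \<tau> / 2"
          unfolding closure_approachable using \<tau> by (metis half_gt_zero mem_Collect_eq)
        then obtain p where p: "p \<in> lattice_nbhd e x" "c' p \<noteq> 0"
          unfolding u by (metis (no_types, lifting) mult_eq_0_iff sum.not_neutral_contains_not_neutral)
        then obtain q where q: "q \<in> T" "c q \<noteq> 0" "dist (lattice_point e p) q \<le> 2 * n * e"
          using c'0 by blast
        have "dist (lattice_point e p) x \<le> 2 * n * e"
          using dist_lattice_point[OF e p(1)] by (simp add: n_def)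
        then have "dist x q \<le> 4 * (n * e)"
          using q dist_triangle[of x q "lattice_point e p"] by (simp add: dist_commute)
        then have "dist q y < \<tau>"
          using x(2) ne dist_triangle[of q y x] by (simp add: dist_commute)
        then show "y \<in> (\<Union>q\<in>{q\<in>T. c q \<noteq> 0}. ball q \<tau>)" using q by auto
      qed
    qed
  qed
  show ?thesis
    by (intro exI[of _ K'] conjI \<open>K' > 0\<close>; intro allI impI) (rule main)
qed

section \<open>Orthogonal projections and the Grassmannian\<close>

lemma orth_proj_eqI:
  assumes "subspace S" "y \<in> S" "\<And>v. v \<in> S \<Longrightarrow> orthogonal (x - y) v"
  shows "orth_proj S x = y"
  unfolding orth_proj_def
proof (rule the_equality)
  fix y' assume y': "y' \<in> S \<and> (\<forall>v\<in>S. orthogonal (x - y') v)"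
  have "y - y' \<in> S" using assms y' by (simp add: subspace_diff)
  then have "orthogonal (x - y') (y - y')" "orthogonal (x - y) (y - y')" using assms y' by auto
  then have "(y - y') \<bullet> (y - y') = 0"
    by (simp add: orthogonal_def inner_diff_left inner_diff_right)
  then show "y' = y" by simp
qed (use assms in auto)

text \<open>Expansion in an orthonormal basis satisfies the definite description in
  \<open>orth_proj\<close>; linearity and the trace are read off from it.\<close>

lemma orth_proj_exists:
  fixes S :: "(real^'n) set"
  assumes "subspace S"
  obtains B where "finite B" "card B = dim S" "\<And>x. orth_proj S x = (\<Sum>b\<in>B. (b \<bullet> x) *\<^sub>R b)"
    "\<And>b. b \<in> B \<Longrightarrow> norm b = 1" "orth_proj S ` UNIV = S" "\<And>x. x \<in> S \<Longrightarrow> orth_proj S x = x"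
    "\<And>x y. y \<in> S \<Longrightarrow> orth_proj S x \<bullet> y = x \<bullet> y"
proof -
  obtain B where B: "B \<subseteq> S" "pairwise orthogonal B" "\<And>x. x \<in> B \<Longrightarrow> norm x = 1"
    "independent B" "card B = dim S" "span B = S"
    using orthonormal_basis_subspace[OF assms] by blast
  have fin: "finite B" using B independent_imp_finite by blast
  have P: "orth_proj S x = (\<Sum>b\<in>B. (b \<bullet> x) *\<^sub>R b)"
    and orth: "\<And>v. v \<in> S \<Longrightarrow> orthogonal (x - (\<Sum>b\<in>B. (b \<bullet> x) *\<^sub>R b)) v" for x
  proof -
    let ?y = "\<Sum>b\<in>B. (b \<bullet> x) *\<^sub>R b"
    have y: "?y \<in> S" using B assms by (intro subspace_sum subspace_scale) auto
    have "b \<bullet> ?y = b \<bullet> x" if "b \<in> B" for b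
    proof -
      have "b \<bullet> ?y = (\<Sum>c\<in>B. (c \<bullet> x) * (b \<bullet> c))" by (simp add: inner_sum_right)
      also have "\<dots> = (\<Sum>c\<in>B. if c = b then b \<bullet> x else 0)"
      proof (rule sum.cong)
        fix c assume "c \<in> B"
        then show "(c \<bullet> x) * (b \<bullet> c) = (if c = b then b \<bullet> x else 0)"
          using that B(2,3) by (auto simp: pairwise_def orthogonal_def norm_eq_1)
      qed simp
      finally show ?thesis using that fin by simp
    qed
    then have "orthogonal (x - ?y) b" if "b \<in> B" for b
      using that by (simp only: orthogonal_def inner_commute[of _ b] inner_diff_right cancel_comm_monoid_add_class.diff_cancel)
    then show orth: "orthogonal (x - ?y) v" if "v \<in> S" for v
      using orthogonal_to_span[of v B] that B(6) by (simp add: \<open>\<And>b. b \<in> B \<Longrightarrow> orthogonal (x - ?y) b\<close>)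
    show "orth_proj S x = ?y" by (rule orth_proj_eqI[OF assms y orth])
  qed
  have in_S: "orth_proj S x \<in> S" for x
    unfolding P using B assms by (intro subspace_sum subspace_scale) auto
  have id: "orth_proj S x = x" if "x \<in> S" for x
    using assms that by (intro orth_proj_eqI) (auto simp: orthogonal_def)
  have "orth_proj S ` UNIV = S"
  proof (intro equalityI subsetI)
    show "x \<in> orth_proj S ` UNIV" if "x \<in> S" for x using id[OF that] by (metis rangeI)
  qed (use in_S in auto)
  moreover have "orth_proj S x \<bullet> y = x \<bullet> y" if "y \<in> S" for x y
    using orth[OF that, of x] unfolding P by (simp add: orthogonal_def inner_diff_left)
  ultimately show ?thesis using fin B(5) P B(3) id by (intro that)
qed

lemma orth_proj_in: "subspace S \<Longrightarrow> orth_proj S x \<in> S"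
  by (rule orth_proj_exists[of S]) auto

lemma orth_proj_id: "subspace S \<Longrightarrow> x \<in> S \<Longrightarrow> orth_proj S x = x"
  by (rule orth_proj_exists[of S]) auto

lemma orth_proj_inner_eq: "subspace S \<Longrightarrow> y \<in> S \<Longrightarrow> orth_proj S x \<bullet> y = x \<bullet> y"
  by (rule orth_proj_exists[of S]) auto

lemma linear_orth_proj:
  assumes "subspace S"
  shows "linear (orth_proj S)"
proof -
  obtain B where "\<And>x. orth_proj S x = (\<Sum>b\<in>B. (b \<bullet> x) *\<^sub>R b)"
    by (rule orth_proj_exists[OF assms]) blast
  then have "orth_proj S = (\<lambda>x. \<Sum>b\<in>B. (b \<bullet> x) *\<^sub>R b)" by auto
  then show ?thesis
    by (simp only:) (intro linear_compose_sum ballI linearI; simp add: algebra_simps)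
qed

lemma orth_proj_inner:
  assumes "subspace S"
  shows "orth_proj S x \<bullet> y = orth_proj S x \<bullet> orth_proj S y"
    and "x \<bullet> orth_proj S y = orth_proj S x \<bullet> orth_proj S y"
proof -
  show 1: "x \<bullet> orth_proj S y = orth_proj S x \<bullet> orth_proj S y" for x y
    using orth_proj_inner_eq[OF assms orth_proj_in[OF assms], of x y] by simp
  show "orth_proj S x \<bullet> y = orth_proj S x \<bullet> orth_proj S y"
    using 1[of y x] by (simp add: inner_commute)
qed

lemma norm_orth_proj_le:
  assumes "subspace S"
  shows "norm (orth_proj S x) \<le> norm x"
proof -
  have "norm (orth_proj S x) * norm (orth_proj S x) \<le> norm (orth_proj S x) * norm x"
    using orth_proj_inner(1)[OF assms, of x x] norm_cauchy_schwarz[of "orth_proj S x" x]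
    by (simp add: norm_eq_sqrt_inner)
  then show ?thesis by (cases "orth_proj S x = 0") auto
qed

section \<open>Projections as matrices and compactness of the Grassmannian\<close>

lemma trace_matrix: "trace (matrix f) = (\<Sum>i\<in>UNIV. f (axis i 1) \<bullet> axis i 1)"
  by (simp add: trace_def matrix_def inner_axis)

lemma trace_orth_proj:
  fixes S :: "(real^'n) set"
  assumes "subspace S"
  shows "(\<Sum>i\<in>(UNIV::'n set). orth_proj S (axis i 1) \<bullet> axis i 1) = real (dim S)"
proof -
  obtain B where B: "finite B" "card B = dim S" "\<And>x. orth_proj S x = (\<Sum>b\<in>B. (b \<bullet> x) *\<^sub>R b)"
    "\<And>b. b \<in> B \<Longrightarrow> norm b = 1"
    by (rule orth_proj_exists[OF assms]) blast
  have "(\<Sum>i\<in>(UNIV::'n set). orth_proj S (axis i 1) \<bullet> axis i 1) =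
      (\<Sum>i\<in>(UNIV::'n set). \<Sum>b\<in>B. b $ i * b $ i)"
    by (simp add: B inner_sum_left inner_axis)
  also have "\<dots> = (\<Sum>b\<in>B. \<Sum>i\<in>(UNIV::'n set). b $ i * b $ i)"
    by (rule sum.swap)
  also have "\<dots> = (\<Sum>b\<in>B. 1)"
    by (rule sum.cong) (use B(4) in \<open>auto simp: norm_eq_1 inner_vec_def\<close>)
  finally show ?thesis using B(2) by simp
qed

lemma lin_inner_eq:
  fixes D :: "real^'n \<Rightarrow> real^'n"
  assumes "linear D"
  shows "lin_inner D P = (\<Sum>i\<in>UNIV. P (axis i 1) \<bullet> D (axis i 1))"
  unfolding lin_inner_def trace_matrix o_def
  by (simp add: adjoint_works[OF assms] adjoint_clauses[OF assms])

text \<open>A symmetric idempotent matrix is the orthogonal projection onto its range, and its trace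
  is the dimension of that range. This describes the image of the Grassmannian by closed
  equations.\<close>

lemma proj_matrices_eq:
  "(\<lambda>S. matrix (orth_proj S)) ` grassmannian m =
    {A :: real^'n^'n. A ** A = A \<and> transpose A = A \<and> trace A = real m}"
proof (intro equalityI subsetI)
  fix A :: "real^'n^'n" assume "A \<in> (\<lambda>S. matrix (orth_proj S)) ` grassmannian m"
  then obtain S where S: "subspace S" "dim S = m" and A: "A = matrix (orth_proj S)"
    by (auto simp: grassmannian_def)
  have lin: "linear (orth_proj S)" by (rule linear_orth_proj[OF S(1)])
  have "orth_proj S \<circ> orth_proj S = orth_proj S"
    using orth_proj_id[OF S(1) orth_proj_in[OF S(1)]] by (auto simp: fun_eq_iff)
  then have "A ** A = A" unfolding A by (metis lin matrix_compose)
  moreover have "transpose A = A"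
  proof -
    have "orth_proj S (axis i 1) $ j = orth_proj S (axis j 1) $ i" for i j
      using orth_proj_inner[OF S(1), of "axis i 1" "axis j 1"] orth_proj_inner[OF S(1), of "axis j 1" "axis i 1"]
      by (simp add: inner_axis inner_axis' inner_commute)
    then show ?thesis unfolding A by (simp add: vec_eq_iff transpose_def matrix_def)
  qed
  moreover have "trace A = real m"
    unfolding A trace_matrix using trace_orth_proj[OF S(1)] S(2) by simp
  ultimately show "A \<in> {A. A ** A = A \<and> transpose A = A \<and> trace A = real m}" by simp
next
  fix A :: "real^'n^'n" assume "A \<in> {A. A ** A = A \<and> transpose A = A \<and> trace A = real m}"
  then have A: "A ** A = A" "transpose A = A" "trace A = real m" by auto
  define S where "S = range ((*v) A)"
  have S: "subspace S" unfolding S_def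
    by (intro linear_subspace_image subspace_UNIV matrix_vector_mul_linear)
  have "orth_proj S x = A *v x" for x
  proof (rule orth_proj_eqI[OF S])
    show "A *v x \<in> S" by (simp add: S_def)
    fix v assume "v \<in> S"
    then obtain y where "v = A *v y" by (auto simp: S_def)
    moreover have sym: "z \<bullet> (A *v y) = (A *v z) \<bullet> y" for z
      using dot_lmul_matrix[of z A y] transpose_matrix_vector[of A z] A(2) by simp
    moreover have "A *v (A *v x) = A *v x"
      by (simp add: matrix_vector_mul_assoc A(1))
    ultimately show "orthogonal (x - A *v x) v"
      unfolding orthogonal_def inner_diff_left using sym[of x] sym[of "A *v x"] by simp
  qed
  then have P: "orth_proj S = (*v) A" by auto
  then have m: "A = matrix (orth_proj S)" by simp
  then have "real (dim S) = real m"
    using trace_orth_proj[OF S] A(3) trace_matrix[of "orth_proj S"] by simp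
  then show "A \<in> (\<lambda>S. matrix (orth_proj S)) ` grassmannian m"
    using S m by (auto simp: grassmannian_def)
qed

text \<open>Closedness is visible from the equations; boundedness holds since projections do not
  increase norms, so that all columns have norm at most 1.\<close>

lemma compact_proj_matrices:
  "compact {A :: real^'n^'n. A ** A = A \<and> transpose A = A \<and> trace A = real m}"
    (is "compact ?P")
proof (subst compact_eq_bounded_closed, intro conjI)
  have "norm (A *v x) \<le> norm x" if "A \<in> ?P" for A :: "real^'n^'n" and x
  proof -
    obtain S where "subspace S" "A = matrix (orth_proj S)"
      using \<open>A \<in> ?P\<close> unfolding proj_matrices_eq[symmetric] by (auto simp: grassmannian_def)
    then show ?thesis
      using norm_orth_proj_le[of S x] matrix_works[of "orth_proj S" x] linear_orth_proj[of S]
      by (simp add: scalar_mult_eq_scaleR)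
  qed
  then have col: "norm (column i A) \<le> 1" if "A \<in> ?P" for A :: "real^'n^'n" and i
    using \<open>\<And>x A. A \<in> ?P \<Longrightarrow> norm (A *v x) \<le> norm x\<close>[OF that, of "axis i 1"]
    by (simp add: matrix_vector_mult_basis)
  have "norm A \<le> (\<Sum>i\<in>(UNIV::'n set). \<Sum>j\<in>(UNIV::'n set). 1)" if "A \<in> ?P" for A :: "real^'n^'n"
  proof -
    have "\<bar>A $ i $ j\<bar> \<le> 1" for i j
      using col[OF that, of j] component_le_norm_cart[of "column j A" i] by (simp add: column_def)
    then have "norm (A $ i) \<le> (\<Sum>j\<in>(UNIV::'n set). 1)" for i
      by (intro order_trans[OF norm_le_l1_cart] sum_mono) auto
    then show ?thesis
      unfolding norm_vec_def[of A]
      by (intro order_trans[OF L2_set_le_sum] sum_mono) auto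
  qed
  then show "bounded ?P" unfolding bounded_iff by blast
  have "closed {A :: real^'n^'n. A ** A = A}" "closed {A :: real^'n^'n. transpose A = A}"
    "closed {A :: real^'n^'n. trace A = real m}"
    unfolding matrix_matrix_mult_def transpose_def trace_def
    by (intro closed_Collect_eq continuous_intros)+
  then show "closed ?P" by (auto intro!: closed_Collect_conj)
qed

text \<open>Open sets of a pullback topology are preimages, so a cover of the Grassmannian comes
  from a cover of the compact set of matrices. For compact \<open>K\<close> the product with the
  Grassmannian is then compact, and the weight is finite on \<open>K\<close>.\<close>

lemma compact_space_grassmann: "compact_space (grassmann_topology m :: (real^'n) set topology)"
proof -
  let ?f = "\<lambda>S::(real^'n) set. matrix (orth_proj S)"
  have ts: "topspace (grassmann_topology m :: (real^'n) set topology) = grassmannian m"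
    by (simp add: grassmann_topology_def topspace_pullback_topology)
  have "compactin (grassmann_topology m) (grassmannian m :: (real^'n) set set)"
    unfolding compactin_def
  proof (intro conjI allI impI)
    fix \<U> :: "(real^'n) set set set" assume \<U>: "Ball \<U> (openin (grassmann_topology m)) \<and> grassmannian m \<subseteq> \<Union> \<U>"
    then have "\<forall>W\<in>\<U>. \<exists>Q. open Q \<and> W = ?f -` Q \<inter> grassmannian m"
      by (simp add: grassmann_topology_def openin_pullback_topology)
    then obtain g where g: "\<And>W. W \<in> \<U> \<Longrightarrow> open (g W)" "\<And>W. W \<in> \<U> \<Longrightarrow> W = ?f -` g W \<inter> grassmannian m"
      by metis
    have "compact (?f ` grassmannian m)"
      unfolding proj_matrices_eq by (rule compact_proj_matrices)
    moreover have "?f ` grassmannian m \<subseteq> \<Union> (g ` \<U>)" using \<U> g by blast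
    ultimately obtain D where "D \<subseteq> g ` \<U>" "finite D" "?f ` grassmannian m \<subseteq> \<Union> D"
      using g(1) by (elim compactE) auto
    then obtain F where F: "F \<subseteq> \<U>" "finite F" "D = g ` F" by (meson finite_subset_image)
    then have "grassmannian m \<subseteq> \<Union> F" using g(2) \<open>?f ` grassmannian m \<subseteq> \<Union> D\<close> by blast
    then show "\<exists>F. finite F \<and> F \<subseteq> \<U> \<and> grassmannian m \<subseteq> \<Union> F" using F by blast
  qed (simp add: ts)
  then show ?thesis unfolding compact_space_def ts .
qed

section \<open>Integration with respect to a varifold\<close>

lemma openin_sets_borel_of:
  assumes "openin Y A"
  shows "A \<in> sets (borel_of Y)"
proof -
  have "{A. openin Y A} \<subseteq> Pow (topspace Y)" using openin_subset by blast
  then show ?thesis unfolding borel_of_def using assms by (simp add: sets_measure_of)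
qed

locale varifold_in_open =
  fixes m :: nat and U :: "(real^'n) set" and V :: "((real^'n) \<times> (real^'n) set) measure"
  assumes open_U: "open U" and varifold_V: "varifold m U V"
begin

abbreviation W :: "(real^'n) measure" where "W \<equiv> weight U V"
abbreviation T :: "(real^'n) set" where "T \<equiv> spt U W"
abbreviation X :: "((real^'n) \<times> (real^'n) set) topology" where
  "X \<equiv> prod_topology (top_of_set U) (grassmann_topology m)"

lemma topspace_grassmann: "topspace (grassmann_topology m :: (real^'n) set topology) = grassmannian m"
  by (simp add: grassmann_topology_def topspace_pullback_topology)

lemma space_V: "space V = U \<times> grassmannian m"
  and sets_V: "sets V = sets (borel_of X)"
  using varifold_V by (auto simp: varifold_def radon_measure_def topspace_grassmann)

lemma openin_sets_V: "openin X A \<Longrightarrow> A \<in> sets V"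
  by (simp only: sets_V openin_sets_borel_of)

lemma continuous_measurable_V:
  fixes f :: "_ \<Rightarrow> 'b::topological_space"
  assumes "continuous_map X euclidean f"
  shows "f \<in> borel_measurable V"
proof (rule borel_measurableI)
  fix S :: "'b set" assume "open S"
  then have "openin X {x \<in> topspace X. f x \<in> S}"
    by (intro openin_continuous_map_preimage[OF assms]) simp
  moreover have "{x \<in> topspace X. f x \<in> S} = f -` S \<inter> space V"
    by (auto simp: space_V topspace_grassmann)
  ultimately show "f -` S \<inter> space V \<in> sets V"
    using openin_sets_V[of "{x \<in> topspace X. f x \<in> S}"] by (simp only:)
qed

lemma fst_measurable: "fst \<in> V \<rightarrow>\<^sub>M borel_of (top_of_set U)"
  unfolding borel_of_def
proof (rule measurable_measure_of)
  show "{A. openin (top_of_set U) A} \<subseteq> Pow (topspace (top_of_set U))"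
    using openin_subset by blast
  show "fst \<in> space V \<rightarrow> topspace (top_of_set U)" by (auto simp: space_V)
  fix A assume "A \<in> {A. openin (top_of_set U) A}"
  then have "openin X {x \<in> topspace X. fst x \<in> A}"
    by (intro openin_continuous_map_preimage[OF continuous_map_fst]) simp
  moreover have "{x \<in> topspace X. fst x \<in> A} = fst -` A \<inter> space V"
    by (auto simp: space_V topspace_grassmann)
  ultimately show "fst -` A \<inter> space V \<in> sets V"
    using openin_sets_V[of "{x \<in> topspace X. fst x \<in> A}"] by (simp only:)
qed

lemma space_borel_of_U: "space (borel_of (top_of_set U)) = U"
  by (simp add: borel_of_def space_measure_of_conv)

lemma space_W: "space W = U"
  by (simp add: weight_def space_borel_of_U)

lemma sets_W: "sets W = sets (borel_of (top_of_set U))"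
  by (simp add: weight_def)

lemma fst_measurable_W: "fst \<in> V \<rightarrow>\<^sub>M W"
  using fst_measurable by (simp only: measurable_cong_sets[OF refl sets_W])

lemma id_measurable_borel_of: "(\<lambda>x. x) \<in> borel_measurable (borel_of (top_of_set U))"
proof (rule borel_measurableI)
  fix S :: "(real^'n) set" assume "open S"
  then have "openin (top_of_set U) (U \<inter> S)" by auto
  then show "(\<lambda>x. x) -` S \<inter> space (borel_of (top_of_set U)) \<in> sets (borel_of (top_of_set U))"
    using openin_sets_borel_of by (simp add: space_borel_of_U Int_commute)
qed

lemma borel_in_sets: "A \<in> sets borel \<Longrightarrow> A \<subseteq> U \<Longrightarrow> A \<in> sets (borel_of (top_of_set U))"
  using measurable_sets[OF id_measurable_borel_of, of A]
  by (simp add: space_borel_of_U Int_absorb2)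

lemma borel_in_sets_W: "A \<in> sets borel \<Longrightarrow> A \<subseteq> U \<Longrightarrow> A \<in> sets W"
  using borel_in_sets by (simp add: sets_W)

lemma borel_measurable_W: "f \<in> borel_measurable borel \<Longrightarrow> f \<in> borel_measurable W"
  using measurable_compose[OF id_measurable_borel_of, of f] by (simp only: measurable_cong_sets[OF sets_W refl])

lemma emeasure_W: "A \<in> sets W \<Longrightarrow> emeasure W A = emeasure V (fst -` A \<inter> space V)"
  unfolding weight_def by (rule emeasure_distr[OF fst_measurable]) simp

lemma compact_emeasure_finite:
  assumes "compact K" "K \<subseteq> U"
  shows "emeasure W K < \<infinity>" and "emeasure V (K \<times> grassmannian m) < \<infinity>"
    and "K \<times> grassmannian m \<in> sets V"
proof -
  have eq: "fst -` K \<inter> space V = K \<times> grassmannian m" using assms by (auto simp: space_V)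
  have K: "K \<in> sets W" using assms by (intro borel_in_sets_W) (auto intro: borel_closed compact_imp_closed)
  have "compactin X (K \<times> grassmannian m)"
    using assms compact_space_grassmann[of m, where 'n='n]
    by (simp add: compactin_Times compactin_subtopology compact_space_def topspace_grassmann)
  then show 2: "emeasure V (K \<times> grassmannian m) < \<infinity>"
    using varifold_V by (auto simp: varifold_def radon_measure_def)
  then show "emeasure W K < \<infinity>" by (simp add: emeasure_W[OF K] eq)
  show "K \<times> grassmannian m \<in> sets V"
    using measurable_sets[OF fst_measurable_W K] by (simp add: eq)
qed

lemma integral_W:
  fixes f :: "real^'n \<Rightarrow> real"
  shows "f \<in> borel_measurable borel \<Longrightarrow> (\<integral>x. f x \<partial>W) = (\<integral>p. f (fst p) \<partial>V)"
  unfolding weight_def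
  by (rule integral_distr[OF fst_measurable measurable_compose[OF id_measurable_borel_of]])

lemma integrable_W_V:
  fixes f :: "real^'n \<Rightarrow> real"
  shows "f \<in> borel_measurable borel \<Longrightarrow> integrable W f = integrable V (\<lambda>p. f (fst p))"
  unfolding weight_def
  by (rule integrable_distr_eq[OF fst_measurable measurable_compose[OF id_measurable_borel_of]])

lemma integrable_W:
  fixes f :: "real^'n \<Rightarrow> real"
  assumes "f \<in> borel_measurable borel" "compact K" "K \<subseteq> U" "\<And>x. x \<notin> K \<Longrightarrow> f x = 0" "\<And>x. \<bar>f x\<bar> \<le> B"
  shows "integrable W f"
proof (rule Bochner_Integration.integrable_bound)
  have "K \<in> sets W" using assms by (intro borel_in_sets_W) (auto intro: borel_closed compact_imp_closed)
  then show "integrable W (\<lambda>x. B * indicator K x)"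
    using compact_emeasure_finite(1)[OF assms(2,3)] by (intro integrable_mult_right integrable_real_indicator)
  show "f \<in> borel_measurable W" by (rule borel_measurable_W[OF assms(1)])
  show "AE x in W. norm (f x) \<le> norm (B * indicator K x)"
  proof (rule AE_I2)
    fix x
    show "norm (f x) \<le> norm (B * indicator K x)"
      using assms(4)[of x] assms(5)[of x] by (cases "x \<in> K") auto
  qed
qed

lemma integrable_V:
  fixes f :: "_ \<Rightarrow> real"
  assumes "f \<in> borel_measurable V" "compact K" "K \<subseteq> U"
    "\<And>p. p \<in> space V \<Longrightarrow> fst p \<notin> K \<Longrightarrow> f p = 0" "\<And>p. p \<in> space V \<Longrightarrow> \<bar>f p\<bar> \<le> B"
  shows "integrable V f"
proof (rule Bochner_Integration.integrable_bound)
  show "integrable V (\<lambda>p. B * indicator (K \<times> grassmannian m) p)"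
    using compact_emeasure_finite[OF assms(2,3)] by (intro integrable_mult_right integrable_real_indicator)
  show "f \<in> borel_measurable V" by fact
  show "AE p in V. norm (f p) \<le> norm (B * indicator (K \<times> grassmannian m) p)"
  proof (rule AE_I2)
    fix p assume p: "p \<in> space V"
    show "norm (f p) \<le> norm (B * indicator (K \<times> grassmannian m) p)"
      using p assms(4)[OF p] assms(5)[OF p]
      by (cases "fst p \<in> K") (auto simp: space_V indicator_def)
  qed
qed

text \<open>The complement is an arbitrary union of null open sets; the Lindelof property reduces it
  to a countable one.\<close>

lemma emeasure_outside_spt: "U - T \<in> null_sets W"
proof -
  define \<G> where "\<G> = {G. open G \<and> G \<subseteq> U \<and> emeasure W G = 0}"
  obtain \<G>' where G: "\<G>' \<subseteq> \<G>" "countable \<G>'" "\<Union>\<G>' = \<Union>\<G>"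
    using Lindelof[of \<G>] by (auto simp: \<G>_def)
  have "(\<Union>G\<in>\<G>'. G) \<in> null_sets W"
    using G(1,2) by (intro null_sets_UN') (auto simp: \<G>_def null_sets_def intro!: borel_in_sets_W)
  moreover have "U - T = \<Union>\<G>" by (auto simp: spt_def \<G>_def)
  ultimately show ?thesis using G(3) by simp
qed

lemma spt_subset: "T \<subseteq> U" by (auto simp: spt_def)

lemma open_compl_spt: "open (U - T)"
proof -
  have "U - T = \<Union>{G. open G \<and> G \<subseteq> U \<and> emeasure W G = 0}" by (auto simp: spt_def)
  then show ?thesis by (simp only:) (rule open_Union, blast)
qed

lemma spt_inter_compact:
  assumes "compact K" "K \<subseteq> U"
  shows "compact (K \<inter> T)"
proof -
  have "K \<inter> T = K - (U - T)" using assms spt_subset by auto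
  moreover have "compact (K - (U - T))" by (intro compact_diff assms open_compl_spt)
  ultimately show ?thesis by (simp only:)
qed

lemma spt_borel: "T \<in> sets borel"
proof -
  have "U - (U - T) \<in> sets borel" by (intro sets.Diff borel_open open_U open_compl_spt)
  moreover have "U - (U - T) = T" using spt_subset by auto
  ultimately show ?thesis by (simp only:)
qed

lemma spt_emeasure_pos: "x \<in> T \<Longrightarrow> open G \<Longrightarrow> x \<in> G \<Longrightarrow> G \<subseteq> U \<Longrightarrow> emeasure W G > 0"
  by (auto simp: spt_def zero_less_iff_neq_zero)

text \<open>This makes pointwise estimates at points of the support enough under the integral over
  \<open>V\<close>; the gradient bound in \<open>smooth_cutoff\<close> gives no more.\<close>

lemma AE_V_spt: "AE p in V. p \<in> space V \<and> fst p \<in> T"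
proof -
  have "emeasure V (fst -` (U - T) \<inter> space V) = 0"
    using emeasure_outside_spt emeasure_W[of "U - T"] by (auto simp: null_sets_def)
  moreover have "fst -` (U - T) \<inter> space V \<in> sets V"
    using emeasure_outside_spt by (intro measurable_sets[OF fst_measurable_W]) auto
  ultimately have "fst -` (U - T) \<inter> space V \<in> null_sets V" by auto
  then show ?thesis
    by (rule AE_I') (auto simp: space_V)
qed

lemma emeasure_Int_spt:
  assumes "A \<in> sets W"
  shows "emeasure W (A \<inter> T) = emeasure W A"
proof -
  have "A \<inter> T = A - (U - T)"
    using sets.sets_into_space[OF assms] by (auto simp: space_W)
  then show ?thesis using emeasure_Diff_null_set[OF emeasure_outside_spt assms] by simp
qed

lemma orth_proj_continuous: "continuous_map X euclidean (\<lambda>p. orth_proj (snd p) v)"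
proof -
  have "continuous_map (grassmann_topology m) euclidean (\<lambda>S. matrix (orth_proj S) :: real^'n^'n)"
    unfolding grassmann_topology_def
    using continuous_map_pullback[OF continuous_map_id] by (simp add: o_def)
  moreover have "continuous_map euclidean euclidean (\<lambda>A::real^'n^'n. A *v v)"
    by (simp add: matrix_vector_mult_def) (intro continuous_intros)
  ultimately have "continuous_map (grassmann_topology m) euclidean (\<lambda>S. matrix (orth_proj S) *v v)"
    using continuous_map_compose[of _ _ "\<lambda>S. matrix (orth_proj S)" euclidean "\<lambda>A. A *v v"]
    unfolding o_def by (simp only:)
  then have "continuous_map (grassmann_topology m) euclidean (\<lambda>S::(real^'n) set. orth_proj S v)"
    by (rule continuous_map_eq)
      (auto simp: topspace_grassmann grassmannian_def linear_orth_proj linear_matrix_vector_mul_eq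
         intro!: matrix_works)
  from continuous_map_compose[OF continuous_map_snd this] show ?thesis unfolding o_def .
qed

lemma continuous_map_fst_compose:
  fixes f :: "real^'n \<Rightarrow> 'b::topological_space"
  assumes "continuous_on UNIV f"
  shows "continuous_map X euclidean (\<lambda>p. f (fst p))"
proof -
  have "continuous_map (top_of_set U) euclidean f"
    using assms by (auto intro: continuous_on_subset)
  from continuous_map_compose[OF continuous_map_fst this] show ?thesis unfolding o_def .
qed

text \<open>A nonintegrable function has Bochner integral 0, so no inequality between integrands
  could be integrated without this.\<close>

lemma first_variation_integrable:
  assumes "g \<in> test_fields U"
  shows "integrable V (\<lambda>p. lin_inner (frechet_derivative g (at (fst p))) (orth_proj (snd p)))"
proof -
  let ?K = "closure {x. g x \<noteq> 0}"
  let ?D = "\<lambda>x. frechet_derivative g (at x)"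
  have K: "compact ?K" "?K \<subseteq> U" and Ck: "\<And>k. C_k_on k g UNIV"
    using assms by (auto simp: test_fields_def)
  have der: "(g has_derivative ?D x) (at x)" for x
    using Ck[of 1] by (simp add: frechet_derivative_works)
  have cont: "continuous_on UNIV (\<lambda>x. ?D x v)" for v
    using Ck[of 1] by simp
  have D0: "?D x = (\<lambda>v. 0)" if "x \<notin> ?K" for x
  proof -
    have "(g has_derivative (\<lambda>v. 0)) (at x)"
      by (rule has_derivative_transform_within_open[where s = "- ?K" and f = "\<lambda>_. 0"])
        (use that closure_subset[of "{x. g x \<noteq> 0}"] in auto)
    then show ?thesis by (rule has_derivative_unique[OF der])
  qed
  have lin: "linear (?D x)" for x by (rule has_derivative_linear[OF der])
  have eq: "lin_inner (?D (fst p)) (orth_proj (snd p)) =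
      (\<Sum>i\<in>UNIV. orth_proj (snd p) (axis i 1) \<bullet> ?D (fst p) (axis i 1))" for p
    by (rule lin_inner_eq[OF lin])
  have "\<exists>B. \<forall>x. norm (?D x (axis i 1)) \<le> B" for i
  proof -
    have "bounded ((\<lambda>x. ?D x (axis i 1)) ` ?K)"
      by (intro compact_imp_bounded compact_continuous_image K continuous_on_subset[OF cont]) auto
    then obtain B where "\<forall>x\<in>?K. norm (?D x (axis i 1)) \<le> B" by (auto simp: bounded_iff)
    then have "norm (?D x (axis i 1)) \<le> max B 0" for x
      using D0[of x] by (cases "x \<in> ?K") auto
    then show ?thesis by blast
  qed
  then obtain B where B: "\<And>i x. norm (?D x (axis i 1)) \<le> B i" by metis
  have "integrable V (\<lambda>p. \<Sum>i\<in>UNIV. orth_proj (snd p) (axis i 1) \<bullet> ?D (fst p) (axis i 1))"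
  proof (rule Bochner_Integration.integrable_sum, rule integrable_V[OF _ K])
    fix i
    have [measurable]: "(\<lambda>p. orth_proj (snd p) (axis i 1)) \<in> borel_measurable V"
      by (rule continuous_measurable_V[OF orth_proj_continuous])
    have [measurable]: "(\<lambda>p. ?D (fst p) (axis i 1)) \<in> borel_measurable V"
      by (rule continuous_measurable_V[OF continuous_map_fst_compose[OF cont]])
    show "(\<lambda>p. orth_proj (snd p) (axis i 1) \<bullet> ?D (fst p) (axis i 1)) \<in> borel_measurable V"
      by measurable
    show "orth_proj (snd p) (axis i 1) \<bullet> ?D (fst p) (axis i 1) = 0" if "fst p \<notin> ?K" for p
      using D0[OF that] by simp
    show "\<bar>orth_proj (snd p) (axis i 1) \<bullet> ?D (fst p) (axis i 1)\<bar> \<le> 1 * B i"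
      if "p \<in> space V" for p
    proof -
      have "norm (orth_proj (snd p) (axis i 1 :: real^'n)) \<le> 1"
        using norm_orth_proj_le[of "snd p" "axis i 1"] that by (auto simp: space_V grassmannian_def)
      then show ?thesis
        by (intro order_trans[OF Cauchy_Schwarz_ineq2] mult_mono B) auto
    qed
  qed
  then show ?thesis by (simp only: eq)
qed

end

section \<open>Chains and Lipschitzian curves\<close>

text \<open>Consecutive points lie in \<open>K\<close>, but the segments between them may leave it;
  only in the limit \<open>\<delta> \<rightarrow> 0\<close> do chains yield curves in
  \<open>K\<close>. The last argument is the total length.\<close>

inductive chain :: "'a::metric_space set \<Rightarrow> real \<Rightarrow> 'a \<Rightarrow> 'a \<Rightarrow> real \<Rightarrow> bool"
  for K :: "'a set" and \<delta> :: real and a :: 'a where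
  chain_refl: "a \<in> K \<Longrightarrow> chain K \<delta> a a 0"
| chain_step: "chain K \<delta> a p l \<Longrightarrow> q \<in> K \<Longrightarrow> dist p q < \<delta> \<Longrightarrow> chain K \<delta> a q (l + dist p q)"

lemma chain_props:
  assumes "chain K \<delta> a p l"
  shows "a \<in> K" "p \<in> K" "dist a p \<le> l" "0 \<le> l"
  using assms
proof (induction rule: chain.induct)
  case (chain_step p l q)
  { case 3 show ?case using chain_step dist_triangle[of a q p] by linarith }
  { case 4 show ?case using chain_step zero_le_dist[of p q] by linarith }
qed auto

lemma chain_trans:
  assumes "chain K \<delta> b c k" "chain K \<delta> a b l"
  shows "chain K \<delta> a c (l + k)"
  using assms
proof (induction rule: chain.induct)
  case (chain_step p k q)
  then show ?case
    using chain.chain_step[of K \<delta> a p "l + k" q] by (simp add: add.assoc)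
qed simp

lemma chain_single:
  assumes "a \<in> K" "b \<in> K" "dist a b < \<delta>"
  shows "chain K \<delta> a b (dist a b)"
  using chain_step[OF chain_refl[OF assms(1)] assms(2,3)] by simp

lemma chain_sym:
  assumes "chain K \<delta> a b l" "\<delta> > 0"
  shows "chain K \<delta> b a l"
  using assms
proof (induction rule: chain.induct)
  case (chain_step p l q)
  have "chain K \<delta> q p (dist q p)"
    using chain_step chain_props(2) by (intro chain_single) (auto simp: dist_commute)
  then show ?case
    using chain_trans[of K \<delta> p a l q "dist q p"] chain_step by (simp add: dist_commute add.commute)
qed (rule chain_refl)

text \<open>A chain of length \<open>l\<close> never leaves \<open>cball a l\<close>, so only that
  part of \<open>K\<close> matters. This confines chains to compact balls; enlarging
  \<open>\<delta>\<close> compares different scales.\<close>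

lemma chain_mono:
  assumes "chain K \<delta> a b l" "K \<inter> cball a l \<subseteq> K'" "\<delta> \<le> \<delta>'"
  shows "chain K' \<delta>' a b l"
  using assms
proof (induction rule: chain.induct)
  case (chain_step p l q)
  have l: "l \<le> l + dist p q" by simp
  have "q \<in> cball a (l + dist p q)"
    using chain_props(3)[OF chain.chain_step[OF chain_step(1-3)]] by simp
  moreover have "K \<inter> cball a l \<subseteq> K'" using chain_step.prems(1) subset_cball[OF l, of a] by blast
  ultimately show ?case using chain_step by (intro chain.chain_step) auto
qed (auto intro: chain_refl)

text \<open>The step function waits at each point until the time equals the length of the chain
  including the next step, and only then jumps. It thus lags behind by a single step, which is
  shorter than \<open>\<delta>\<close>.\<close>

lemma chain_curve:
  assumes "chain K \<delta> a b l" "\<delta> > 0"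
  shows "\<exists>\<gamma> :: real \<Rightarrow> 'a::metric_space. \<gamma> 0 = a \<and> (\<forall>t\<ge>l. \<gamma> t = b) \<and> (\<forall>t. \<gamma> t \<in> K) \<and>
    (\<forall>s t. s \<le> t \<longrightarrow> dist (\<gamma> s) (\<gamma> t) \<le> t - s + \<delta>)"
  using assms
proof (induction rule: chain.induct)
  case chain_refl
  then show ?case by (intro exI[of _ "\<lambda>_. a"]) auto
next
  case (chain_step p l q)
  then obtain \<gamma> where \<gamma>: "\<gamma> 0 = a" "\<forall>t\<ge>l. \<gamma> t = p" "\<forall>t. \<gamma> t \<in> K"
    "\<forall>s t. s \<le> t \<longrightarrow> dist (\<gamma> s) (\<gamma> t) \<le> t - s + \<delta>" by blast
  define \<gamma>' where "\<gamma>' t = (if t < l + dist p q then \<gamma> t else q)" for t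
  have l: "l \<ge> 0" using chain_props(4)[OF chain_step(1)] .
  have "\<gamma>' 0 = a"
  proof (cases "0 < l + dist p q")
    case False
    then have "l = 0" "dist p q = 0" using l zero_le_dist[of p q] by linarith+
    then show ?thesis using \<gamma> by (auto simp: \<gamma>'_def)
  qed (simp add: \<gamma>'_def \<gamma>)
  moreover have "dist (\<gamma>' s) (\<gamma>' t) \<le> t - s + \<delta>" if st: "s \<le> t" for s t
  proof -
    consider "t < l + dist p q" | "l + dist p q \<le> s" | "s < l + dist p q" "l + dist p q \<le> t" "s < l"
      | "s < l + dist p q" "l + dist p q \<le> t" "l \<le> s" by linarith
    then show ?thesis
    proof cases
      case 1 then show ?thesis using \<gamma>(4) st by (simp add: \<gamma>'_def)
    next
      case 2 then show ?thesis using st \<open>\<delta> > 0\<close> by (simp add: \<gamma>'_def)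
    next
      case 3
      have "dist (\<gamma> s) (\<gamma> l) \<le> l - s + \<delta>" using \<gamma>(4) 3(3) by simp
      then have "dist (\<gamma> s) q \<le> l - s + \<delta> + dist p q"
        using dist_triangle[of "\<gamma> s" q p] \<gamma>(2) by simp
      then show ?thesis using 3 by (simp add: \<gamma>'_def)
    next
      case 4
      then show ?thesis using \<gamma>(2) chain_step(3) st by (simp add: \<gamma>'_def)
    qed
  qed
  ultimately show ?case
    using \<gamma>(3) chain_step(2) by (intro exI[of _ \<gamma>']) (auto simp: \<gamma>'_def)
qed

text \<open>The almost 1-Lipschitz step functions along finer and finer chains form nested closed
  subsets of the compact product space \<open>K\<close> to the power \<open>{0..l}\<close>; a point in their
  intersection is the wanted curve.\<close>

lemma chains_imp_lipschitz_curve: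
  fixes K :: "'a::metric_space set"
  assumes "compact K" "0 \<le> l" and chains: "\<And>\<delta>. \<delta> > 0 \<Longrightarrow> \<exists>k\<le>l. chain K \<delta> a b k"
  shows "\<exists>\<gamma>. 1-lipschitz_on {0..l} \<gamma> \<and> \<gamma> ` {0..l} \<subseteq> K \<and> \<gamma> 0 = a \<and> \<gamma> l = b"
proof -
  define I where "I = {0..l}"
  define X where "X = product_topology (\<lambda>_. euclidean :: 'a topology) I"
  have I: "0 \<in> I" "l \<in> I" using \<open>0 \<le> l\<close> by (auto simp: I_def)
  define E where "E = (\<Pi>\<^sub>E t\<in>I. K)"
  define C where "C \<delta> = {\<gamma> \<in> topspace X. \<gamma> 0 \<in> {a} \<and> \<gamma> l \<in> {b} \<and>
     (\<forall>s\<in>I. \<forall>t\<in>I. dist (\<gamma> s) (\<gamma> t) \<in> {..\<bar>t - s\<bar> + \<delta>})}" for \<delta>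
  have E: "compactin X E"
    unfolding X_def E_def by (simp add: compactin_PiE assms(1))
  have proj: "continuous_map X euclidean (\<lambda>\<gamma>. \<gamma> t)" if "t \<in> I" for t
    unfolding X_def using that by (rule continuous_map_product_projection)
  have cl: "closedin X (C \<delta>)" for \<delta>
  proof -
    have "closedin X {\<gamma> \<in> topspace X. dist (\<gamma> s) (\<gamma> t) \<in> {..\<bar>t - s\<bar> + \<delta>}}" if "s \<in> I" "t \<in> I" for s t
      using continuous_map_mdist[of X euclidean_metric "\<lambda>\<gamma>. \<gamma> s" "\<lambda>\<gamma>. \<gamma> t"] proj that
      by (intro closedin_continuous_map_preimage[where Y = euclidean]) auto
    moreover have "closedin X {\<gamma> \<in> topspace X. \<gamma> t \<in> {c}}" if "t \<in> I" for t c
      by (rule closedin_continuous_map_preimage[OF proj[OF that]]) simp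
    moreover have "C \<delta> = {\<gamma> \<in> topspace X. \<gamma> 0 \<in> {a}} \<inter> {\<gamma> \<in> topspace X. \<gamma> l \<in> {b}} \<inter>
       (\<Inter>s\<in>I. \<Inter>t\<in>I. {\<gamma> \<in> topspace X. dist (\<gamma> s) (\<gamma> t) \<in> {..\<bar>t - s\<bar> + \<delta>}})"
      using I by (auto simp: C_def)
    ultimately show ?thesis using I by (auto intro!: closedin_Int closedin_INT)
  qed
  have ne: "E \<inter> C \<delta> \<noteq> {}" if "\<delta> > 0" for \<delta>
  proof -
    obtain k where k: "k \<le> l" "chain K \<delta> a b k" using chains[OF \<open>\<delta> > 0\<close>] by blast
    obtain \<gamma> where \<gamma>: "\<gamma> 0 = a" "\<And>t. t \<ge> k \<Longrightarrow> \<gamma> t = b" "\<And>t. \<gamma> t \<in> K"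
      "\<And>s t. s \<le> t \<Longrightarrow> dist (\<gamma> s) (\<gamma> t) \<le> t - s + \<delta>"
      using chain_curve[OF k(2) \<open>\<delta> > 0\<close>] by metis
    have "dist (\<gamma> s) (\<gamma> t) \<le> \<bar>t - s\<bar> + \<delta>" for s t
      using \<gamma>(4)[of s t] \<gamma>(4)[of t s] by (cases "s \<le> t") (auto simp: dist_commute)
    then have "restrict \<gamma> I \<in> E \<inter> C \<delta>"
      using \<gamma> k I by (auto simp: E_def C_def X_def)
    then show ?thesis by blast
  qed
  have "E \<inter> \<Inter> (C ` {0<..}) \<noteq> {}"
  proof (rule compactin_fip[THEN iffD1, OF E, THEN conjunct2, rule_format])
    show "Ball (C ` {0<..}) (closedin X) \<and> (\<forall>\<F>. finite \<F> \<and> \<F> \<subseteq> C ` {0<..} \<longrightarrow> E \<inter> \<Inter> \<F> \<noteq> {})"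
    proof (intro conjI ballI allI impI)
      fix \<F> assume "finite \<F> \<and> \<F> \<subseteq> C ` {0<..}"
      then obtain D where D: "D \<subseteq> {0<..}" "finite D" "\<F> = C ` D" by (meson finite_subset_image)
      have mono: "C \<delta> \<subseteq> C \<delta>'" if "\<delta> \<le> \<delta>'" for \<delta> \<delta>'
        using that by (fastforce simp: C_def)
      define d where "d = Min (insert 1 D)"
      have "d > 0" "\<And>\<delta>. \<delta> \<in> D \<Longrightarrow> d \<le> \<delta>" using D by (auto simp: d_def)
      then have "E \<inter> C d \<subseteq> E \<inter> \<Inter> \<F>" using mono D(3) by blast
      then show "E \<inter> \<Inter> \<F> \<noteq> {}" using ne[OF \<open>d > 0\<close>] by blast
    qed (use cl in auto)
  qed
  then obtain \<gamma> where \<gamma>: "\<gamma> \<in> E" "\<And>\<delta>. \<delta> > 0 \<Longrightarrow> \<gamma> \<in> C \<delta>" by auto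
  have "dist (\<gamma> s) (\<gamma> t) \<le> \<bar>t - s\<bar>" if "s \<in> I" "t \<in> I" for s t
  proof (rule field_le_epsilon)
    show "dist (\<gamma> s) (\<gamma> t) \<le> \<bar>t - s\<bar> + \<delta>" if "\<delta> > 0" for \<delta>
      using \<gamma>(2)[OF that] \<open>s \<in> I\<close> \<open>t \<in> I\<close> by (simp add: C_def)
  qed
  then have "1-lipschitz_on {0..l} \<gamma>"
    by (intro lipschitz_onI) (auto simp: I_def dist_real_def abs_minus_commute)
  moreover have "\<gamma> ` {0..l} \<subseteq> K" using \<gamma>(1) by (auto simp: E_def I_def)
  moreover have "\<gamma> 0 = a" "\<gamma> l = b" using \<gamma>(2)[of 1] by (auto simp: C_def)
  ultimately show ?thesis by blast
qed

text \<open>\<open>K\<close> and \<open>l\<close> are chosen before \<open>\<delta>\<close>, as the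
  compactness argument requires. Phrased by chains, the relation is transitive by concatenation, and
  its failure produces a scale without short chains.\<close>

definition chain_joined :: "'a::metric_space set \<Rightarrow> 'a \<Rightarrow> 'a \<Rightarrow> bool" where
  "chain_joined T a b \<longleftrightarrow> (\<exists>K l. compact K \<and> K \<subseteq> T \<and> (\<forall>\<delta>>0. \<exists>k\<le>l. chain K \<delta> a b k))"

lemma chain_joined_sym: "chain_joined T a b \<Longrightarrow> chain_joined T b a"
proof -
  assume "chain_joined T a b"
  then obtain K l where K: "compact K" "K \<subseteq> T" "\<forall>\<delta>>0. \<exists>k\<le>l. chain K \<delta> a b k"
    unfolding chain_joined_def by (elim exE conjE)
  have "\<exists>k\<le>l. chain K \<delta> b a k" if \<delta>: "\<delta> > 0" for \<delta>
  proof -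
    obtain k where "k \<le> l" "chain K \<delta> a b k" using K(3)[rule_format, OF \<delta>] by (elim exE conjE)
    then show ?thesis using chain_sym[of K \<delta> a b k] \<delta> by (intro exI[of _ k]) simp
  qed
  then show ?thesis
    unfolding chain_joined_def using K(1,2) by (intro exI[of _ K] exI[of _ l]) simp
qed

lemma chain_joined_trans:
  assumes "chain_joined T a b" "chain_joined T b c"
  shows "chain_joined T a c"
proof -
  obtain K1 l1 where 1: "compact K1" "K1 \<subseteq> T" "\<And>\<delta>. \<delta> > 0 \<Longrightarrow> \<exists>k\<le>l1. chain K1 \<delta> a b k"
    using assms(1) unfolding chain_joined_def by blast
  obtain K2 l2 where 2: "compact K2" "K2 \<subseteq> T" "\<And>\<delta>. \<delta> > 0 \<Longrightarrow> \<exists>k\<le>l2. chain K2 \<delta> b c k"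
    using assms(2) unfolding chain_joined_def by blast
  have "\<exists>k\<le>l1 + l2. chain (K1 \<union> K2) \<delta> a c k" if \<delta>: "\<delta> > 0" for \<delta>
  proof -
    obtain k1 k2 where k: "k1 \<le> l1" "chain K1 \<delta> a b k1" "k2 \<le> l2" "chain K2 \<delta> b c k2"
      using 1(3)[OF \<delta>] 2(3)[OF \<delta>] by blast
    have "chain (K1 \<union> K2) \<delta> a b k1" by (rule chain_mono[OF k(2)]) auto
    moreover have "chain (K1 \<union> K2) \<delta> b c k2" by (rule chain_mono[OF k(4)]) auto
    ultimately show ?thesis using chain_trans[of _ \<delta> b c k2 a k1] k(1,3) by (intro exI[of _ "k1 + k2"]) simp
  qed
  then show ?thesis
    unfolding chain_joined_def using 1(1,2) 2(1,2)
    by (intro exI[of _ "K1 \<union> K2"] exI[of _ "l1 + l2"] conjI) auto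
qed

lemma chain_joined_imp_lipschitz_curve:
  assumes "chain_joined T a b"
  shows "\<exists>(l::real) \<gamma>. 0 \<le> l \<and> 1-lipschitz_on {0..l} \<gamma> \<and> \<gamma> ` {0..l} \<subseteq> T \<and> \<gamma> 0 = a \<and> \<gamma> l = b"
proof -
  obtain K l where K: "compact K" "K \<subseteq> T" "\<And>\<delta>. \<delta> > 0 \<Longrightarrow> \<exists>k\<le>l. chain K \<delta> a b k"
    using assms unfolding chain_joined_def by blast
  obtain k where "k \<le> l" "chain K 1 a b k" using K(3)[of 1] by auto
  then have "0 \<le> l" using chain_props(4)[of K 1 a b k] by linarith
  then obtain \<gamma> where "1-lipschitz_on {0..l} \<gamma>" "\<gamma> ` {0..l} \<subseteq> K" "\<gamma> 0 = a" "\<gamma> l = b"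
    using chains_imp_lipschitz_curve[OF K(1) _ K(3)] by blast
  then show ?thesis using \<open>0 \<le> l\<close> K(2) by (intro exI[of _ l] exI[of _ \<gamma>]) auto
qed

text \<open>Inserting \<open>R\<close> truncates the intrinsic distance: the infimum is over a
  nonempty set, and points that no short chain reaches get the value \<open>R\<close>.\<close>

definition chain_dist :: "'a::metric_space set \<Rightarrow> real \<Rightarrow> real \<Rightarrow> 'a \<Rightarrow> 'a \<Rightarrow> real" where
  "chain_dist T R \<delta> a p = Inf (insert R {l. l \<le> R \<and> chain T \<delta> a p l})"

lemma chain_dist_bdd_below: "bdd_below (insert R {l. l \<le> R \<and> chain T \<delta> a p l})"
  by (rule bdd_belowI[of _ "min R 0"]) (auto dest: chain_props(4))

lemma chain_dist_le: "chain_dist T R \<delta> a p \<le> R"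
  unfolding chain_dist_def by (intro cInf_lower chain_dist_bdd_below) simp

lemma chain_dist_le_chain:
  assumes "chain T \<delta> a p l"
  shows "chain_dist T R \<delta> a p \<le> l"
proof (cases "l \<le> R")
  case True
  then show ?thesis
    unfolding chain_dist_def using assms by (intro cInf_lower chain_dist_bdd_below) simp
next
  case False
  then show "?thesis" using chain_dist_le[of T R \<delta> a p] by linarith
qed

lemma chain_dist_less:
  assumes "chain_dist T R \<delta> a p < s" "s \<le> R"
  obtains l where "chain T \<delta> a p l" "l < s"
proof -
  obtain l where "l \<in> insert R {l. l \<le> R \<and> chain T \<delta> a p l}" "l < s"
    using cInf_lessD[of "insert R {l. l \<le> R \<and> chain T \<delta> a p l}" s] assms(1)
    unfolding chain_dist_def by blast
  then show ?thesis using that assms(2) by auto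
qed

text \<open>An almost optimal chain to one point extends to the other by a single step; hence the
  restriction to distances below \<open>\<delta>\<close>.\<close>

lemma chain_dist_local_lipschitz:
  assumes "p \<in> T" "q \<in> T" "dist p q < \<delta>"
  shows "\<bar>chain_dist T R \<delta> a p - chain_dist T R \<delta> a q\<bar> \<le> dist p q"
proof -
  have *: "chain_dist T R \<delta> a q \<le> chain_dist T R \<delta> a p + dist p q" if "q \<in> T" "dist p q < \<delta>" for p q
  proof (rule field_le_epsilon)
    fix e :: real assume "e > 0"
    show "chain_dist T R \<delta> a q \<le> chain_dist T R \<delta> a p + dist p q + e"
    proof (cases "chain_dist T R \<delta> a p < R")
      case True
      \<comment> \<open>As \<open>s\<close> is at most \<open>R\<close>, a value below
        \<open>s\<close> comes from an actual chain and not from the inserted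
        \<open>R\<close>.\<close>
      define s where "s = min R (chain_dist T R \<delta> a p + e)"
      have s: "chain_dist T R \<delta> a p < s" "s \<le> R" "s \<le> chain_dist T R \<delta> a p + e"
        using True \<open>e > 0\<close> by (auto simp: s_def)
      obtain l where l: "chain T \<delta> a p l" "l < s"
        using chain_dist_less[OF s(1,2)] by blast
      show ?thesis
        using chain_dist_le_chain[OF chain_step[OF l(1) that], of R] l(2) s(3) by linarith
    next
      case False
      then show ?thesis
        using chain_dist_le[of T R \<delta> a q] \<open>e > 0\<close> zero_le_dist[of p q] by linarith
    qed
  qed
  show ?thesis
    using *[of q p] *[of p q] assms by (simp add: dist_commute)
qed

lemma chain_dist_self:
  assumes "a \<in> T" "0 \<le> R"
  shows "chain_dist T R \<delta> a a = 0"
proof (rule antisym)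
  show "chain_dist T R \<delta> a a \<le> 0" by (rule chain_dist_le_chain[OF chain_refl[OF assms(1)]])
  show "0 \<le> chain_dist T R \<delta> a a"
    unfolding chain_dist_def
    by (rule cInf_greatest) (use assms(2) in \<open>auto simp: chain_props(4)\<close>)
qed

section \<open>Monotonicity and the weak isoperimetric inequality\<close>

text \<open>The argument will be the squared ratio of |x - \<xi>| and t, so no norm has to be
  differentiated at the centre. The value is 1 up to half the radius and 0 from t / sqrt 2 on, which
  keeps closed supports inside the open ball.\<close>

definition radial :: "real \<Rightarrow> real" where
  "radial q = smooth_step (2 - 4 * q)"

definition radial' :: "real \<Rightarrow> real" where
  "radial' q = - 4 * smooth_step' (2 - 4 * q)"

lemma radial_has_derivative: "(radial has_real_derivative radial' q) (at q)"
proof -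
  have "((\<lambda>q. 2 - 4 * q) has_real_derivative - 4) (at q)"
    by (auto intro!: derivative_eq_intros)
  from DERIV_chain2[OF smooth_step_has_derivative this] show ?thesis
    unfolding radial_def[abs_def] radial'_def by (simp add: mult.commute)
qed

lemma radial_nonneg: "radial q \<ge> 0"
  and radial_le_1: "radial q \<le> 1"
  and radial'_nonpos: "radial' q \<le> 0"
  by (simp_all add: radial_def radial'_def smooth_step_nonneg smooth_step_le_1 smooth_step'_nonneg)

lemma radial_eq_1: "q \<le> 1 / 4 \<Longrightarrow> radial q = 1"
  by (simp add: radial_def smooth_step_eq_1)

lemma radial_eq_0: "q \<ge> 1 / 2 \<Longrightarrow> radial q = 0"
  by (simp add: radial_def smooth_step_eq_0)

lemma radial'_eq_0: "q \<ge> 1 / 2 \<Longrightarrow> radial' q = 0"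
  by (simp add: radial'_def smooth_step'_eq_0)

lemma C_k_on_radial: "C_k_on k radial UNIV"
  unfolding radial_def[abs_def]
  by (intro C_k_on_compose_real[OF C_k_on_smooth_step] C_k_on_diff C_k_on_mult C_k_on_const
      C_k_on_bounded_linear bounded_linear_ident)

lemma continuous_radial: "continuous_on S radial" and continuous_radial': "continuous_on S radial'"
proof -
  have "continuous_on UNIV radial" using C_k_on_radial[of 0] by simp
  then show "continuous_on S radial" by (rule continuous_on_subset) simp
  have "C_k_on 0 (\<lambda>q. - 4 * smooth_step' (2 - 4 * q)) UNIV"
    by (intro C_k_on_compose_real[OF C_k_on_smooth_step'] C_k_on_diff C_k_on_mult C_k_on_const
        C_k_on_bounded_linear bounded_linear_ident)
  then have "continuous_on UNIV radial'" by (simp add: radial'_def[abs_def])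
  then show "continuous_on S radial'" by (rule continuous_on_subset) simp
qed

lemma radial'_bounded: obtains K where "K > 0" "\<And>q. \<bar>radial' q\<bar> \<le> K"
proof -
  obtain K where K: "K > 0" "\<And>t. smooth_step' t \<le> K" using smooth_step'_bounded by metis
  have "\<bar>radial' q\<bar> \<le> 4 * K" for q
    using K(2)[of "2 - 4 * q"] smooth_step'_nonneg[of "2 - 4 * q"] by (simp add: radial'_def)
  then show ?thesis using that[of "4 * K"] K(1) by simp
qed

text \<open>Dominated convergence for the difference quotients, which the mean value inequality
  bounds by \<open>B\<close>.\<close>

lemma has_field_derivative_lebesgue_integral:
  fixes f :: "real \<Rightarrow> 'a \<Rightarrow> real"
  assumes "e > 0"
    and int: "\<And>s. \<bar>s - t\<bar> < e \<Longrightarrow> integrable M (f s)"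
    and der: "\<And>s x. \<bar>s - t\<bar> < e \<Longrightarrow> ((\<lambda>s. f s x) has_real_derivative f' s x) (at s)"
    and bound: "\<And>s x. \<bar>s - t\<bar> < e \<Longrightarrow> \<bar>f' s x\<bar> \<le> B x"
    and B: "integrable M B"
    and meas: "f' t \<in> borel_measurable M"
  shows "((\<lambda>s. \<integral>x. f s x \<partial>M) has_real_derivative (\<integral>x. f' t x \<partial>M)) (at t)"
  unfolding has_field_derivative_iff tendsto_at_iff_sequentially
proof (intro allI impI)
  fix X :: "nat \<Rightarrow> real" assume X: "\<forall>i. X i \<in> UNIV - {t}" "X \<longlonglongrightarrow> t"
  obtain N where N: "\<And>n. n \<ge> N \<Longrightarrow> dist (X n) t < e"
    using X(2) \<open>e > 0\<close> unfolding lim_sequentially by blast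
  \<comment> \<open>Discarding \<open>N\<close> terms brings the whole sequence into the interval on
    which the hypotheses hold.\<close>
  define Y where "Y n = X (n + N)" for n
  have Y: "\<bar>Y n - t\<bar> < e" "Y n \<noteq> t" for n
    using N[of "n + N"] X(1) by (auto simp: Y_def dist_real_def)
  have Ylim: "Y \<longlonglongrightarrow> t" unfolding Y_def using X(2) by (rule LIMSEQ_ignore_initial_segment)
  have t: "\<bar>t - t\<bar> < e" using \<open>e > 0\<close> by simp
  have "(\<lambda>n. \<integral>x. (f (Y n) x - f t x) / (Y n - t) \<partial>M) \<longlonglongrightarrow> (\<integral>x. f' t x \<partial>M)"
  proof (rule integral_dominated_convergence[OF meas _ B])
    show "(\<lambda>x. (f (Y n) x - f t x) / (Y n - t)) \<in> borel_measurable M" for n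
      using int[OF Y(1)[of n]] int[OF t] by (intro borel_measurable_divide borel_measurable_diff) auto
    show "AE x in M. (\<lambda>n. (f (Y n) x - f t x) / (Y n - t)) \<longlonglongrightarrow> f' t x"
    proof (rule AE_I2)
      fix x
      have "((\<lambda>s. (f s x - f t x) / (s - t)) \<longlongrightarrow> f' t x) (at t)"
        using der[OF t] by (simp add: has_field_derivative_iff)
      then show "(\<lambda>n. (f (Y n) x - f t x) / (Y n - t)) \<longlonglongrightarrow> f' t x"
        using Y(2) Ylim unfolding tendsto_at_iff_sequentially by (auto simp: o_def)
    qed
    show "AE x in M. norm ((f (Y n) x - f t x) / (Y n - t)) \<le> B x" for n
    proof (rule AE_I2)
      fix x
      have "norm (f (Y n) x - f t x) \<le> B x * norm (Y n - t)"
      proof (rule field_differentiable_bound[where S = "{s. \<bar>s - t\<bar> < e}" and f' = "\<lambda>s. f' s x"])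
        show "convex {s. \<bar>s - t\<bar> < e}"
        proof -
          have "{s. \<bar>s - t\<bar> < e} = ball t e" by (auto simp: dist_real_def)
          then show ?thesis by simp
        qed
        show "((\<lambda>s. f s x) has_field_derivative f' s x) (at s within {s. \<bar>s - t\<bar> < e})"
          if "s \<in> {s. \<bar>s - t\<bar> < e}" for s
          using der[of s x] that has_field_derivative_at_within by blast
      qed (use bound Y t in auto)
      then show "norm ((f (Y n) x - f t x) / (Y n - t)) \<le> B x"
        using Y(2)[of n] by (simp add: divide_le_eq)
    qed
  qed
  moreover have "(\<integral>x. (f (Y n) x - f t x) / (Y n - t) \<partial>M) =
      ((\<integral>x. f (Y n) x \<partial>M) - (\<integral>x. f t x \<partial>M)) / (Y n - t)" for n
    using int[OF Y(1)[of n]] int[OF t] by simp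
  ultimately have "(\<lambda>n. ((\<integral>x. f (Y n) x \<partial>M) - (\<integral>x. f t x \<partial>M)) / (Y n - t)) \<longlonglongrightarrow> (\<integral>x. f' t x \<partial>M)"
    by (simp only:)
  then show "((\<lambda>s. ((\<integral>x. f s x \<partial>M) - (\<integral>x. f t x \<partial>M)) / (s - t)) \<circ> X) \<longlonglongrightarrow> (\<integral>x. f' t x \<partial>M)"
    unfolding Y_def o_def by (rule LIMSEQ_offset)
qed

text \<open>Radial fields weighted by a scalar function have derivatives of this shape. The trace of
  the projection gives the dimension, and self-adjointness turns the rank one part into
  \<open>b\<close> at the projected vector.\<close>

lemma lin_inner_radial:
  fixes b :: "real^'n \<Rightarrow> real" and S :: "(real^'n) set"
  assumes S: "subspace S" and b: "linear b"
  shows "lin_inner (\<lambda>v. a *\<^sub>R v + b v *\<^sub>R y) (orth_proj S) = a * real (dim S) + b (orth_proj S y)"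
proof -
  have lin: "linear (\<lambda>v. a *\<^sub>R v + b v *\<^sub>R y)"
    using b by (intro linearI) (simp_all add: linear_add linear_scale algebra_simps)
  have "b (orth_proj S y) = b (\<Sum>i\<in>UNIV. orth_proj S y $ i *\<^sub>R axis i 1)"
    using basis_expansion[of "orth_proj S y"] by (simp add: scalar_mult_eq_scaleR)
  also have "\<dots> = (\<Sum>i\<in>UNIV. orth_proj S y $ i * b (axis i 1))"
    by (simp add: linear_sum[OF b] linear_scale[OF b])
  also have "\<dots> = (\<Sum>i\<in>UNIV. (orth_proj S (axis i 1) \<bullet> y) * b (axis i 1))"
  proof (rule sum.cong)
    fix i :: 'n
    have "orth_proj S y $ i = axis i 1 \<bullet> orth_proj S y" by (simp add: inner_axis')
    also have "\<dots> = orth_proj S (axis i 1) \<bullet> y" using orth_proj_inner[OF S] by metis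
    finally show "orth_proj S y $ i * b (axis i 1) = (orth_proj S (axis i 1) \<bullet> y) * b (axis i 1)" by simp
  qed simp
  finally have 1: "b (orth_proj S y) = (\<Sum>i\<in>UNIV. (orth_proj S (axis i 1) \<bullet> y) * b (axis i 1))" .
  have 2: "a * real (dim S) = (\<Sum>i\<in>(UNIV::'n set). a * (orth_proj S (axis i 1) \<bullet> axis i 1))"
    using trace_orth_proj[OF S] by (simp add: sum_distrib_left[symmetric])
  show ?thesis
    unfolding lin_inner_eq[OF lin] 1 2
    by (simp add: inner_add_right sum.distrib mult.commute)
qed

text \<open>\<open>\<nu>\<close> stands for the variation bound in both cases of the theorem, so
  that the analysis is done once. The scale \<open>r\<close> admits fields of norm up to
  \<open>t\<close>, and the factor 1/2 in \<open>density\<close> leaves room below a density that is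
  at least 1 only in the limit.\<close>

locale varifold_bounded_variation = varifold_in_open m U V
  for m :: nat and U :: "(real^'n) set" and V :: "((real^'n) \<times> (real^'n) set) measure" +
  fixes \<nu> :: "(real^'n) measure"
  assumes m_pos: "1 \<le> m"
    and sets_\<nu>: "sets \<nu> = sets (borel_of (top_of_set U))"
    and variation: "g \<in> test_fields U \<Longrightarrow> open G \<Longrightarrow> G \<subseteq> U \<Longrightarrow> closure {x. g x \<noteq> 0} \<subseteq> G \<Longrightarrow>
      0 < r \<Longrightarrow> (\<And>x. norm (g x) \<le> r) \<Longrightarrow>
      ennreal (first_variation V g) \<le> ennreal r * emeasure \<nu> G"
    and density: "AE x in weight U V. \<exists>\<rho>>0. \<forall>r. 0 < r \<and> r < \<rho> \<longrightarrow>
      ennreal (unit_ball_vol (real m) / 2 * r ^ m) \<le> emeasure (weight U V) (cball x r)"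
begin

lemma borel_in_sets_\<nu>: "A \<in> sets borel \<Longrightarrow> A \<subseteq> U \<Longrightarrow> A \<in> sets \<nu>"
  using borel_in_sets by (simp add: sets_\<nu>)

lemma integrable_W_continuous:
  fixes f :: "real^'n \<Rightarrow> real"
  assumes "continuous_on UNIV f" "compact K" "K \<subseteq> U" "\<And>x. x \<notin> K \<Longrightarrow> f x = 0"
  shows "integrable W f"
proof -
  have "bounded (f ` K)"
    by (intro compact_imp_bounded compact_continuous_image assms(2) continuous_on_subset[OF assms(1)]) simp
  then obtain B where B: "\<forall>x\<in>K. \<bar>f x\<bar> \<le> B" by (auto simp: bounded_iff)
  have "\<bar>f x\<bar> \<le> max B 0" for x
    using B assms(4)[of x] by (cases "x \<in> K") force+
  then show ?thesis
    using assms borel_measurable_continuous_onI by (intro integrable_W[of f K]) auto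
qed

end

section \<open>A fixed cutoff function and its radial test fields\<close>

locale varifold_cutoff = varifold_bounded_variation m U V \<nu>
  for m :: nat and U :: "(real^'n) set" and V :: "((real^'n) \<times> (real^'n) set) measure"
    and \<nu> :: "(real^'n) measure" +
  fixes u :: "real^'n \<Rightarrow> real" and Q :: "(real^'n) set" and \<Lambda> :: real
  assumes u_smooth: "C_k_on k u UNIV"
    and u_nonneg: "0 \<le> u x" and u_le_1: "u x \<le> 1"
    and \<Lambda>_nonneg: "0 \<le> \<Lambda>"
    and u_gradient: "x \<in> spt U (weight U V) \<Longrightarrow> \<bar>frechet_derivative u (at x) v\<bar> \<le> \<Lambda> * norm v"
    and u_support: "compact (closure {x. u x \<noteq> 0})" "closure {x. u x \<noteq> 0} \<subseteq> Q"
    and Q: "open Q" "Q \<subseteq> U"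
    and W_Q: "emeasure (weight U V) Q < \<infinity>" and \<nu>_Q: "emeasure \<nu> Q < \<infinity>"
begin

text \<open>Multiplied by \<open>t\<close>, this bounds the error in testing with
  \<open>field \<xi> t\<close>: the gradient of \<open>u\<close> costs \<open>\<Lambda>\<close> per
  unit of weight, and the first variation costs \<open>\<nu>\<close>.\<close>

definition \<mu> :: "(real^'n) set \<Rightarrow> real" where
  "\<mu> A = \<Lambda> * measure W (A \<inter> Q) + measure \<nu> (A \<inter> Q)"

abbreviation K where "K \<equiv> closure {x. u x \<noteq> 0}"

lemma u_eq_0: "x \<notin> K \<Longrightarrow> u x = 0"
  using closure_subset[of "{x. u x \<noteq> 0}"] by auto

lemma K_subset_U: "K \<subseteq> U" using u_support(2) Q(2) by blast

lemma Q_sets: "Q \<in> sets W" "Q \<in> sets \<nu>"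
  using Q by (auto intro: borel_in_sets_W borel_in_sets_\<nu>)

lemma continuous_u: "continuous_on S u"
  using u_smooth[of 0] continuous_on_subset by auto

lemma inter_Q:
  assumes "A \<in> sets borel"
  shows "A \<inter> Q \<in> sets W" "A \<inter> Q \<in> sets \<nu>"
    "emeasure W (A \<inter> Q) < \<infinity>" "emeasure \<nu> (A \<inter> Q) < \<infinity>"
proof -
  have "A \<inter> Q \<in> sets borel" using assms Q(1) by auto
  then show "A \<inter> Q \<in> sets W" "A \<inter> Q \<in> sets \<nu>"
    using Q(2) by (auto intro!: borel_in_sets_W borel_in_sets_\<nu>)
  show "emeasure W (A \<inter> Q) < \<infinity>"
    using emeasure_mono[of "A \<inter> Q" Q W] Q_sets W_Q by (simp add: le_less_trans)
  show "emeasure \<nu> (A \<inter> Q) < \<infinity>"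
    using emeasure_mono[of "A \<inter> Q" Q \<nu>] Q_sets \<nu>_Q by (simp add: le_less_trans)
qed

lemma \<mu>_mono:
  assumes "A \<subseteq> B" "A \<in> sets borel" "B \<in> sets borel"
  shows "\<mu> A \<le> \<mu> B"
proof -
  have "measure W (A \<inter> Q) \<le> measure W (B \<inter> Q)"
    using assms(1) inter_Q[OF assms(2)] inter_Q[OF assms(3)]
    by (intro measure_mono_fmeasurable) (auto simp: fmeasurable_def)
  moreover have "measure \<nu> (A \<inter> Q) \<le> measure \<nu> (B \<inter> Q)"
    using assms(1) inter_Q[OF assms(2)] inter_Q[OF assms(3)]
    by (intro measure_mono_fmeasurable) (auto simp: fmeasurable_def)
  ultimately show ?thesis
    unfolding \<mu>_def using \<Lambda>_nonneg by (intro add_mono mult_left_mono)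
qed

lemma \<mu>_nonneg: "\<mu> A \<ge> 0"
  using \<Lambda>_nonneg by (simp add: \<mu>_def)

abbreviation sq :: "real^'n \<Rightarrow> real \<Rightarrow> real^'n \<Rightarrow> real" where
  "sq \<xi> t x \<equiv> (x - \<xi>) \<bullet> (x - \<xi>) / t\<^sup>2"

definition field :: "real^'n \<Rightarrow> real \<Rightarrow> real^'n \<Rightarrow> real^'n" where
  "field \<xi> t x = (u x * radial (sq \<xi> t x)) *\<^sub>R (x - \<xi>)"

lemma radial_neq_0_imp:
  assumes "t > 0" "radial (sq \<xi> t x) \<noteq> 0 \<or> radial' (sq \<xi> t x) \<noteq> 0"
  shows "(x - \<xi>) \<bullet> (x - \<xi>) \<le> t\<^sup>2 / 2" "dist \<xi> x < t"
proof -
  have t: "0 < t\<^sup>2" using \<open>t > 0\<close> by simp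
  have "sq \<xi> t x < 1 / 2"
    using assms radial_eq_0 radial'_eq_0 by (meson not_le)
  then show 1: "(x - \<xi>) \<bullet> (x - \<xi>) \<le> t\<^sup>2 / 2"
    using t by (simp add: pos_divide_less_eq)
  then have "(norm (x - \<xi>))\<^sup>2 < t\<^sup>2"
    unfolding power2_norm_eq_inner using t by linarith
  then have "norm (x - \<xi>) < t"
    by (rule power2_less_imp_less) (use \<open>t > 0\<close> in simp)
  then show "dist \<xi> x < t" by (simp add: dist_norm norm_minus_commute)
qed

lemma field_support:
  assumes "t > 0"
  shows "closure {x. field \<xi> t x \<noteq> 0} \<subseteq> K \<inter> ball \<xi> t"
proof -
  have "{x. field \<xi> t x \<noteq> 0} \<subseteq> K \<inter> {x. (x - \<xi>) \<bullet> (x - \<xi>) \<le> t\<^sup>2 / 2}"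
  proof (intro subsetI IntI CollectI)
    fix x assume "x \<in> {x. field \<xi> t x \<noteq> 0}"
    then have "u x \<noteq> 0" "radial (sq \<xi> t x) \<noteq> 0"
      by (simp_all add: field_def)
    then show "x \<in> K" "(x - \<xi>) \<bullet> (x - \<xi>) \<le> t\<^sup>2 / 2"
      using u_eq_0 radial_neq_0_imp(1)[OF assms, of x \<xi>] by blast+
  qed
  moreover have "closed (K \<inter> {x. (x - \<xi>) \<bullet> (x - \<xi>) \<le> t\<^sup>2 / 2})"
    by (intro closed_Int closed_closure closed_Collect_le continuous_intros)
  ultimately have "closure {x. field \<xi> t x \<noteq> 0} \<subseteq> K \<inter> {x. (x - \<xi>) \<bullet> (x - \<xi>) \<le> t\<^sup>2 / 2}"
    by (rule closure_minimal)
  moreover have "{x. (x - \<xi>) \<bullet> (x - \<xi>) \<le> t\<^sup>2 / 2} \<subseteq> ball \<xi> t"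
  proof
    fix x assume "x \<in> {x. (x - \<xi>) \<bullet> (x - \<xi>) \<le> t\<^sup>2 / 2}"
    then have "(norm (x - \<xi>))\<^sup>2 \<le> t\<^sup>2 / 2" by (simp add: power2_norm_eq_inner)
    also have "\<dots> < t\<^sup>2" using \<open>t > 0\<close> by simp
    finally have "norm (x - \<xi>) < t"
      by (rule power2_less_imp_less) (use \<open>t > 0\<close> in simp)
    then show "x \<in> ball \<xi> t" by (simp add: dist_norm norm_minus_commute)
  qed
  ultimately show ?thesis by blast
qed

lemma field_norm:
  assumes "t > 0"
  shows "norm (field \<xi> t x) \<le> t"
proof (cases "radial (sq \<xi> t x) = 0")
  case False
  then have "norm (x - \<xi>) < t"
    using radial_neq_0_imp(2)[OF assms, of x \<xi>] by (simp add: dist_norm norm_minus_commute)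
  moreover have "\<bar>u x * radial (sq \<xi> t x)\<bar> \<le> 1"
    using u_nonneg u_le_1 radial_nonneg radial_le_1 by (simp add: abs_mult mult_le_one)
  ultimately have "\<bar>u x * radial (sq \<xi> t x)\<bar> * norm (x - \<xi>) \<le> 1 * t"
    by (intro mult_mono) auto
  then show ?thesis by (simp add: field_def)
qed (use assms in \<open>simp add: field_def\<close>)

lemma field_test:
  assumes "t > 0"
  shows "field \<xi> t \<in> test_fields U"
proof -
  have "C_k_on k (sq \<xi> t) UNIV" for k
    unfolding divide_inverse
    by (intro C_k_on_mult C_k_on_inner C_k_on_diff C_k_on_const C_k_on_bounded_linear bounded_linear_ident)
  then have q: "C_k_on k (\<lambda>x. radial (sq \<xi> t x)) UNIV" for k
    by (rule C_k_on_compose_real[OF C_k_on_radial])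
  have "C_k_on k (\<lambda>x. x - \<xi>) UNIV" for k
    by (intro C_k_on_diff C_k_on_const C_k_on_bounded_linear bounded_linear_ident)
  then have "C_k_on k (field \<xi> t) UNIV" for k
    unfolding field_def[abs_def] by (intro C_k_on_scaleR C_k_on_mult u_smooth q)
  moreover have "compact (closure {x. field \<xi> t x \<noteq> 0})"
  proof -
    have "closure {x. field \<xi> t x \<noteq> 0} = K \<inter> closure {x. field \<xi> t x \<noteq> 0}"
      using field_support[OF assms, of \<xi>] by blast
    moreover have "compact (K \<inter> closure {x. field \<xi> t x \<noteq> 0})"
      by (intro compact_Int_closed u_support(1) closed_closure)
    ultimately show ?thesis by (simp only:)
  qed
  ultimately show ?thesis
    using field_support[OF assms, of \<xi>] K_subset_U by (auto simp: test_fields_def)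
qed

lemma field_derivative:
  fixes \<xi> :: "real^'n"
  assumes "t > 0"
  defines "q \<equiv> sq \<xi> t"
  shows "frechet_derivative (field \<xi> t) (at x) = (\<lambda>v. (u x * radial (q x)) *\<^sub>R v +
    (u x * (radial' (q x) * (2 * ((x - \<xi>) \<bullet> v) / t\<^sup>2)) + frechet_derivative u (at x) v * radial (q x))
      *\<^sub>R (x - \<xi>))"
proof -
  have fe: "field \<xi> t = (\<lambda>x. (u x * radial (q x)) *\<^sub>R (x - \<xi>))"
    by (simp add: fun_eq_iff field_def q_def)
  have id: "((\<lambda>x. x - \<xi>) has_derivative (\<lambda>v. v)) (at x)"
    by (auto intro!: derivative_eq_intros)
  have "((\<lambda>x. (x - \<xi>) \<bullet> (x - \<xi>)) has_derivative (\<lambda>v. 2 * ((x - \<xi>) \<bullet> v))) (at x)"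
    by (rule has_derivative_eq_rhs[OF has_derivative_inner[OF id id]]) (simp add: fun_eq_iff inner_commute)
  then have q: "(q has_derivative (\<lambda>v. 2 * ((x - \<xi>) \<bullet> v) / t\<^sup>2)) (at x)"
    unfolding q_def by (rule bounded_linear.has_derivative[OF bounded_linear_divide])
  have r: "((\<lambda>x. radial (q x)) has_derivative (\<lambda>v. radial' (q x) * (2 * ((x - \<xi>) \<bullet> v) / t\<^sup>2))) (at x)"
    by (rule has_derivative_compose[OF q, of radial "\<lambda>v. radial' (q x) * v"])
      (use radial_has_derivative in \<open>simp add: has_field_derivative_def\<close>)
  have ur: "((\<lambda>x. u x * radial (q x)) has_derivative (\<lambda>v.
      u x * (radial' (q x) * (2 * ((x - \<xi>) \<bullet> v) / t\<^sup>2)) + frechet_derivative u (at x) v * radial (q x))) (at x)"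
    by (rule has_derivative_mult[OF C_k_on_SucD(1)[OF u_smooth] r])
  have "(field \<xi> t has_derivative (\<lambda>v. (u x * radial (q x)) *\<^sub>R v +
    (u x * (radial' (q x) * (2 * ((x - \<xi>) \<bullet> v) / t\<^sup>2)) + frechet_derivative u (at x) v * radial (q x))
      *\<^sub>R (x - \<xi>))) (at x)"
    unfolding fe by (rule has_derivative_scaleR[OF ur id])
  then show ?thesis by (simp add: frechet_derivative_at[symmetric])
qed

text \<open>Since \<open>radial'\<close> is nonpositive and projecting shortens \<open>y\<close>,
  replacing the tangential part of \<open>y\<close> by all of \<open>y\<close> lowers the value. The
  gradient term is nonzero only where \<open>radial\<close> and the derivative of \<open>u\<close>
  both are, which confines it to the ball and to \<open>Q\<close>.\<close>

lemma first_variation_integrand_lower: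
  fixes \<xi> :: "real^'n"
  assumes "t > 0" "x \<in> T" "S \<in> grassmannian m"
  defines "q \<equiv> sq \<xi> t"
  shows "u x * (m * radial (q x) + 2 * (q x * radial' (q x))) - \<Lambda> * t * indicator (ball \<xi> t \<inter> Q) x
    \<le> lin_inner (frechet_derivative (field \<xi> t) (at x)) (orth_proj S)"
proof -
  have S: "subspace S" "dim S = m" using assms(3) by (auto simp: grassmannian_def)
  define y where "y = x - \<xi>"
  define p where "p = orth_proj S y"
  define D where "D = frechet_derivative u (at x)"
  have Dlin: "linear D"
    unfolding D_def by (rule has_derivative_linear[OF C_k_on_SucD(1)[OF u_smooth]])
  have lin: "linear (\<lambda>v. u x * (radial' (q x) * (2 * (y \<bullet> v) / t\<^sup>2)) + D v * radial (q x))"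
    using Dlin by (intro linearI)
      (simp_all add: linear_add linear_scale inner_add_right algebra_simps add_divide_distrib)
  have qx: "y \<bullet> y / t\<^sup>2 = q x" by (simp add: q_def y_def)
  have eq: "lin_inner (frechet_derivative (field \<xi> t) (at x)) (orth_proj S) =
      u x * radial (q x) * m + (u x * (radial' (q x) * (2 * (y \<bullet> p) / t\<^sup>2)) + D p * radial (q x))"
    unfolding field_derivative[OF assms(1)] y_def[symmetric] D_def[symmetric] qx
    by (subst lin_inner_radial[OF S(1) lin]) (simp add: S(2) p_def)
  have np: "norm p \<le> norm y" unfolding p_def by (rule norm_orth_proj_le[OF S(1)])
  have "y \<bullet> p = p \<bullet> p" unfolding p_def by (rule orth_proj_inner(2)[OF S(1)])
  also have "\<dots> \<le> y \<bullet> y"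
    using np by (simp add: power2_norm_eq_inner[symmetric])
  finally have "2 * (y \<bullet> p) / t\<^sup>2 \<le> 2 * q x"
    unfolding q_def y_def by (simp add: divide_right_mono)
  then have "radial' (q x) * (2 * q x) \<le> radial' (q x) * (2 * (y \<bullet> p) / t\<^sup>2)"
    using radial'_nonpos by (intro mult_left_mono_neg)
  then have 1: "u x * (radial' (q x) * (2 * q x)) \<le> u x * (radial' (q x) * (2 * (y \<bullet> p) / t\<^sup>2))"
    by (rule mult_left_mono[OF _ u_nonneg])
  have 2: "- (\<Lambda> * t * indicator (ball \<xi> t \<inter> Q) x) \<le> D p * radial (q x)"
  proof (cases "radial (q x) = 0 \<or> D p = 0")
    case True
    then have "D p * radial (q x) = 0" by auto
    moreover have "0 \<le> \<Lambda> * t * indicator (ball \<xi> t \<inter> Q) x"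
      using \<Lambda>_nonneg \<open>t > 0\<close> by (intro mult_nonneg_nonneg) auto
    ultimately show ?thesis by linarith
  next
    case False
    then have d: "dist \<xi> x < t" using radial_neq_0_imp(2)[OF assms(1), of x \<xi>] by (simp add: q_def)
    have "x \<in> K"
    proof (rule ccontr)
      assume "x \<notin> K"
      have "(u has_derivative (\<lambda>v. 0)) (at x)"
      proof (rule has_derivative_transform_within_open[where s = "- K" and f = "\<lambda>_. 0"])
        show "x \<in> - K" using \<open>x \<notin> K\<close> by simp
        show "0 = u y" if "y \<in> - K" for y by (rule u_eq_0[symmetric]) (use that in blast)
      qed (rule has_derivative_const, rule open_Compl[OF closed_closure])
      then have "D = (\<lambda>v. 0)"
        unfolding D_def by (rule has_derivative_unique[OF C_k_on_SucD(1)[OF u_smooth]])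
      then show False using False by simp
    qed
    then have "x \<in> ball \<xi> t \<inter> Q" using d u_support(2) by auto
    then have ind: "indicator (ball \<xi> t \<inter> Q) x = (1::real)" by simp
    have "norm p \<le> t" using np d by (simp add: y_def dist_norm norm_minus_commute)
    then have "\<bar>D p\<bar> \<le> \<Lambda> * t"
      using u_gradient[OF assms(2), of p] \<Lambda>_nonneg mult_left_mono[of "norm p" t \<Lambda>]
      unfolding D_def by linarith
    then have "\<bar>D p * radial (q x)\<bar> \<le> \<Lambda> * t * 1"
      unfolding abs_mult using radial_nonneg[of "q x"] radial_le_1[of "q x"] by (intro mult_mono) auto
    then show ?thesis unfolding ind by linarith
  qed
  show ?thesis unfolding eq using 1 2 by (simp add: algebra_simps)
qed

text \<open>The first variation of \<open>field \<xi> t\<close> is at least the left side minus the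
  gradient error; as the field has norm at most \<open>t\<close>, it is also at most
  \<open>t\<close> times the variation of \<open>ball \<xi> t \<inter> Q\<close>.\<close>

lemma monotonicity_integral:
  fixes \<xi> :: "real^'n"
  assumes "t > 0"
  defines "q \<equiv> sq \<xi> t"
  shows "(\<integral>x. u x * (m * radial (q x) + 2 * (q x * radial' (q x))) \<partial>W) \<le> t * \<mu> (ball \<xi> t)"
    and "integrable W (\<lambda>x. u x * (m * radial (q x) + 2 * (q x * radial' (q x))))"
proof -
  let ?f = "\<lambda>x. u x * (m * radial (q x) + 2 * (q x * radial' (q x)))"
  let ?B = "ball \<xi> t \<inter> Q"
  let ?g = "\<lambda>x. \<Lambda> * t * indicator ?B x :: real"
  have qc: "continuous_on UNIV q"
    unfolding q_def by (intro continuous_intros) (use \<open>t > 0\<close> in auto)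
  have fc: "continuous_on UNIV ?f"
    by (intro continuous_intros continuous_u continuous_on_compose2[OF continuous_radial[of UNIV] qc]
        continuous_on_compose2[OF continuous_radial'[of UNIV] qc] qc) auto
  then show int: "integrable W ?f"
    by (rule integrable_W_continuous[OF _ u_support(1) K_subset_U]) (rule mult_eq_0_iff[THEN iffD2], rule disjI1, rule u_eq_0)
  have B: "?B \<in> sets borel" "?B \<in> sets W" "?B \<in> sets \<nu>"
    using Q by (auto intro!: borel_in_sets_W borel_in_sets_\<nu>)
  have WB: "emeasure W ?B < \<infinity>"
    using W_Q emeasure_mono[of ?B Q W] Q_sets by (auto intro: le_less_trans)
  have \<nu>B: "emeasure \<nu> ?B < \<infinity>"
    using \<nu>_Q emeasure_mono[of ?B Q \<nu>] Q_sets by (auto intro: le_less_trans)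
  have intg: "integrable W ?g"
    by (intro integrable_mult_right integrable_real_indicator B WB)
  have fb: "?f \<in> borel_measurable borel" by (rule borel_measurable_continuous_onI[OF fc])
  have gb: "?g \<in> borel_measurable borel" using B(1) by simp
  have fgb: "(\<lambda>x. ?f x - ?g x) \<in> borel_measurable borel" using fb gb by simp
  have "(\<integral>x. ?f x \<partial>W) - \<Lambda> * t * measure W ?B = (\<integral>x. ?f x - ?g x \<partial>W)"
    using int intg B(2) by simp
  also have "\<dots> = (\<integral>p. ?f (fst p) - ?g (fst p) \<partial>V)" by (rule integral_W[OF fgb])
  also have "\<dots> \<le> first_variation V (field \<xi> t)"
    unfolding first_variation_def
  proof (rule integral_mono_AE)
    show "integrable V (\<lambda>p. ?f (fst p) - ?g (fst p))"
      using integrable_W_V[OF fgb] int intg by simp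
    show "AE p in V. ?f (fst p) - ?g (fst p) \<le>
        lin_inner (frechet_derivative (field \<xi> t) (at (fst p))) (orth_proj (snd p))"
      using AE_V_spt
    proof eventually_elim
      case (elim p)
      then show ?case
        unfolding q_def using first_variation_integrand_lower[OF \<open>t > 0\<close>, of "fst p" "snd p" \<xi>]
        by (auto simp: space_V)
    qed
  qed (rule first_variation_integrable[OF field_test[OF \<open>t > 0\<close>]])
  also have "\<dots> \<le> t * measure \<nu> ?B"
  proof -
    have "ennreal (first_variation V (field \<xi> t)) \<le> ennreal t * emeasure \<nu> ?B"
      using field_support[OF \<open>t > 0\<close>, of \<xi>] u_support(2) Q \<open>t > 0\<close> field_norm[OF \<open>t > 0\<close>]
      by (intro variation field_test) auto
    also have "\<dots> = ennreal (t * measure \<nu> ?B)"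
      using \<nu>B \<open>t > 0\<close> by (simp add: emeasure_eq_ennreal_measure ennreal_mult)
    finally show ?thesis using \<open>t > 0\<close> by (simp add: ennreal_le_iff)
  qed
  finally show "(\<integral>x. ?f x \<partial>W) \<le> t * \<mu> (ball \<xi> t)"
    by (simp add: \<mu>_def algebra_simps)
qed

section \<open>Monotonicity of smoothed density ratios\<close>

definition J :: "real^'n \<Rightarrow> real \<Rightarrow> real" where
  "J \<xi> t = (\<integral>x. u x * radial (sq \<xi> t x) \<partial>W)"

lemma J_integrable: "integrable W (\<lambda>x. u x * radial (sq \<xi> t x))"
proof (rule integrable_W_continuous[OF _ u_support(1) K_subset_U])
  have "continuous_on UNIV (\<lambda>x. (x - \<xi>) \<bullet> (x - \<xi>) * inverse (t\<^sup>2))"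
    by (intro continuous_intros)
  then have "continuous_on UNIV (\<lambda>x. radial (sq \<xi> t x))"
    unfolding divide_inverse[symmetric]
    by (rule continuous_on_compose2[OF continuous_radial[of UNIV]]) simp
  then show "continuous_on UNIV (\<lambda>x. u x * radial (sq \<xi> t x))"
    by (intro continuous_on_mult continuous_u)
qed (rule mult_eq_0_iff[THEN iffD2], rule disjI1, rule u_eq_0)

lemma J_lower:
  assumes "t > 0" "F \<in> sets W" "F \<subseteq> cball \<xi> (t / 2)" "\<And>x. x \<in> F \<inter> T \<Longrightarrow> u x = 1"
  shows "measure W F \<le> J \<xi> t" "emeasure W F < \<infinity>"
proof -
  have ae: "AE x in W. x \<in> T"
    using emeasure_outside_spt by (rule AE_I') (auto simp: space_W)
  have "emeasure W F = emeasure W (F \<inter> T)" using emeasure_Int_spt[OF assms(2)] by simp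
  also have "\<dots> \<le> emeasure W Q"
  proof (rule emeasure_mono[OF _ Q_sets(1)])
    show "F \<inter> T \<subseteq> Q"
    proof
      fix x assume "x \<in> F \<inter> T"
      then have "u x \<noteq> 0" using assms(4)[of x] by simp
      then show "x \<in> Q" using u_eq_0[of x] u_support(2) by blast
    qed
  qed
  finally show fin: "emeasure W F < \<infinity>" using W_Q by (rule le_less_trans)
  have "measure W F = (\<integral>x. indicator F x \<partial>W)" using assms(2) by simp
  also have "\<dots> \<le> J \<xi> t"
    unfolding J_def
  proof (rule integral_mono_AE[OF integrable_real_indicator[OF assms(2) fin] J_integrable])
    show "AE x in W. indicator F x \<le> u x * radial (sq \<xi> t x)"
      using ae
    proof eventually_elim
      case (elim x)
      show ?case
      proof (cases "x \<in> F")
        case True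
        then have "norm (x - \<xi>) \<le> t / 2"
          using assms(3) by (auto simp: dist_norm norm_minus_commute)
        then have "(norm (x - \<xi>))\<^sup>2 \<le> (t / 2)\<^sup>2" by (rule power_mono) simp
        then have "sq \<xi> t x \<le> 1 / 4"
          using \<open>t > 0\<close> by (simp add: power2_norm_eq_inner divide_le_eq power_divide)
        then show ?thesis using assms(4)[of x] True elim by (simp add: radial_eq_1)
      next
        case False
        then show ?thesis using u_nonneg radial_nonneg by simp
      qed
    qed
  qed
  finally show "measure W F \<le> J \<xi> t" .
qed

lemma J_upper: "J \<xi> t \<le> measure W Q"
proof -
  have "J \<xi> t \<le> (\<integral>x. indicator Q x \<partial>W)"
    unfolding J_def
  proof (rule integral_mono[OF J_integrable integrable_real_indicator[OF Q_sets(1) W_Q]])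
    fix x
    show "u x * radial (sq \<xi> t x) \<le> indicator Q x"
    proof (cases "x \<in> K")
      case True
      then have "x \<in> Q" using u_support(2) by blast
      then show ?thesis
        using u_nonneg[of x] u_le_1[of x] radial_nonneg radial_le_1 by (simp add: mult_le_one)
    next
      case False
      then have "u x = 0" by (rule u_eq_0)
      then show ?thesis by simp
    qed
  qed
  also have "\<dots> = measure W Q" using Q_sets(1) by simp
  finally show ?thesis .
qed

lemma J_has_derivative:
  assumes "t > 0"
  shows "(J \<xi> has_real_derivative
     (\<integral>x. u x * (radial' (sq \<xi> t x) * (- 2 * ((x - \<xi>) \<bullet> (x - \<xi>)) / t ^ 3)) \<partial>W)) (at t)"
proof -
  obtain C where C: "C > 0" "\<And>q. \<bar>radial' q\<bar> \<le> C" using radial'_bounded by metis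
  let ?y = "\<lambda>x. (x - \<xi>) \<bullet> (x - \<xi>)"
  let ?f' = "\<lambda>s x. u x * (radial' (?y x / s\<^sup>2) * (- 2 * ?y x / s ^ 3))"
  \<comment> \<open>Dominating function: \<open>s\<close> within \<open>t / 2\<close> of
    \<open>t\<close> exceeds \<open>t / 2\<close>, so \<open>1 / s ^ 3\<close> is at most
    \<open>8 / t ^ 3\<close>.\<close>
  let ?B = "\<lambda>x. u x * (C * (2 * ?y x * 8 / t ^ 3))"
  have pos: "s > t / 2" if "\<bar>s - t\<bar> < t / 2" for s using that by linarith
  have bc: "continuous_on UNIV ?B"
    by (intro continuous_intros continuous_u) (use \<open>t > 0\<close> in auto)
  have fc: "continuous_on UNIV (?f' t)"
  proof -
    have "continuous_on UNIV (\<lambda>x. ?y x / t\<^sup>2)" "continuous_on UNIV (\<lambda>x. - 2 * ?y x / t ^ 3)"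
      by (intro continuous_intros; use \<open>t > 0\<close> in simp)+
    moreover from this(1) have "continuous_on UNIV (\<lambda>x. radial' (?y x / t\<^sup>2))"
      by (rule continuous_on_compose2[OF continuous_radial'[of UNIV]]) simp
    ultimately show ?thesis by (intro continuous_on_mult continuous_u)
  qed
  show ?thesis
    unfolding J_def[abs_def]
  proof (rule has_field_derivative_lebesgue_integral[where e = "t / 2" and f' = ?f' and B = ?B])
    show "integrable W ?B"
      by (rule integrable_W_continuous[OF bc u_support(1) K_subset_U])
        (rule mult_eq_0_iff[THEN iffD2], rule disjI1, rule u_eq_0)
    show "?f' t \<in> borel_measurable W"
      by (rule borel_measurable_W[OF borel_measurable_continuous_onI[OF fc]])
    show "((\<lambda>s. u x * radial (?y x / s\<^sup>2)) has_real_derivative ?f' s x) (at s)"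
      if "\<bar>s - t\<bar> < t / 2" for s x
    proof -
      have s: "s > 0" using pos[OF that] \<open>t > 0\<close> by linarith
      have "((\<lambda>s. ?y x / s\<^sup>2) has_real_derivative (- 2 * ?y x / s ^ 3)) (at s)"
        using s by (auto intro!: derivative_eq_intros simp: power2_eq_square power3_eq_cube mult_ac)
      from DERIV_chain2[OF radial_has_derivative this] show ?thesis by (rule DERIV_cmult)
    qed
    show "\<bar>?f' s x\<bar> \<le> ?B x" if "\<bar>s - t\<bar> < t / 2" for s x
    proof -
      have "(t / 2) ^ 3 \<le> s ^ 3" using pos[OF that] \<open>t > 0\<close> by (intro power_mono) auto
      then have "inverse (s ^ 3) \<le> inverse ((t / 2) ^ 3)"
        using \<open>t > 0\<close> by (intro le_imp_inverse_le) auto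
      then have s3: "inverse (s ^ 3) \<le> 8 / t ^ 3" by (simp add: power_divide)
      have s: "s > 0" using pos[OF that] \<open>t > 0\<close> by linarith
      have y: "?y x \<ge> 0" by simp
      have "\<bar>- 2 * ?y x / s ^ 3\<bar> = (2 * ?y x) * inverse (s ^ 3)"
        using s y by (simp add: abs_mult divide_inverse)
      also have "\<dots> \<le> (2 * ?y x) * (8 / t ^ 3)" by (rule mult_left_mono[OF s3]) (use y in simp)
      finally have *: "\<bar>- 2 * ?y x / s ^ 3\<bar> \<le> 2 * ?y x * 8 / t ^ 3" by simp
      have "\<bar>radial' (?y x / s\<^sup>2) * (- 2 * ?y x / s ^ 3)\<bar> \<le> C * (2 * ?y x * 8 / t ^ 3)"
        unfolding abs_mult[of "radial' _"] by (rule mult_mono[OF C(2) *]) (use C(1) in auto)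
      then show ?thesis
        by (simp only: abs_mult[of "u x"] abs_of_nonneg[OF u_nonneg]) (rule mult_left_mono[OF _ u_nonneg])
    qed
  qed (use \<open>t > 0\<close> in \<open>auto intro: J_integrable\<close>)
qed

text \<open>Differentiating \<open>radial (q x)\<close> in \<open>t\<close> produces -2/t times
  \<open>q x * radial' (q x)\<close>, a part of the integrand of \<open>A\<close>. Hence
  \<open>t * J' = m * J \<xi> t - A\<close>, and the quotient rule leaves only
  \<open>A\<close>.\<close>

lemma J_quotient_derivative:
  assumes "t > 0"
  obtains D where "((\<lambda>t. J \<xi> t / t ^ m) has_real_derivative D) (at t)" "- (\<mu> (ball \<xi> t) / t ^ m) \<le> D"
proof -
  let ?y = "\<lambda>x. (x - \<xi>) \<bullet> (x - \<xi>)"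
  define q where "q x = ?y x / t\<^sup>2" for x
  define J' where "J' = (\<integral>x. u x * (radial' (q x) * (- 2 * ?y x / t ^ 3)) \<partial>W)"
  have J': "(J \<xi> has_real_derivative J') (at t)"
    using J_has_derivative[OF assms, of \<xi>] unfolding J'_def q_def .
  define A where "A = (\<integral>x. u x * (m * radial (q x) + 2 * (q x * radial' (q x))) \<partial>W)"
  have A: "A \<le> t * \<mu> (ball \<xi> t)"
    and intA: "integrable W (\<lambda>x. u x * (m * radial (q x) + 2 * (q x * radial' (q x))))"
    using monotonicity_integral[OF assms, of \<xi>] unfolding A_def q_def by auto
  have pt: "u x * (radial' (q x) * (- 2 * ?y x / t ^ 3)) =
      (m * (u x * radial (q x)) - u x * (m * radial (q x) + 2 * (q x * radial' (q x)))) / t" for x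
    using \<open>t > 0\<close> by (simp add: q_def field_simps power2_eq_square power3_eq_cube)
  have "J' = (m * J \<xi> t - A) / t"
    unfolding J'_def pt A_def J_def q_def[symmetric]
    using intA J_integrable[of \<xi> t] unfolding q_def[symmetric] by simp
  then have tJ': "t * J' = m * J \<xi> t - A" using \<open>t > 0\<close> by simp
  have "((\<lambda>t. J \<xi> t / t ^ m) has_real_derivative
      ((J' * t ^ m - J \<xi> t * (real m * t ^ (m - 1))) / (t ^ m * t ^ m))) (at t)"
    using DERIV_divide[OF J' DERIV_pow[of m t]] \<open>t > 0\<close> by simp
  moreover have "- (\<mu> (ball \<xi> t) / t ^ m) \<le> (J' * t ^ m - J \<xi> t * (real m * t ^ (m - 1))) / (t ^ m * t ^ m)"
  proof -
    have tm: "t ^ m = t * t ^ (m - 1)" using m_pos by (cases m) auto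
    have "(J' * t ^ m - J \<xi> t * (real m * t ^ (m - 1))) = t ^ (m - 1) * (t * J' - m * J \<xi> t)"
      unfolding tm by (simp add: algebra_simps)
    also have "\<dots> = - (t ^ (m - 1) * A)" by (simp add: tJ')
    finally have eq: "(J' * t ^ m - J \<xi> t * (real m * t ^ (m - 1))) / (t ^ m * t ^ m) = - (A / t) / t ^ m"
      using \<open>t > 0\<close> by (simp add: tm)
    have "A / t \<le> \<mu> (ball \<xi> t)" using A \<open>t > 0\<close> by (simp add: divide_le_eq mult.commute)
    then have "- \<mu> (ball \<xi> t) / t ^ m \<le> - (A / t) / t ^ m"
      using \<open>t > 0\<close> by (intro divide_right_mono) auto
    then show ?thesis unfolding eq by simp
  qed
  ultimately show ?thesis by (rule that)
qed

text \<open>The mean value theorem on [r/2, r] replaces integration of the differential inequality;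
  on this interval \<open>t ^ m\<close> is at least \<open>(r / 2) ^ m\<close>, and
  \<open>\<mu> (ball \<xi> t)\<close> is largest at \<open>r\<close>.\<close>

lemma J_monotonicity:
  assumes "r > 0"
  shows "J \<xi> (r / 2) / (r / 2) ^ m \<le> J \<xi> r / r ^ m + (r / 2) * (2 / r) ^ m * \<mu> (ball \<xi> r)"
proof -
  define D where "D t = (SOME D. ((\<lambda>t. J \<xi> t / t ^ m) has_real_derivative D) (at t) \<and>
      - (\<mu> (ball \<xi> t) / t ^ m) \<le> D)" for t
  have D: "((\<lambda>t. J \<xi> t / t ^ m) has_real_derivative D t) (at t)" "- (\<mu> (ball \<xi> t) / t ^ m) \<le> D t"
    if "t > 0" for t
  proof -
    have "\<exists>D. ((\<lambda>t. J \<xi> t / t ^ m) has_real_derivative D) (at t) \<and> - (\<mu> (ball \<xi> t) / t ^ m) \<le> D"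
      using J_quotient_derivative[OF that, of \<xi>] by blast
    from someI_ex[OF this] show "((\<lambda>t. J \<xi> t / t ^ m) has_real_derivative D t) (at t)"
      "- (\<mu> (ball \<xi> t) / t ^ m) \<le> D t" unfolding D_def by auto
  qed
  have "\<exists>z>r / 2. z < r \<and> J \<xi> r / r ^ m - J \<xi> (r / 2) / (r / 2) ^ m = (r - r / 2) * D z"
    by (rule MVT2) (use \<open>r > 0\<close> D(1) in auto)
  then obtain z where z: "r / 2 < z" "z < r"
    "J \<xi> r / r ^ m - J \<xi> (r / 2) / (r / 2) ^ m = (r / 2) * D z" by (auto simp: field_simps)
  have "z > 0" using z(1) \<open>r > 0\<close> by linarith
  have "\<mu> (ball \<xi> z) / z ^ m \<le> \<mu> (ball \<xi> r) / (r / 2) ^ m"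
    using z \<open>r > 0\<close> by (intro frac_le \<mu>_mono power_mono \<mu>_nonneg) auto
  also have "\<dots> = (2 / r) ^ m * \<mu> (ball \<xi> r)"
    by (simp add: power_divide field_simps)
  finally have "- D z \<le> (2 / r) ^ m * \<mu> (ball \<xi> r)" using D(2)[OF \<open>z > 0\<close>] by linarith
  then have "(r / 2) * - D z \<le> (r / 2) * ((2 / r) ^ m * \<mu> (ball \<xi> r))"
    using \<open>r > 0\<close> by (intro mult_left_mono) auto
  then show ?thesis using z(3) unfolding mult.assoc mult_minus_right by linarith
qed

text \<open>If the inequality failed at all scales \<open>r0 / 2 ^ k\<close>, then monotonicity would keep
  \<open>J \<xi> t / t ^ m\<close> below \<open>2 \<parallel>V\<parallel>(Q) / r0 ^ m\<close> for \<open>t\<close> running through these scales, which contradicts the density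
  bound at \<open>\<xi>\<close>. The factor 16 leaves room for the factor 5 of Vitali's lemma, as \<open>radial\<close> is
  known to be 1 on a quarter of its range only.\<close>

lemma exists_good_radius:
  assumes "\<xi> \<in> T" and u1: "\<rho> > 0" "\<And>x. x \<in> T \<Longrightarrow> dist \<xi> x < \<rho> \<Longrightarrow> u x = 1"
    and dens: "\<rho>' > 0" "\<And>r. 0 < r \<Longrightarrow> r < \<rho>' \<Longrightarrow>
        ennreal (unit_ball_vol (real m) / 2 * r ^ m) \<le> emeasure W (cball \<xi> r)"
    and r0: "r0 > 0" "2 ^ (m + 2) * measure W Q < unit_ball_vol (real m) * r0 ^ m"
  shows "\<exists>k::nat. J \<xi> (16 * (r0 / 2 ^ k)) \<le> 2 * 32 ^ m * r0 * \<mu> (ball \<xi> (r0 / 2 ^ k))"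
proof (rule ccontr)
  define r where "r k = r0 / 2 ^ k" for k :: nat
  define a where "a t = J \<xi> t / t ^ m" for t
  define B where "B = measure W Q / r0 ^ m"
  have B: "B \<ge> 0" using r0 by (simp add: B_def)
  have rpos: "r k > 0" for k using r0 by (simp add: r_def)
  assume "\<not> ?thesis"
  then have neg: "2 * 32 ^ m * r0 * \<mu> (ball \<xi> (r k)) < J \<xi> (16 * r k)" for k
    by (auto simp: r_def not_le)
  have large: "a t \<le> B" if "t \<ge> r0" for t
  proof -
    have "J \<xi> t / t ^ m \<le> measure W Q / r0 ^ m"
      using that r0 J_upper by (intro frac_le power_mono) auto
    then show ?thesis by (simp add: a_def B_def)
  qed
  \<comment> \<open>Failure of the claim at scale \<open>r k\<close> replaces \<open>\<mu>\<close>
    in the monotonicity by \<open>J\<close> at the scale \<open>16 * r k\<close>. The constants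
    collapse by \<open>(2 / r k) ^ m * (16 * r k) ^ m = 32 ^ m\<close>, and \<open>r k / r0\<close>
    supplies the summable factor \<open>1 / 2 ^ k\<close>.\<close>
  have step: "a (r (Suc k)) \<le> a (r k) + a (16 * r k) / (4 * 2 ^ k)" for k
  proof -
    have "a (r (Suc k)) \<le> a (r k) + (r k / 2) * (2 / r k) ^ m * \<mu> (ball \<xi> (r k))"
    proof -
      have "r (Suc k) = r k / 2" by (simp add: r_def)
      then show ?thesis using J_monotonicity[OF rpos[of k], of \<xi>] by (simp only: a_def)
    qed
    also have "(r k / 2) * (2 / r k) ^ m * \<mu> (ball \<xi> (r k))
        \<le> (r k / 2) * (2 / r k) ^ m * (J \<xi> (16 * r k) / (2 * 32 ^ m * r0))"
    proof (rule mult_left_mono)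
      show "\<mu> (ball \<xi> (r k)) \<le> J \<xi> (16 * r k) / (2 * 32 ^ m * r0)"
        using neg[of k] r0 by (simp add: pos_le_divide_eq mult.commute less_imp_le)
    qed (use rpos[of k] in simp)
    also have "\<dots> = a (16 * r k) / (4 * 2 ^ k)"
    proof -
      have "(2 / r k) ^ m * J \<xi> (16 * r k) = 32 ^ m * a (16 * r k)"
      proof -
        have "(32::real) ^ m = (2 / r k) ^ m * (16 * r k) ^ m"
        proof -
          have "(2 / r k) * (16 * r k) = 32" using rpos[of k] by simp
          then show ?thesis by (simp only: power_mult_distrib[symmetric])
        qed
        then show ?thesis using rpos[of k] by (simp add: a_def)
      qed
      moreover have "(r k / 2) * (2 / r k) ^ m * (J \<xi> (16 * r k) / (2 * 32 ^ m * r0)) =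
          (r k / 2) * ((2 / r k) ^ m * J \<xi> (16 * r k)) / (2 * 32 ^ m * r0)" by simp
      ultimately have "(r k / 2) * (2 / r k) ^ m * (J \<xi> (16 * r k) / (2 * 32 ^ m * r0)) =
          (r k / 2) * (32 ^ m * a (16 * r k)) / (2 * 32 ^ m * r0)" by (simp only:)
      also have "\<dots> = a (16 * r k) * (r k / r0) / 4" by (simp add: mult.commute)
      also have "r k / r0 = 1 / 2 ^ k" using r0 by (simp add: r_def)
      finally show ?thesis by simp
    qed
    finally show ?thesis by simp
  qed
  \<comment> \<open>Adding the increments \<open>2 * B / (4 * 2 ^ j)\<close> to the initial value
    \<open>B\<close> gives this geometric sum, which stays below \<open>2 * B\<close>.\<close>
  have bound: "a (r k) \<le> B * (2 - 1 / 2 ^ k)" for k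
  proof (induction k rule: less_induct)
    case (less k)
    show ?case
    proof (cases k)
      case 0
      then show ?thesis using large[of "r 0"] by (simp add: r_def)
    next
      case (Suc j)
      \<comment> \<open>Since 16 = 2 ^ 4, the enlarged scale is either at least \<open>r0\<close> or
        lies four indices back; hence the strong induction.\<close>
      have "a (16 * r j) \<le> 2 * B"
      proof (cases "j < 4")
        case True
        then have "(2::real) ^ j \<le> 2 ^ 4" by (intro power_increasing) auto
        then have "16 * r j \<ge> r0" using r0 by (simp add: r_def field_simps)
        then show ?thesis using large[of "16 * r j"] B by linarith
      next
        case False
        then have j: "j = (j - 4) + 4" by simp
        have "16 * r j = r (j - 4)"
          by (subst j) (simp add: r_def power_add)
        moreover have "a (r (j - 4)) \<le> B * (2 - 1 / 2 ^ (j - 4))"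
          using less.IH[of "j - 4"] Suc by simp
        moreover have "B * (2 - 1 / 2 ^ (j - 4)) \<le> B * 2"
          using B by (intro mult_left_mono) auto
        ultimately show ?thesis by simp
      qed
      then have "a (16 * r j) / (4 * 2 ^ j) \<le> 2 * B / (4 * 2 ^ j)"
        by (intro divide_right_mono) auto
      moreover have "a (r j) \<le> B * (2 - 1 / 2 ^ j)" using less.IH[of j] Suc by simp
      ultimately have "a (r (Suc j)) \<le> B * (2 - 1 / 2 ^ j) + 2 * B / (4 * 2 ^ j)"
        using step[of j] by linarith
      also have "\<dots> = B * (2 - 1 / 2 ^ Suc j)" by (simp add: field_simps)
      finally show ?thesis using Suc by simp
    qed
  qed
  have "r \<longlonglongrightarrow> 0"
    unfolding r_def by (rule LIMSEQ_divide_realpow_zero) simp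
  obtain e where e: "e > 0" "cball \<xi> e \<subseteq> U"
    using open_U assms(1) spt_subset open_contains_cball by blast
  have "\<forall>\<^sub>F k in sequentially. r k < min e (min \<rho> \<rho>')"
    by (rule order_tendstoD(2)[OF \<open>r \<longlonglongrightarrow> 0\<close>]) (use e(1) u1(1) dens(1) in simp)
  then obtain k where "r k < min e (min \<rho> \<rho>')"
    by (auto simp: eventually_sequentially)
  then have k: "r k < e" "r k < \<rho>" "r k < \<rho>'" by auto
  define t where "t = r k"
  have t: "t > 0" using rpos by (simp add: t_def)
  define F where "F = cball \<xi> (t / 2)"
  have F: "F \<in> sets W"
    using e k t by (intro borel_in_sets_W) (auto simp: F_def t_def)
  have "u x = 1" if "x \<in> F \<inter> T" for x
    using that u1(2)[of x] k t by (auto simp: F_def t_def)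
  then have JF: "measure W F \<le> J \<xi> t" "emeasure W F < \<infinity>"
    using J_lower[OF t F, of \<xi>] by (auto simp: F_def)
  have "ennreal (unit_ball_vol (real m) / 2 * (t / 2) ^ m) \<le> ennreal (measure W F)"
    using dens(2)[of "t / 2"] k t JF(2)
    by (simp add: F_def[symmetric] t_def[symmetric] emeasure_eq_ennreal_measure)
  then have "unit_ball_vol (real m) / 2 * (t / 2) ^ m \<le> J \<xi> t"
    using JF(1) by (simp add: ennreal_le_iff)
  \<comment> \<open>The power m + 2 in the hypothesis on \<open>r0\<close> collects the 1/2 of the
    density bound, the \<open>1 / 2 ^ m\<close> of the half radius and the 2 of
    \<open>bound\<close>.\<close>
  then have "unit_ball_vol (real m) / 2 ^ (m + 1) \<le> a t"
    using t by (simp add: a_def power_divide field_simps)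
  also have "a t \<le> B * (2 - 1 / 2 ^ k)" unfolding t_def by (rule bound)
  also have "\<dots> \<le> B * 2" using B by (intro mult_left_mono) auto
  finally have "unit_ball_vol (real m) * r0 ^ m \<le> 2 ^ (m + 2) * measure W Q"
    using r0(1) by (simp add: B_def field_simps)
  then show False using r0(2) by linarith
qed

text \<open>All good radii are at most \<open>r0\<close>, so Vitali's lemma selects disjoint balls
  whose fivefold enlargements cover almost all of \<open>E\<close>. By disjointness the bounds for
  the selected balls add up to at most the total over \<open>Q\<close>.\<close>

lemma weak_isoperimetric:
  assumes E: "E \<in> sets W" "E \<subseteq> T"
    and u1: "\<And>\<xi>. \<xi> \<in> E \<Longrightarrow> \<exists>\<rho>>0. \<forall>x\<in>T. dist \<xi> x < \<rho> \<longrightarrow> u x = 1"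
    and r0: "r0 > 0" "2 ^ (m + 2) * measure W Q < unit_ball_vol (real m) * r0 ^ m"
  shows "measure W E \<le> 2 * 32 ^ m * r0 * (\<Lambda> * measure W Q + measure \<nu> Q)"
proof -
  define A where "A = 2 * 32 ^ m * r0"
  define M where "M = A * (\<Lambda> * measure W Q + measure \<nu> Q)"
  have A: "A \<ge> 0" using r0 by (simp add: A_def)
  have M: "M \<ge> 0" using A \<Lambda>_nonneg by (simp add: M_def)
  obtain N where N: "{x \<in> space W. \<not> (\<exists>\<rho>>0. \<forall>r. 0 < r \<and> r < \<rho> \<longrightarrow>
      ennreal (unit_ball_vol (real m) / 2 * r ^ m) \<le> emeasure W (cball x r))} \<subseteq> N"
    "emeasure W N = 0" "N \<in> sets W"
    using AE_E[OF density] .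
  define E' where "E' = E - N"
  have E': "E' \<in> sets W" "E' \<subseteq> T" "emeasure W E' = emeasure W E"
    using E N by (auto simp: E'_def intro!: emeasure_Diff_null_set)
  have "\<exists>k::nat. J \<xi> (16 * (r0 / 2 ^ k)) \<le> A * \<mu> (ball \<xi> (r0 / 2 ^ k))" if "\<xi> \<in> E'" for \<xi>
  proof -
    have \<xi>: "\<xi> \<in> T" "\<xi> \<in> E" "\<xi> \<notin> N" "\<xi> \<in> space W"
      using that E'(2) spt_subset by (auto simp: E'_def space_W)
    obtain \<rho> where "\<rho> > 0" "\<forall>x\<in>T. dist \<xi> x < \<rho> \<longrightarrow> u x = 1" using u1[OF \<xi>(2)] by blast
    moreover obtain \<rho>' where "\<rho>' > 0" "\<forall>r. 0 < r \<and> r < \<rho>' \<longrightarrow>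
      ennreal (unit_ball_vol (real m) / 2 * r ^ m) \<le> emeasure W (cball \<xi> r)"
      using N(1) \<xi>(3,4) by blast
    ultimately show ?thesis
      unfolding A_def using exists_good_radius[OF \<xi>(1) _ _ _ _ r0, of \<rho> \<rho>'] by blast
  qed
  then obtain k where k: "\<And>\<xi>. \<xi> \<in> E' \<Longrightarrow> J \<xi> (16 * (r0 / 2 ^ k \<xi>)) \<le> A * \<mu> (ball \<xi> (r0 / 2 ^ k \<xi>))"
    by metis
  define rad where "rad \<xi> = r0 / 2 ^ k \<xi>" for \<xi>
  have rad: "0 < rad \<xi>" "rad \<xi> \<le> r0" for \<xi>
    using r0 by (auto simp: rad_def divide_le_eq)
  \<comment> \<open>Radius \<open>5 * rad \<xi>\<close> lies below \<open>8 * rad \<xi>\<close>,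
    half of the radius at which \<open>J\<close> is estimated, so \<open>J_lower\<close> applies to
    this set.\<close>
  define F where "F \<xi> = E \<inter> ball \<xi> (5 * rad \<xi>)" for \<xi>
  have F_sets: "F \<xi> \<in> sets W" for \<xi>
  proof -
    have "F \<xi> = E \<inter> (ball \<xi> (5 * rad \<xi>) \<inter> U)" using E spt_subset by (auto simp: F_def)
    moreover have "ball \<xi> (5 * rad \<xi>) \<inter> U \<in> sets W" using open_U by (intro borel_in_sets_W) auto
    ultimately show ?thesis using E(1) by simp
  qed
  have F: "emeasure W (F \<xi>) \<le> ennreal (A * \<mu> (ball \<xi> (rad \<xi>)))" if "\<xi> \<in> E'" for \<xi>
  proof -
    have sub: "F \<xi> \<subseteq> cball \<xi> (16 * rad \<xi> / 2)" using rad(1)[of \<xi>] by (auto simp: F_def)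
    have one: "u x = 1" if "x \<in> F \<xi> \<inter> T" for x
    proof -
      have "x \<in> E" "x \<in> T" using that by (auto simp: F_def)
      then show ?thesis using u1[of x] by (metis dist_self)
    qed
    have "measure W (F \<xi>) \<le> J \<xi> (16 * rad \<xi>)" "emeasure W (F \<xi>) < \<infinity>"
      using J_lower[OF _ F_sets sub one] rad(1)[of \<xi>] by auto
    then show ?thesis
      using k[OF that] by (simp add: emeasure_eq_ennreal_measure rad_def[symmetric] ennreal_leI)
  qed
  obtain C where C: "countable C" "C \<subseteq> E'"
    "pairwise (\<lambda>i j. disjnt (cball i (rad i)) (cball j (rad j))) C"
    "\<And>i. i \<in> E' \<Longrightarrow> \<exists>j. j \<in> C \<and> \<not> disjnt (cball i (rad i)) (cball j (rad j)) \<and>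
       cball i (rad i) \<subseteq> ball j (5 * rad j)"
    by (rule Vitali_covering_lemma_cballs_balls[of E' rad r0 "\<lambda>x. x"]) (use rad in auto)
  have fin: "emeasure W (\<Union>j\<in>D. F j) \<le> ennreal M" if D: "finite D" "D \<subseteq> C" for D
  proof -
    have disj: "disjoint_family_on (\<lambda>j. ball j (rad j) \<inter> Q) D"
      unfolding disjoint_family_on_def
    proof (intro ballI impI)
      fix i j assume "i \<in> D" "j \<in> D" "i \<noteq> j"
      then have "disjnt (cball i (rad i)) (cball j (rad j))"
        using C(3) D(2) by (auto simp: pairwise_def)
      then show "ball i (rad i) \<inter> Q \<inter> (ball j (rad j) \<inter> Q) = {}"
        using ball_subset_cball[of i "rad i"] ball_subset_cball[of j "rad j"]
        unfolding disjnt_def by blast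
    qed
    let ?B = "\<Union>j\<in>D. ball j (rad j)"
    have B: "?B \<in> sets borel" using D(1) by (intro borel_open open_UN) auto
    have un: "(\<Union>j\<in>D. ball j (rad j) \<inter> Q) = ?B \<inter> Q" by blast
    have bQ: "ball j (rad j) \<inter> Q \<in> sets W" "ball j (rad j) \<inter> Q \<in> sets \<nu>" 
      "emeasure W (ball j (rad j) \<inter> Q) \<noteq> \<infinity>" "emeasure \<nu> (ball j (rad j) \<inter> Q) \<noteq> \<infinity>" for j
      using inter_Q[of "ball j (rad j)"] by auto
    have "(\<Sum>j\<in>D. measure W (ball j (rad j) \<inter> Q)) = measure W (?B \<inter> Q)"
      unfolding un[symmetric] by (rule measure_finite_Union[symmetric]) (use D(1) disj bQ in auto)
    also have "\<dots> \<le> measure W Q"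
      using inter_Q[OF B] Q_sets W_Q by (intro measure_mono_fmeasurable) (auto simp: fmeasurable_def)
    finally have 1: "(\<Sum>j\<in>D. measure W (ball j (rad j) \<inter> Q)) \<le> measure W Q" .
    have "(\<Sum>j\<in>D. measure \<nu> (ball j (rad j) \<inter> Q)) = measure \<nu> (?B \<inter> Q)"
      unfolding un[symmetric] by (rule measure_finite_Union[symmetric]) (use D(1) disj bQ in auto)
    also have "\<dots> \<le> measure \<nu> Q"
      using inter_Q[OF B] Q_sets \<nu>_Q by (intro measure_mono_fmeasurable) (auto simp: fmeasurable_def)
    finally have 2: "(\<Sum>j\<in>D. measure \<nu> (ball j (rad j) \<inter> Q)) \<le> measure \<nu> Q" .
    have "(\<Sum>j\<in>D. A * \<mu> (ball j (rad j))) = A * (\<Lambda> * (\<Sum>j\<in>D. measure W (ball j (rad j) \<inter> Q))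
        + (\<Sum>j\<in>D. measure \<nu> (ball j (rad j) \<inter> Q)))"
      by (simp only: \<mu>_def sum.distrib sum_distrib_left[symmetric])
    also have "\<dots> \<le> M"
      unfolding M_def using 1 2 A \<Lambda>_nonneg by (intro mult_left_mono add_mono) auto
    finally have 3: "(\<Sum>j\<in>D. A * \<mu> (ball j (rad j))) \<le> M" .
    have "emeasure W (\<Union>j\<in>D. F j) \<le> (\<Sum>j\<in>D. emeasure W (F j))"
      using D(1) F_sets by (intro emeasure_subadditive_finite) auto
    also have "\<dots> \<le> (\<Sum>j\<in>D. ennreal (A * \<mu> (ball j (rad j))))"
      using C(2) D(2) by (intro sum_mono F) auto
    also have "\<dots> = ennreal (\<Sum>j\<in>D. A * \<mu> (ball j (rad j)))"
      using A \<mu>_nonneg by (intro sum_ennreal) auto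
    also have "\<dots> \<le> ennreal M" using 3 by (rule ennreal_leI)
    finally show ?thesis .
  qed
  \<comment> \<open>The finite subfamilies of \<open>C\<close> with code at most \<open>n\<close>
    exhaust \<open>C\<close>, so continuity from below carries \<open>fin\<close> over to the
    countable union.\<close>
  define G where "G n = (\<Union>j\<in>{j \<in> C. to_nat_on C j \<le> n}. F j)" for n
  have finC: "finite {j \<in> C. to_nat_on C j \<le> n}" for n
    using finite_vimage_IntI[OF finite_atMost[of n] inj_on_to_nat_on[OF C(1)]]
    by (rule finite_subset[rotated]) auto
  have G_sets: "G n \<in> sets W" for n
    unfolding G_def by (rule sets.finite_UN[OF finC F_sets])
  have "emeasure W E = emeasure W E'" using E' by simp
  also have "\<dots> \<le> emeasure W (\<Union>n. G n)"
  proof (rule emeasure_mono)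
    show "E' \<subseteq> (\<Union>n. G n)"
    proof
      fix x assume x: "x \<in> E'"
      then obtain j where j: "j \<in> C" "cball x (rad x) \<subseteq> ball j (5 * rad j)" using C(4) by blast
      have "x \<in> cball x (rad x)" using rad(1)[of x] by simp
      then have "x \<in> ball j (5 * rad j)" using j(2) by blast
      then have "x \<in> F j" using x by (simp add: F_def E'_def)
      then show "x \<in> (\<Union>n. G n)" using j(1) unfolding G_def by blast
    qed
    show "(\<Union>n. G n) \<in> sets W"
      using G_sets by (intro sets.countable_UN) blast
  qed
  also have "\<dots> = (SUP n. emeasure W (G n))"
  proof (rule SUP_emeasure_incseq[symmetric])
    show "incseq G" unfolding incseq_def G_def by (intro allI impI UN_mono) auto
  qed (use G_sets in blast)
  also have "\<dots> \<le> ennreal M"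
    unfolding G_def by (intro SUP_least fin finC) auto
  finally have "measure W E \<le> M"
    unfolding measure_def using M by (intro enn2real_leI)
  then show ?thesis unfolding M_def A_def .
qed

end

section \<open>Comparing the masses of two sublevel sets\<close>

context varifold_bounded_variation
begin

text \<open>\<open>f\<close> is controlled only on \<open>T\<close> and only at scale
  \<open>\<delta>\<close>; this still makes the sublevel set the intersection of \<open>T\<close>
  with a union of balls.\<close>

lemma sublevel_sets_W:
  assumes "\<delta> > 0" "\<And>p q. p \<in> T \<Longrightarrow> q \<in> T \<Longrightarrow> dist p q < \<delta> \<Longrightarrow> \<bar>f p - f q\<bar> \<le> dist p q"
  shows "{p \<in> T. f p < (s::real)} \<in> sets W"
proof -
  have "{p \<in> T. f p < s} = T \<inter> (\<Union>q\<in>{q \<in> T. f q < s}. ball q (min \<delta> (s - f q)))"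
  proof (intro equalityI subsetI)
    fix p assume "p \<in> T \<inter> (\<Union>q\<in>{q \<in> T. f q < s}. ball q (min \<delta> (s - f q)))"
    then obtain q where "p \<in> T" "q \<in> T" "dist q p < \<delta>" "dist q p < s - f q" by auto
    then show "p \<in> {p \<in> T. f p < s}" using assms(2)[of q p] by auto
  qed (use assms(1) in force)
  moreover have "T \<inter> (\<Union>q\<in>{q \<in> T. f q < s}. ball q (min \<delta> (s - f q))) \<in> sets borel"
    by (rule sets.Int[OF spt_borel borel_open]) (intro open_UN ballI open_ball)
  ultimately show ?thesis using spt_subset by (intro borel_in_sets_W) auto
qed

text \<open>The last clause is the smallness that matches the isoperimetric scaling; for m = 1 it
  reads \<open>measure \<nu> Q \<le> \<epsilon>\<close>. The \<open>\<tau>\<close>-neighbourhood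
  inside \<open>Y\<close> leaves space for the supports of smooth cutoffs.\<close>

definition admissible :: "(real^'n \<Rightarrow> real) \<Rightarrow> real \<Rightarrow> real \<Rightarrow> (real^'n) set \<Rightarrow> real \<Rightarrow> bool" where
  "admissible f \<delta> s Y \<epsilon> \<longleftrightarrow> 0 < \<delta> \<and> 0 \<le> \<epsilon> \<and>
     (\<forall>p\<in>T. \<forall>q\<in>T. dist p q < \<delta> \<longrightarrow> \<bar>f p - f q\<bar> \<le> dist p q) \<and>
     (\<exists>\<tau>>0. (\<Union>q\<in>{q\<in>T. f q < s}. ball q \<tau>) \<subseteq> Y) \<and> open Y \<and> Y \<subseteq> U \<and> bounded Y \<and>
     emeasure W Y < \<infinity> \<and> emeasure \<nu> Y < \<infinity> \<and>
     (\<forall>Q. open Q \<longrightarrow> Q \<subseteq> Y \<longrightarrow> measure \<nu> Q \<le> \<epsilon> * root m (measure W Q) ^ (m - 1))"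

text \<open>A cutoff between the two levels has gradient of order 1 / (s2 - s1). With
  \<open>\<rho>\<close> the m-th root of the mass of \<open>Q\<close> and a radius proportional to
  \<open>\<rho>\<close>, the gradient term is of order \<open>\<rho>\<close> times that mass over s2
  - s1, and the variation term is at most \<open>\<epsilon> * \<rho> ^ m\<close>, up to a factor.
  The constant of \<open>ex_smooth_cutoff\<close> is independent of \<open>\<delta>\<close>, hence
  so is \<open>C\<close>.\<close>

lemma sublevel_step:
  "\<exists>C>0. \<forall>f \<delta> s1 s2 Y \<epsilon>. s1 < s2 \<longrightarrow> admissible f \<delta> s2 Y \<epsilon> \<longrightarrow>
     measure W {p\<in>T. f p < s1} \<le>
       C * (root m (measure W {p\<in>T. f p < s2}) / (s2 - s1) + \<epsilon>) * measure W {p\<in>T. f p < s2}"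
proof -
  obtain K0 where K0: "K0 > 0" "\<And>(T :: (real^'n) set) c L \<delta> \<tau>. 0 < \<delta> \<Longrightarrow> 0 < \<tau> \<Longrightarrow> 0 \<le> L \<Longrightarrow>
     (\<forall>p. 0 \<le> c p \<and> c p \<le> 1) \<Longrightarrow>
     (\<forall>p\<in>T. \<forall>q\<in>T. dist p q < \<delta> \<longrightarrow> \<bar>c p - c q\<bar> \<le> L * dist p q) \<Longrightarrow>
     bounded {p\<in>T. c p \<noteq> 0} \<Longrightarrow> \<exists>u. smooth_cutoff T c (K0 * L) \<tau> u"
    using ex_smooth_cutoff[where 'n='n] by (elim exE conjE) blast
  define \<alpha> where "\<alpha> = unit_ball_vol (real m)"
  have \<alpha>: "\<alpha> > 0" by (simp add: \<alpha>_def unit_ball_vol_pos)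
  \<comment> \<open>Chosen so that the radius \<open>c0 * \<rho>\<close> meets the hypothesis on
    \<open>r0\<close> in \<open>weak_isoperimetric\<close> with a factor 2 to spare.\<close>
  define c0 where "c0 = root m (2 ^ (m + 3) / \<alpha>)"
  have m0: "0 < m" using m_pos by simp
  have c0: "c0 > 0" "\<alpha> * c0 ^ m = 2 ^ (m + 3)"
    using \<alpha> m0 by (auto simp: c0_def real_root_pow_pos2 real_root_gt_zero)
  define A where "A = 2 * 32 ^ m * c0"
  have A: "A > 0" using c0 by (simp add: A_def)
  define C where "C = A * (2 * K0 + 1)"
  have C: "C > 0" using A K0(1) by (simp add: C_def)
  have main: "measure W {p\<in>T. f p < s1} \<le>
       C * (root m (measure W {p\<in>T. f p < s2}) / (s2 - s1) + \<epsilon>) * measure W {p\<in>T. f p < s2}"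
    if s: "s1 < s2" and adm: "admissible f \<delta> s2 Y \<epsilon>" for f \<delta> s1 s2 Y \<epsilon>
  proof -
    have \<delta>: "0 < \<delta>" and \<epsilon>: "0 \<le> \<epsilon>"
      and lip: "\<forall>p\<in>T. \<forall>q\<in>T. dist p q < \<delta> \<longrightarrow> \<bar>f p - f q\<bar> \<le> dist p q"
      and Y: "open Y" "Y \<subseteq> U" "bounded Y" "emeasure W Y < \<infinity>" "emeasure \<nu> Y < \<infinity>"
      and \<nu>: "\<forall>Q. open Q \<longrightarrow> Q \<subseteq> Y \<longrightarrow> measure \<nu> Q \<le> \<epsilon> * root m (measure W Q) ^ (m - 1)"
      using adm unfolding admissible_def by - (elim conjE, assumption)+
    have "\<exists>\<tau>>0. (\<Union>q\<in>{q\<in>T. f q < s2}. ball q \<tau>) \<subseteq> Y"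
      using adm unfolding admissible_def by (elim conjE)
    then obtain \<tau>0 where \<tau>0: "0 < \<tau>0" and nb: "(\<Union>q\<in>{q\<in>T. f q < s2}. ball q \<tau>0) \<subseteq> Y"
      by blast
    define h where "h = s2 - s1"
    have h: "h > 0" using s by (simp add: h_def)
    define \<tau> where "\<tau> = min \<tau>0 (min \<delta> (h / 8))"
    have \<tau>: "\<tau> > 0" "\<tau> \<le> \<tau>0" "\<tau> \<le> \<delta>" "\<tau> \<le> h / 8" using \<tau>0 \<delta> h by (auto simp: \<tau>_def)
    \<comment> \<open>A ramp of slope \<open>2 / h\<close> in \<open>f\<close>, equal to 1 up to
      level \<open>s1 + h / 4\<close> and to 0 from \<open>s2 - h / 4\<close> on. The margins absorb
      up to two moves of length \<open>\<tau> \<le> h / 8\<close>.\<close>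
    define c where "c p = max 0 (min 1 ((s2 - h / 4 - f p) * (2 / h)))" for p
    define M2 where "M2 = measure W {p\<in>T. f p < s2}"
    have lip': "\<bar>f p - f q\<bar> \<le> dist p q" if "p \<in> T" "q \<in> T" "dist p q < \<delta>" for p q
      using lip that by blast
    have sub_sets: "{p\<in>T. f p < s} \<in> sets W" for s
      by (rule sublevel_sets_W[OF \<delta> lip'])
    have c01: "\<forall>p. 0 \<le> c p \<and> c p \<le> 1" by (simp add: c_def)
    have c1: "c p = 1" if "f p \<le> s1 + h / 4" for p
    proof -
      have "h / 2 \<le> s2 - h / 4 - f p" using that by (simp add: h_def field_simps)
      then have "(h / 2) * (2 / h) \<le> (s2 - h / 4 - f p) * (2 / h)"
        using h by (intro mult_right_mono) auto
      then show ?thesis using h by (simp add: c_def)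
    qed
    have c0': "f p < s2 - h / 4" if "c p \<noteq> 0" for p
    proof (rule ccontr)
      assume "\<not> ?thesis"
      then have "(s2 - h / 4 - f p) * (2 / h) \<le> 0"
        using h by (intro mult_nonpos_nonneg) auto
      then show False using that by (simp add: c_def)
    qed
    have cl: "\<bar>c p - c q\<bar> \<le> (2 / h) * dist p q" if "p \<in> T" "q \<in> T" "dist p q < \<delta>" for p q
    proof -
      have "\<bar>c p - c q\<bar> \<le> \<bar>(s2 - h / 4 - f p) * (2 / h) - (s2 - h / 4 - f q) * (2 / h)\<bar>"
        unfolding c_def by linarith
      also have "\<dots> = (2 / h) * \<bar>f p - f q\<bar>"
      proof -
        have "(s2 - h / 4 - f p) * (2 / h) - (s2 - h / 4 - f q) * (2 / h) = (2 / h) * (f q - f p)"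
          unfolding left_diff_distrib[symmetric] by simp
        then show ?thesis using h by (simp only: abs_mult abs_minus_commute[of "f q"]) simp
      qed
      also have "\<dots> \<le> (2 / h) * dist p q" using lip'[OF that] h by (intro mult_left_mono) auto
      finally show ?thesis .
    qed
    define Q where "Q = (\<Union>q\<in>{q\<in>T. c q \<noteq> 0}. ball q \<tau>)"
    have QY: "Q \<subseteq> Y"
    proof
      fix x assume "x \<in> Q"
      then obtain q where q: "q \<in> T" "c q \<noteq> 0" "x \<in> ball q \<tau>" by (auto simp: Q_def)
      then have "f q < s2" "x \<in> ball q \<tau>0" using c0'[OF q(2)] h \<tau>(2) by auto
      then show "x \<in> Y" using nb q(1) by blast
    qed
    have bdd: "bounded {p\<in>T. c p \<noteq> 0}"
    proof (rule bounded_subset[OF Y(3)])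
      show "{p\<in>T. c p \<noteq> 0} \<subseteq> Y" using QY \<tau>(1) by (force simp: Q_def)
    qed
    have L: "0 \<le> 2 / h" using h by simp
    obtain u where u: "\<forall>k. C_k_on k u UNIV" "\<forall>x. 0 \<le> u x \<and> u x \<le> 1"
      "\<forall>x\<in>T. \<forall>v. \<bar>frechet_derivative u (at x) v\<bar> \<le> K0 * (2 / h) * norm v"
      "\<forall>x\<in>T. (\<forall>p\<in>T. dist p x < \<tau> \<longrightarrow> c p = 1) \<longrightarrow> u x = 1"
      "closure {x. u x \<noteq> 0} \<subseteq> Q"
      using K0(2)[OF \<delta> \<tau>(1) L c01 _ bdd] cl unfolding Q_def smooth_cutoff_def by blast
    have openQ: "open Q" unfolding Q_def by (intro open_UN) auto
    have Ysets: "Y \<in> sets W" "Y \<in> sets \<nu>"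
      using Y borel_in_sets_W borel_in_sets_\<nu> by auto
    have "bounded (closure {x. u x \<noteq> 0})"
      by (rule bounded_subset[OF Y(3) order_trans[OF u(5) QY]])
    then have comp: "compact (closure {x. u x \<noteq> 0})"
      unfolding compact_eq_bounded_closed by (intro conjI closed_closure)
    have WQ: "emeasure W Q < \<infinity>" "emeasure \<nu> Q < \<infinity>"
      by (rule le_less_trans[OF emeasure_mono[OF QY Ysets(1)] Y(4)],
          rule le_less_trans[OF emeasure_mono[OF QY Ysets(2)] Y(5)])
    interpret varifold_cutoff m U V \<nu> u Q "K0 * (2 / h)"
      using u openQ QY Y(2) comp WQ K0(1) h by unfold_locales auto
    have "measure W Q \<le> M2"
    proof -
      have "Q \<inter> T \<subseteq> {p\<in>T. f p < s2}"
      proof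
        fix x assume x: "x \<in> Q \<inter> T"
        then obtain q where q: "q \<in> T" "c q \<noteq> 0" "dist q x < \<tau>" by (auto simp: Q_def)
        then have "\<bar>f q - f x\<bar> \<le> dist q x" using lip'[of q x] x \<tau>(3) by auto
        then have "f x < s2" using c0'[OF q(2)] q(3) \<tau>(4) h by linarith
        then show "x \<in> {p\<in>T. f p < s2}" using x by simp
      qed
      then have "emeasure W (Q \<inter> T) \<le> emeasure W {p\<in>T. f p < s2}"
        by (rule emeasure_mono[OF _ sub_sets])
      moreover have "emeasure W {p\<in>T. f p < s2} < \<infinity>"
      proof (rule le_less_trans[OF emeasure_mono[OF _ Ysets(1)] Y(4)])
        show "{p\<in>T. f p < s2} \<subseteq> Y" using nb \<tau>0 by force
      qed
      ultimately show ?thesis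
        unfolding M2_def measure_def emeasure_Int_spt[OF Q_sets(1)] by (intro enn2real_mono) auto
    qed
    define E where "E = {p\<in>T. f p < s1}"
    have E: "E \<in> sets W" "E \<subseteq> T" unfolding E_def using sub_sets by auto
    have EQ: "E \<subseteq> Q"
    proof
      fix x assume "x \<in> E"
      then have "x \<in> T" "c x = 1" using c1[of x] h by (auto simp: E_def)
      then show "x \<in> Q" using \<tau>(1) by (force simp: Q_def)
    qed
    define \<rho> where "\<rho> = root m (measure W Q)"
    have \<rho>: "\<rho> \<ge> 0" "\<rho> ^ m = measure W Q" "\<rho> \<le> root m M2"
      using m0 \<open>measure W Q \<le> M2\<close> by (auto simp: \<rho>_def real_root_pow_pos2)
    have "measure W E \<le> C * (root m M2 / h + \<epsilon>) * M2"
    \<comment> \<open>Without mass in \<open>Q\<close> the radius \<open>c0 * \<rho>\<close> would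
      be 0; then \<open>E \<subseteq> Q\<close> settles the claim.\<close>
    proof (cases "measure W Q = 0")
      case True
      have "measure W E \<le> measure W Q"
        using EQ E(1) Q_sets WQ by (intro measure_mono_fmeasurable) (auto simp: fmeasurable_def)
      also have "\<dots> \<le> C * (root m M2 / h + \<epsilon>) * M2"
        using True C h \<epsilon> \<rho> by (simp add: M2_def)
      finally show ?thesis .
    next
      case False
      then have WQ0: "measure W Q > 0" by (simp add: zero_less_measure_iff)
      then have "\<rho> > 0" using m0 by (simp add: \<rho>_def)
      have r0: "c0 * \<rho> > 0" using c0 \<open>\<rho> > 0\<close> by simp
      have "unit_ball_vol (real m) * (c0 * \<rho>) ^ m = 2 ^ (m + 3) * measure W Q"
        using c0(2) \<rho>(2) by (simp add: power_mult_distrib \<alpha>_def[symmetric] mult.assoc[symmetric])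
      moreover have "(2::real) ^ (m + 2) < 2 ^ (m + 3)" by (intro power_strict_increasing) auto
      ultimately have r0': "2 ^ (m + 2) * measure W Q < unit_ball_vol (real m) * (c0 * \<rho>) ^ m"
        using WQ0 by (simp add: mult_strict_right_mono)
      have one: "\<exists>\<rho>>0. \<forall>x\<in>T. dist \<xi> x < \<rho> \<longrightarrow> u x = 1" if "\<xi> \<in> E" for \<xi>
      proof (intro exI[of _ \<tau>] conjI ballI impI \<tau>(1))
        fix x assume x: "x \<in> T" "dist \<xi> x < \<tau>"
        have \<xi>: "\<xi> \<in> T" "f \<xi> < s1" using that by (auto simp: E_def)
        have "c p = 1" if "p \<in> T" "dist p x < \<tau>" for p
        proof (rule c1)
          have "\<bar>f p - f x\<bar> \<le> dist p x" using that x(1) \<tau>(3) by (intro lip') auto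
          moreover have "\<bar>f \<xi> - f x\<bar> \<le> dist \<xi> x" using \<xi>(1) x \<tau>(3) by (intro lip') auto
          ultimately show "f p \<le> s1 + h / 4" using that(2) x(2) \<xi>(2) \<tau>(4) by linarith
        qed
        then show "u x = 1" using u(4)[rule_format, OF x(1)] by simp
      qed
      have "measure W E \<le> 2 * 32 ^ m * (c0 * \<rho>) * (K0 * (2 / h) * measure W Q + measure \<nu> Q)"
        by (rule weak_isoperimetric[OF E one r0 r0'])
      also have "\<dots> = A * (\<rho> * (K0 * (2 / h) * measure W Q + measure \<nu> Q))"
        by (simp add: A_def)
      also have "\<dots> \<le> A * (\<rho> * (K0 * (2 / h) * measure W Q + \<epsilon> * \<rho> ^ (m - 1)))"
        using \<nu> openQ QY A \<rho>(1) unfolding \<rho>_def by (intro mult_left_mono add_left_mono) auto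
      also have "\<dots> = A * ((K0 * (2 / h) * \<rho> + \<epsilon>) * measure W Q)"
      proof -
        have "\<rho> * \<rho> ^ (m - 1) = measure W Q" using \<rho>(2) m0 by (cases m) auto
        then have "\<rho> * (\<epsilon> * \<rho> ^ (m - 1)) = \<epsilon> * measure W Q" by (simp add: mult.left_commute)
        then show ?thesis by (simp add: algebra_simps)
      qed
      also have "\<dots> \<le> A * ((2 * K0 + 1) * (root m M2 / h + \<epsilon>) * M2)"
      proof -
        have "K0 * (2 / h) * \<rho> + \<epsilon> \<le> (2 * K0 + 1) * (root m M2 / h + \<epsilon>)"
        proof -
          have "\<rho> / h \<le> root m M2 / h" using \<rho>(3) h by (intro divide_right_mono) auto
          then have "2 * K0 * (\<rho> / h) \<le> 2 * K0 * (root m M2 / h)"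
            using K0(1) by (intro mult_left_mono) auto
          moreover have "0 \<le> root m M2 / h" using \<rho> h by (intro divide_nonneg_nonneg) linarith+
          moreover have "0 \<le> 2 * K0 * \<epsilon>" using K0(1) \<epsilon> by simp
          moreover have "K0 * (2 / h) * \<rho> = 2 * K0 * (\<rho> / h)" by simp
          moreover have "(2 * K0 + 1) * (root m M2 / h + \<epsilon>) =
              2 * K0 * (root m M2 / h) + 2 * K0 * \<epsilon> + root m M2 / h + \<epsilon>"
            by (simp only: distrib_left distrib_right mult_1_left add.assoc)
          ultimately show ?thesis by linarith
        qed
        moreover have "0 \<le> (2 * K0 + 1) * (root m M2 / h + \<epsilon>)"
          using K0(1) \<epsilon> h \<rho> by (intro mult_nonneg_nonneg add_nonneg_nonneg divide_nonneg_nonneg) linarith+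
        ultimately show ?thesis
          using \<open>measure W Q \<le> M2\<close> A by (intro mult_left_mono mult_mono) auto
      qed
      finally show ?thesis by (simp add: C_def mult.assoc)
    qed
    then show ?thesis by (simp add: E_def M2_def h_def)
  qed
  show ?thesis
    by (intro exI[of _ C] conjI C; intro allI impI) (rule main)
qed

end

section \<open>Lower mass bounds for intrinsic balls and connecting curves\<close>

context varifold_bounded_variation
begin

text \<open>If the conclusion failed, then by \<open>sublevel_step\<close> the masses of the sets where
  \<open>f < S / 2 + S / 2 ^ (k + 1)\<close> would decay geometrically, so that \<open>{f < S / 2}\<close> would be a null set
  containing a neighbourhood of \<open>a\<close> in \<open>spt \<parallel>V\<parallel>\<close>.\<close>

lemma sublevel_growth:
  "\<exists>\<epsilon>>0. \<exists>c>0. \<forall>f \<delta> S Y a. 0 < S \<longrightarrow> admissible f \<delta> S Y \<epsilon> \<longrightarrow> a \<in> T \<longrightarrow> f a = 0 \<longrightarrow>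
     c * S ^ m \<le> measure W {p\<in>T. f p < S}"
proof -
  obtain C where C: "C > 0" "\<And>f \<delta> s1 s2 Y \<epsilon>. s1 < s2 \<Longrightarrow> admissible f \<delta> s2 Y \<epsilon> \<Longrightarrow>
     measure W {p\<in>T. f p < s1} \<le>
       C * (root m (measure W {p\<in>T. f p < s2}) / (s2 - s1) + \<epsilon>) * measure W {p\<in>T. f p < s2}"
    using sublevel_step by (elim exE conjE) blast
  \<comment> \<open>Both constants contribute half of
    \<open>C * (4 * c' + \<epsilon>) = 1 / 2 ^ m\<close>. One step of the iteration then divides the
    mass bound by \<open>2 ^ m\<close> while \<open>c' * S / 2 ^ k\<close> is halved, so
    \<open>bound\<close> reproduces itself. The 4 compares \<open>S / 2 ^ k\<close> with the gap
    \<open>S / 2 ^ (k + 2)\<close> between consecutive levels.\<close>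
  define \<epsilon> where "\<epsilon> = 1 / (2 ^ m * (2 * C))"
  define c' where "c' = 1 / (2 ^ m * (8 * C))"
  have pos: "\<epsilon> > 0" "c' > 0" using C by (auto simp: \<epsilon>_def c'_def)
  have const: "C * (4 * c' + \<epsilon>) = 1 / 2 ^ m"
    using C(1) by (simp add: \<epsilon>_def c'_def field_simps)
  have m0: "0 < m" using m_pos by simp
  have main: "c' ^ m * S ^ m \<le> measure W {p\<in>T. f p < S}"
    if S: "0 < S" and adm: "admissible f \<delta> S Y \<epsilon>" and a: "a \<in> T" "f a = 0" for f \<delta> S Y a
  proof (rule ccontr)
    assume "\<not> ?thesis"
    then have small: "measure W {p\<in>T. f p < S} < (c' * S) ^ m" by (simp add: power_mult_distrib)
    have \<delta>: "0 < \<delta>" and lip: "\<forall>p\<in>T. \<forall>q\<in>T. dist p q < \<delta> \<longrightarrow> \<bar>f p - f q\<bar> \<le> dist p q"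
      and Y: "open Y" "Y \<subseteq> U" "emeasure W Y < \<infinity>"
      using adm unfolding admissible_def by - (elim conjE, assumption)+
    have "\<exists>\<tau>>0. (\<Union>q\<in>{q\<in>T. f q < S}. ball q \<tau>) \<subseteq> Y"
      using adm unfolding admissible_def by (elim conjE)
    then obtain \<tau>0 where \<tau>0: "0 < \<tau>0" and nb: "(\<Union>q\<in>{q\<in>T. f q < S}. ball q \<tau>0) \<subseteq> Y"
      by blast
    define s where "s k = S / 2 + S / 2 ^ (k + 1)" for k :: nat
    define M where "M k = measure W {p\<in>T. f p < s k}" for k
    have sS: "s k \<le> S" for k
    proof -
      have "S / 2 ^ (k + 1) \<le> S / 2 ^ 1" using S by (intro divide_left_mono power_increasing) auto
      then show ?thesis by (simp add: s_def)
    qed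
    have lip': "\<bar>f p - f q\<bar> \<le> dist p q" if "p \<in> T" "q \<in> T" "dist p q < \<delta>" for p q
      using lip that by blast
    have sub_sets: "{p\<in>T. f p < t} \<in> sets W" for t by (rule sublevel_sets_W[OF \<delta> lip'])
    have Ysets: "Y \<in> sets W" using Y by (intro borel_in_sets_W) auto
    have subY: "{p\<in>T. f p < t} \<subseteq> Y" if "t \<le> S" for t
    proof
      fix p assume "p \<in> {p\<in>T. f p < t}"
      then have "p \<in> T" "f p < S" "p \<in> ball p \<tau>0" using that \<tau>0 by auto
      then show "p \<in> Y" using nb by blast
    qed
    have bound: "M k \<le> (c' * S / 2 ^ k) ^ m" for k
    proof (induction k)
      case 0
      then show ?case using small by (simp add: M_def s_def)
    next
      case (Suc k)
      have diff: "s k - s (Suc k) = S / 2 ^ (k + 2)" by (simp add: s_def field_simps)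
      have "0 < S / 2 ^ (k + 2)" using S by simp
      then have "s (Suc k) < s k" using diff by linarith
      have "(\<Union>q\<in>{q\<in>T. f q < s k}. ball q \<tau>0) \<subseteq> Y"
        using nb sS[of k] by fastforce
      then have admk: "admissible f \<delta> (s k) Y \<epsilon>"
        using adm \<tau>0 unfolding admissible_def by - (elim conjE, intro conjI exI[of _ \<tau>0], assumption+)
      have Mnn: "0 \<le> M k" by (simp add: M_def)
      have "root m (M k) \<le> root m ((c' * S / 2 ^ k) ^ m)" using Suc m0 by simp
      also have "\<dots> = c' * S / 2 ^ k" using m0 pos S by (intro real_root_power_cancel) auto
      finally have "root m (M k) / (S / 2 ^ (k + 2)) \<le> (c' * S / 2 ^ k) / (S / 2 ^ (k + 2))"
        using S by (intro divide_right_mono) auto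
      also have "\<dots> = 4 * c'" using S by simp
      finally have r: "root m (M k) / (s k - s (Suc k)) \<le> 4 * c'" by (simp only: diff)
      have "M (Suc k) \<le> C * (root m (M k) / (s k - s (Suc k)) + \<epsilon>) * M k"
        unfolding M_def
        by (rule C(2)[OF \<open>s (Suc k) < s k\<close> admk])
      also have "\<dots> \<le> C * (4 * c' + \<epsilon>) * M k"
        using r C(1) Mnn by (intro mult_right_mono mult_left_mono) auto
      also have "\<dots> = M k / 2 ^ m" by (simp add: const)
      also have "\<dots> \<le> (c' * S / 2 ^ k) ^ m / 2 ^ m" using Suc by (intro divide_right_mono) auto
      also have "\<dots> = (c' * S / 2 ^ Suc k) ^ m"
      proof -
        have "c' * S / 2 ^ Suc k = (c' * S / 2 ^ k) / 2" by simp
        then show ?thesis by (simp only: power_divide)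
      qed
      finally show ?case .
    qed
    have fin: "emeasure W {p\<in>T. f p < s k} < \<infinity>" for k
      by (rule le_less_trans[OF emeasure_mono[OF subY[OF sS] Ysets] Y(3)])
    have "measure W {p\<in>T. f p < S / 2} \<le> (c' * S / 2 ^ k) ^ m" for k
    proof -
      have "S / 2 \<le> s k" using S by (simp add: s_def)
      then have "{p\<in>T. f p < S / 2} \<subseteq> {p\<in>T. f p < s k}" by auto
      then have "measure W {p\<in>T. f p < S / 2} \<le> M k"
        unfolding M_def
        by (rule measure_mono_fmeasurable[OF _ sub_sets fmeasurableI[OF sub_sets fin]])
      then show ?thesis using bound[of k] by linarith
    qed
    moreover have "(\<lambda>k. (c' * S / 2 ^ k) ^ m) \<longlonglongrightarrow> 0 ^ m"
      by (intro tendsto_power LIMSEQ_divide_realpow_zero) simp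
    ultimately have "measure W {p\<in>T. f p < S / 2} \<le> 0"
      using m0 LIMSEQ_le_const[of "\<lambda>k. (c' * S / 2 ^ k) ^ m" 0 "measure W {p\<in>T. f p < S / 2}"]
      by (simp add: zero_power)
    then have z: "measure W {p\<in>T. f p < S / 2} = 0"
      using measure_nonneg[of W "{p\<in>T. f p < S / 2}"] by linarith
    have "S / 2 \<le> S" using S by simp
    then have "emeasure W {p\<in>T. f p < S / 2} < \<infinity>"
      by (intro le_less_trans[OF emeasure_mono[OF subY Ysets] Y(3)])
    then have ez: "emeasure W {p\<in>T. f p < S / 2} = 0"
      using z by (simp add: emeasure_eq_ennreal_measure)
    define B where "B = ball a (min \<delta> (S / 2)) \<inter> U"
    have B: "open B" "a \<in> B" "B \<subseteq> U" using open_U a(1) spt_subset \<delta> S by (auto simp: B_def)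
    have "B \<in> sets W" using B by (intro borel_in_sets_W) auto
    have "B \<inter> T \<subseteq> {p\<in>T. f p < S / 2}"
    proof
      fix p assume p: "p \<in> B \<inter> T"
      then have "dist a p < \<delta>" "dist a p < S / 2" by (auto simp: B_def)
      moreover have "\<bar>f a - f p\<bar> \<le> dist a p" using lip'[OF a(1)] p \<open>dist a p < \<delta>\<close> by blast
      ultimately show "p \<in> {p\<in>T. f p < S / 2}" using p a(2) by auto
    qed
    then have "emeasure W (B \<inter> T) \<le> emeasure W {p\<in>T. f p < S / 2}"
      by (rule emeasure_mono[OF _ sub_sets])
    also note ez
    finally have "emeasure W B = 0" using emeasure_Int_spt[OF \<open>B \<in> sets W\<close>] by simp
    then show False using spt_emeasure_pos[OF a(1) B(1,2,3)] by simp
  qed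
  show ?thesis
    by (intro exI[of _ \<epsilon>] exI[of _ "c' ^ m"] conjI pos(1) zero_less_power[OF pos(2)];
        intro allI impI) (rule main)
qed

text \<open>Smallness is asked near each point separately, with \<open>R\<close> depending on the
  point and on \<open>\<epsilon>\<close>. Removing the centre is what lets every Radon measure
  \<open>\<nu>\<close> satisfy it when m = 1.\<close>

definition locally_small_variation :: bool where
  "locally_small_variation \<longleftrightarrow> (\<forall>x\<in>T. \<forall>\<epsilon>>0. \<exists>R>0. cball x R \<subseteq> U \<and>
     emeasure \<nu> (ball x R) < \<infinity> \<and> (\<forall>Q. open Q \<longrightarrow> Q \<subseteq> ball x R - {x} \<longrightarrow>
       measure \<nu> Q \<le> \<epsilon> * root m (measure W Q) ^ (m - 1)))"

lemma locally_chain_joined: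
  assumes small: "locally_small_variation" and x: "x \<in> T"
  shows "\<exists>r>0. \<forall>y\<in>T. dist x y < r \<longrightarrow> chain_joined T y x"
proof (rule ccontr)
  obtain \<epsilon> c where \<epsilon>: "\<epsilon> > 0" and c: "c > 0" and
    growth: "\<And>f \<delta> S Y a. 0 < S \<Longrightarrow> admissible f \<delta> S Y \<epsilon> \<Longrightarrow> a \<in> T \<Longrightarrow> f a = 0 \<Longrightarrow>
      c * S ^ m \<le> measure W {p\<in>T. f p < S}"
    using sublevel_growth by (elim exE conjE) blast
  obtain R where R: "R > 0" "cball x R \<subseteq> U" "emeasure \<nu> (ball x R) < \<infinity>"
    "\<forall>Q. open Q \<longrightarrow> Q \<subseteq> ball x R - {x} \<longrightarrow>
        measure \<nu> Q \<le> \<epsilon> * root m (measure W Q) ^ (m - 1)"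
    using small[unfolded locally_small_variation_def, rule_format, OF x \<epsilon>] by (elim exE conjE)
  \<comment> \<open>Budget of lengths: intrinsic balls have radius \<open>S\<close>, the centres of
    two meeting ones are joined within \<open>2 * S\<close>, and a last step to \<open>x\<close>
    stays within \<open>3 * S\<close>. The \<open>y i\<close> lie within \<open>S\<close> of
    \<open>x\<close>, so chains of that length remain within \<open>4 * S < R\<close>.\<close>
  define S where "S = R / 8"
  have S: "S > 0" "4 * S < R" using R by (auto simp: S_def)
  define Y where "Y = ball x R - {x}"
  have bR: "ball x R \<subseteq> U" using R(2) ball_subset_cball[of x R] by blast
  have Y: "open Y" "Y \<subseteq> U" "bounded Y"
    using bR by (auto simp: Y_def intro: open_delete bounded_subset[OF bounded_ball])
  have YW: "Y \<in> sets W" using Y by (intro borel_in_sets_W) auto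
  have WY: "emeasure W Y < \<infinity>"
  proof -
    have "emeasure W (cball x R) < \<infinity>" by (rule compact_emeasure_finite(1)[OF compact_cball R(2)])
    moreover have "cball x R \<in> sets W" using R(2) by (intro borel_in_sets_W) auto
    moreover have "Y \<subseteq> cball x R" by (auto simp: Y_def)
    ultimately show ?thesis using emeasure_mono le_less_trans by blast
  qed
  have \<nu>Y: "emeasure \<nu> Y < \<infinity>"
  proof -
    have "ball x R \<in> sets \<nu>" using bR by (intro borel_in_sets_\<nu>) auto
    then have "emeasure \<nu> Y \<le> emeasure \<nu> (ball x R)" by (intro emeasure_mono) (auto simp: Y_def)
    then show ?thesis using R(3) by (rule le_less_trans)
  qed
  assume not: "\<not> ?thesis"
  have "\<exists>y\<in>T. dist x y < min S (1 / Suc i) \<and> \<not> chain_joined T y x" for i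
  proof -
    have "0 < min S (1 / Suc i)" using S(1) by simp
    then show ?thesis using not by blast
  qed
  then obtain y where y: "\<And>i. y i \<in> T" "\<And>i. dist x (y i) < min S (1 / Suc i)"
    "\<And>i. \<not> chain_joined T (y i) x" by metis
  have yS: "dist x (y i) < S" "dist x (y i) < 1 / Suc i" for i using y(2)[of i] by auto
  \<comment> \<open>Otherwise chains of length at most \<open>3 * S\<close> at every scale would
    join \<open>y i\<close> to \<open>x\<close> inside the compact set
    \<open>cball x R \<inter> T\<close>.\<close>
  have "\<exists>d>0. \<forall>k\<le>3 * S. \<not> chain T d (y i) x k" for i
  proof (rule ccontr)
    assume no: "\<not> ?thesis"
    have "\<exists>k\<le>3 * S. chain (cball x R \<inter> T) \<delta> (y i) x k" if \<delta>: "\<delta> > 0" for \<delta>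
    proof -
      obtain k where k: "k \<le> 3 * S" "chain T \<delta> (y i) x k" using no \<delta> by blast
      have "cball (y i) k \<subseteq> cball x R"
      proof
        fix z assume "z \<in> cball (y i) k"
        then show "z \<in> cball x R"
          using dist_triangle[of x z "y i"] yS(1)[of i] k(1) S(2) by simp
      qed
      then have "chain (cball x R \<inter> T) \<delta> (y i) x k" by (intro chain_mono[OF k(2)]) auto
      then show ?thesis using k(1) by blast
    qed
    then have "chain_joined T (y i) x"
      unfolding chain_joined_def using spt_inter_compact[OF compact_cball R(2)]
      by (intro exI[of _ "cball x R \<inter> T"] exI[of _ "3 * S"]) simp
    then show False using y(3) by blast
  qed
  then obtain d where d: "\<And>i. d i > 0" "\<And>i k. k \<le> 3 * S \<Longrightarrow> \<not> chain T (d i) (y i) x k" by metis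
  define near where "near i j \<longleftrightarrow> (\<forall>\<delta>>0. \<exists>k\<le>2 * S. chain T \<delta> (y i) (y j) k)" for i j
  have near_sym: "near i j \<Longrightarrow> near j i" for i j
  proof -
    assume n: "near i j"
    have "\<exists>k\<le>2 * S. chain T \<delta> (y j) (y i) k" if \<delta>: "\<delta> > 0" for \<delta>
    proof -
      obtain k where k: "k \<le> 2 * S" "chain T \<delta> (y i) (y j) k" using n \<delta> unfolding near_def by blast
      show ?thesis using k(1) chain_sym[OF k(2) \<delta>] by blast
    qed
    then show "near j i" by (simp add: near_def)
  qed
  \<comment> \<open>A pair is coloured by whether its points are joined at every scale. Ramsey's
    theorem yields infinitely many indices for which either all pairs are near or none is.\<close>
  define col :: "nat set \<Rightarrow> nat" where "col A = (if \<exists>i j. A = {i, j} \<and> near i j then 1 else 0)" for A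
  have col: "col {i, j} = 1 \<longleftrightarrow> near i j" for i j
    using near_sym by (auto simp: col_def doubleton_eq_iff)
  have col_less: "col A < 2" for A by (simp add: col_def)
  obtain I t where I: "infinite I" "\<forall>i\<in>I. \<forall>j\<in>I. i \<noteq> j \<longrightarrow> col {i, j} = t"
    using Ramsey2[of "UNIV :: nat set" col 2] col_less infinite_UNIV_nat by blast
  show False
  proof (cases "t = 1")
    case True
    \<comment> \<open>For large \<open>j\<close> the point \<open>y j\<close> is within
      \<open>d i\<close> of \<open>x\<close>, so \<open>x\<close> can be appended to a chain from
      \<open>y i\<close> to \<open>y j\<close>, contrary to the choice of
      \<open>d i\<close>.\<close>
    have "I \<noteq> {}" using I(1) by auto
    then obtain i where i: "i \<in> I" by blast
    have "0 < min S (d i)" using S(1) d(1)[of i] by simp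
    then obtain n where n: "1 / Suc n < min S (d i)" by (rule nat_approx_posE)
    obtain j where j: "j \<in> I" "j > max n i"
      using infinite_nat_iff_unbounded[THEN iffD1, OF I(1), rule_format, of "max n i"] by blast
    have "col {i, j} = t" using I(2) i j by auto
    then have "near i j" using True col[of i j] by simp
    then obtain k where k: "k \<le> 2 * S" "chain T (d i) (y i) (y j) k"
      using d(1)[of i] unfolding near_def by blast
    have "1 / real (Suc j) \<le> 1 / Suc n" using j(2) by (intro divide_left_mono) auto
    then have jx: "dist (y j) x < S" "dist (y j) x < d i"
      using yS(2)[of j] n by (auto simp: dist_commute)
    have "chain T (d i) (y i) x (k + dist (y j) x)" by (rule chain_step[OF k(2) x jx(2)])
    moreover have "k + dist (y j) x \<le> 3 * S" using k(1) jx(1) by linarith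
    ultimately show False using d(2) by blast
  next
    case False
    have notnear: "\<not> near i j" if "i \<in> I" "j \<in> I" "i \<noteq> j" for i j
    proof -
      have "col {i, j} = t" using I(2) that by blast
      then show ?thesis using False col[of i j] by simp
    qed
    have "\<exists>e>0. \<forall>k\<le>2 * S. \<not> chain T e (y i) (y j) k" if "i \<in> I" "j \<in> I" "i \<noteq> j" for i j
      using notnear[OF that] unfolding near_def by blast
    then obtain e where e: "\<And>i j. i \<in> I \<Longrightarrow> j \<in> I \<Longrightarrow> i \<noteq> j \<Longrightarrow> e i j > 0"
      "\<And>i j k. i \<in> I \<Longrightarrow> j \<in> I \<Longrightarrow> i \<noteq> j \<Longrightarrow> k \<le> 2 * S \<Longrightarrow> \<not> chain T (e i j) (y i) (y j) k"
      by metis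
    have cS: "c * S ^ m > 0" using c S by simp
    obtain N :: nat where N: "measure W Y < real N * (c * S ^ m)"
      using reals_Archimedean3[OF cS] by blast
    obtain F where F: "F \<subseteq> I" "finite F" "card F = N"
      using infinite_arbitrarily_large[OF I(1)] by blast
    \<comment> \<open>Only finitely many centres are used, so one scale lies below all
      \<open>d i\<close> and \<open>e i j\<close>. The lower mass bound from \<open>growth\<close>
      does not depend on it.\<close>
    define \<delta> where "\<delta> = Min (insert S (d ` F \<union> (\<lambda>(i, j). e i j) ` {(i, j). i \<in> F \<and> j \<in> F \<and> i \<noteq> j}))"
    have finP: "finite {(i, j). i \<in> F \<and> j \<in> F \<and> i \<noteq> j}"
      by (rule finite_subset[of _ "F \<times> F"]) (use F(2) in auto)
    have eF: "e i j > 0" if "i \<in> F" "j \<in> F" "i \<noteq> j" for i j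
      using e(1) F(1) that by blast
    have \<delta>: "\<delta> > 0" "\<delta> \<le> S" "\<And>i. i \<in> F \<Longrightarrow> \<delta> \<le> d i"
      "\<And>i j. i \<in> F \<Longrightarrow> j \<in> F \<Longrightarrow> i \<noteq> j \<Longrightarrow> \<delta> \<le> e i j"
      unfolding \<delta>_def using F(2) finP S(1) d(1) eF by (auto intro!: Min_le)
    define D where "D i = {p\<in>T. chain_dist T S \<delta> (y i) p < S}" for i
    have D: "\<exists>k<S. chain T \<delta> (y i) p k" if p: "p \<in> D i" for i p
    proof -
      have "chain_dist T S \<delta> (y i) p < S" using p by (simp add: D_def)
      then obtain k where "chain T \<delta> (y i) p k" "k < S" by (rule chain_dist_less) simp
      then show ?thesis by blast
    qed
    have nbY: "ball p \<delta> \<subseteq> Y" if i: "i \<in> F" and p: "p \<in> D i" for i p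
    proof -
      obtain k where k: "k < S" "chain T \<delta> (y i) p k" using D[OF p] by blast
      have "dist (y i) p \<le> k" by (rule chain_props(3)[OF k(2)])
      then have xp: "dist x p < 2 * S" using dist_triangle[of x p "y i"] yS(1)[of i] k(1) by linarith
      \<comment> \<open>From a point this close to \<open>x\<close> its chain would continue to
        \<open>x\<close> within length \<open>2 * S\<close>. So the whole
        \<open>\<delta>\<close>-neighbourhood of the intrinsic ball avoids the centre and lies in
        the punctured ball \<open>Y\<close>.\<close>
      have "\<not> dist p x < \<delta>"
      proof
        assume px: "dist p x < \<delta>"
        have "chain T \<delta> (y i) x (k + dist p x)" by (rule chain_step[OF k(2) x px])
        then have "chain T (d i) (y i) x (k + dist p x)"
          by (rule chain_mono) (use \<delta>(3)[OF i] in auto)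
        moreover have "k + dist p x \<le> 3 * S" using k(1) px \<delta>(2) S(1) by linarith
        ultimately show False using d(2) by blast
      qed
      show ?thesis
      proof
        fix z assume "z \<in> ball p \<delta>"
        then have z: "dist p z < \<delta>" by simp
        then have "z \<noteq> x" using \<open>\<not> dist p x < \<delta>\<close> by auto
        moreover have "dist x z < R"
          using dist_triangle[of x z p] xp z \<delta>(2) S by linarith
        ultimately show "z \<in> Y" by (simp add: Y_def)
      qed
    qed
    have lip: "\<forall>p\<in>T. \<forall>q\<in>T. dist p q < \<delta> \<longrightarrow>
        \<bar>chain_dist T S \<delta> (y i) p - chain_dist T S \<delta> (y i) q\<bar> \<le> dist p q" for i
      by (intro ballI impI chain_dist_local_lipschitz)
    have D_sets: "D i \<in> sets W" for i
      unfolding D_def by (rule sublevel_sets_W[OF \<delta>(1) chain_dist_local_lipschitz])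
    have big: "c * S ^ m \<le> measure W (D i)" if i: "i \<in> F" for i
      unfolding D_def
    proof (rule growth[OF S(1) _ y(1)])
      have "(\<Union>q\<in>{q \<in> T. chain_dist T S \<delta> (y i) q < S}. ball q \<delta>) \<subseteq> Y"
        using nbY[OF i] by (auto simp: D_def)
      then show "admissible (chain_dist T S \<delta> (y i)) \<delta> S Y \<epsilon>"
        using \<delta>(1) \<epsilon> Y WY \<nu>Y lip[of i] R(4)
        unfolding admissible_def Y_def[symmetric] by (intro conjI exI[of _ \<delta>]) simp_all
      show "chain_dist T S \<delta> (y i) (y i) = 0" using y(1) S(1) by (intro chain_dist_self) auto
    qed
    have DY: "D i \<subseteq> Y" if "i \<in> F" for i
    proof
      fix p assume "p \<in> D i"
      then have "ball p \<delta> \<subseteq> Y" by (rule nbY[OF that])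
      then show "p \<in> Y" using \<delta>(1) by (auto dest: subsetD[of _ _ p])
    qed
    have disj: "disjoint_family_on D F"
      unfolding disjoint_family_on_def
    proof (intro ballI impI)
      fix i j assume ij: "i \<in> F" "j \<in> F" "i \<noteq> j"
      show "D i \<inter> D j = {}"
      proof (rule ccontr)
        assume "D i \<inter> D j \<noteq> {}"
        then obtain p where p: "p \<in> D i" "p \<in> D j" by blast
        obtain k where k: "k < S" "chain T \<delta> (y i) p k" using D[OF p(1)] by blast
        obtain l where l: "l < S" "chain T \<delta> (y j) p l" using D[OF p(2)] by blast
        have "chain T \<delta> (y i) (y j) (k + l)"
          by (rule chain_trans[OF chain_sym[OF l(2) \<delta>(1)] k(2)])
        then have "chain T (e i j) (y i) (y j) (k + l)"
          by (rule chain_mono) (use \<delta>(4)[OF ij] in auto)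
        moreover have "k + l \<le> 2 * S" using k(1) l(1) by linarith
        ultimately show False using e(2)[of i j "k + l"] ij F(1) by blast
      qed
    qed
    have finD: "emeasure W (D i) \<noteq> \<infinity>" if "i \<in> F" for i
      using emeasure_mono[OF DY[OF that] YW] WY by (auto simp: top_unique)
    have "real N * (c * S ^ m) = (\<Sum>i\<in>F. c * S ^ m)" using F(3) by simp
    also have "\<dots> \<le> (\<Sum>i\<in>F. measure W (D i))" by (rule sum_mono[OF big])
    also have "\<dots> = measure W (\<Union>i\<in>F. D i)"
      by (rule measure_finite_Union[symmetric]) (use F(2) D_sets disj finD in auto)
    also have "\<dots> \<le> measure W Y"
      using DY D_sets F(2) YW WY by (intro measure_mono_fmeasurable) (auto simp: fmeasurable_def)
    finally show False using N by linarith
  qed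
qed

lemma component_chain_joined:
  assumes small: "locally_small_variation"
    and C: "C \<in> components T" "w \<in> C" "z \<in> C"
  shows "chain_joined T w z"
proof (rule connected_equivalence_relation[of C])
  show "connected C" using C(1) by (rule in_components_connected)
  have CT: "C \<subseteq> T" using C(1) by (rule in_components_subset)
  show "chain_joined T y x" if "chain_joined T x y" for x y
    using that by (rule chain_joined_sym)
  show "chain_joined T x z" if "chain_joined T x y" "chain_joined T y z" for x y z
    using that by (rule chain_joined_trans)
  show "\<exists>A. openin (top_of_set C) A \<and> a \<in> A \<and> (\<forall>x\<in>A. chain_joined T a x)" if a: "a \<in> C" for a
  proof -
    have "a \<in> T" using a CT by blast
    obtain r where r: "r > 0" "\<forall>y\<in>T. dist a y < r \<longrightarrow> chain_joined T y a"
      using locally_chain_joined[OF small \<open>a \<in> T\<close>] by blast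
    have "chain_joined T a x" if "x \<in> C \<inter> ball a r" for x
      by (rule chain_joined_sym) (use r(2) that CT in auto)
    then show ?thesis using a r(1) by (intro exI[of _ "C \<inter> ball a r"]) auto
  qed
qed (rule C(2), rule C(3))

end

text \<open>The punctured balls decrease to the empty set, so continuity from above applies; with
  the centre included, an atom would remain in the limit.\<close>

lemma punctured_ball_small:
  fixes x :: "'a::metric_space"
  assumes "R0 > 0" "\<And>r. 0 < r \<Longrightarrow> r \<le> R0 \<Longrightarrow> ball x r - {x} \<in> sets M"
    and "emeasure M (ball x R0 - {x}) < \<infinity>" "e > 0"
  obtains R where "0 < R" "R \<le> R0" "emeasure M (ball x R - {x}) < ennreal e"
proof -
  define A where "A n = ball x (R0 / Suc n) - {x}" for n :: nat
  have r: "0 < R0 / Suc n" "R0 / Suc n \<le> R0" for n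
    using assms(1) by (auto simp: divide_le_eq mult_le_cancel_left1)
  have "(\<lambda>n. emeasure M (A n)) \<longlonglongrightarrow> emeasure M (\<Inter>n. A n)"
  proof (rule Lim_emeasure_decseq)
    show "range A \<subseteq> sets M" using assms(2) r by (auto simp: A_def)
    show "decseq A"
      unfolding decseq_def A_def using assms(1)
      by (intro allI impI Diff_mono subset_ball divide_left_mono) auto
    show "emeasure M (A n) \<noteq> \<infinity>" for n
    proof -
      have "emeasure M (A n) \<le> emeasure M (ball x R0 - {x})"
        unfolding A_def using assms(1,2) r[of n] by (intro emeasure_mono Diff_mono subset_ball) auto
      then show ?thesis using assms(3) by (auto simp: top_unique)
    qed
  qed
  moreover have "(\<Inter>n. A n) = {}"
  proof (rule ccontr)
    assume "(\<Inter>n. A n) \<noteq> {}"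
    then obtain y where y: "\<And>n. y \<in> A n" by blast
    have "0 < dist x y / R0" using y[of 0] assms(1) by (auto simp: A_def)
    then obtain n where "1 / Suc n < dist x y / R0" by (rule nat_approx_posE)
    then have "R0 / Suc n < dist x y" using assms(1) by (simp add: field_simps)
    then show False using y[of n] by (simp add: A_def)
  qed
  ultimately have "(\<lambda>n. emeasure M (A n)) \<longlonglongrightarrow> 0" by simp
  then have "\<forall>\<^sub>F n in sequentially. emeasure M (A n) < ennreal e"
    by (rule order_tendstoD(2)) (use assms(4) in simp)
  then obtain n where "emeasure M (A n) < ennreal e" by (auto simp: eventually_sequentially)
  then show ?thesis using that[of "R0 / Suc n"] r[of n] by (simp add: A_def)
qed

section \<open>From the density and variation hypotheses to the locale bounds\<close>

context varifold_in_open
begin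

text \<open>The density exceeds 1/2, and a strict inequality passes from the limit to all small
  radii.\<close>

lemma has_density_imp_lower_bound:
  assumes "has_density m W x d" "d \<ge> 1"
  shows "\<exists>\<rho>>0. \<forall>r. 0 < r \<and> r < \<rho> \<longrightarrow>
      ennreal (unit_ball_vol (real m) / 2 * r ^ m) \<le> emeasure W (cball x r)"
proof -
  have "ennreal (1 / 2) < 1" using ennreal_lessI[of 1 "1 / 2"] by simp
  then have "ennreal (1 / 2) < d" using assms(2) by (rule less_le_trans)
  then have "\<forall>\<^sub>F r in at_right 0. ennreal (1 / 2) < emeasure W (cball x r) / ennreal (unit_ball_vol (real m) * r ^ m)"
    using assms(1) unfolding has_density_def by (rule order_tendstoD(1)[rotated])
  then obtain \<rho> where \<rho>: "\<rho> > 0" "\<And>r. 0 < r \<Longrightarrow> r < \<rho> \<Longrightarrow>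
      ennreal (1 / 2) < emeasure W (cball x r) / ennreal (unit_ball_vol (real m) * r ^ m)"
    unfolding eventually_at_right_field by blast
  have "ennreal (unit_ball_vol (real m) / 2 * r ^ m) \<le> emeasure W (cball x r)" if r: "0 < r" "r < \<rho>" for r
  proof -
    have c: "0 < unit_ball_vol (real m) * r ^ m" using r by (simp add: unit_ball_vol_pos)
    have "ennreal (unit_ball_vol (real m) / 2 * r ^ m) =
        ennreal (1 / 2) * ennreal (unit_ball_vol (real m) * r ^ m)"
    proof -
      have "unit_ball_vol (real m) / 2 * r ^ m = (1 / 2) * (unit_ball_vol (real m) * r ^ m)" by simp
      then show ?thesis using c by (simp only: ennreal_mult[OF _ less_imp_le[OF c]])
    qed
    also have "\<dots> \<le> (emeasure W (cball x r) / ennreal (unit_ball_vol (real m) * r ^ m)) *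
        ennreal (unit_ball_vol (real m) * r ^ m)"
      using \<rho>(2)[OF r] by (intro mult_right_mono) auto
    also have "\<dots> = emeasure W (cball x r)"
    proof -
      have "ennreal (unit_ball_vol (real m) * r ^ m) \<noteq> 0" using c by (simp only: ennreal_eq_0_iff not_le)
      then show ?thesis
        by (simp only: ennreal_divide_times ennreal_divide_self[OF _ ennreal_less_top] mult_1_right not_False_eq_True)
    qed
    finally show ?thesis .
  qed
  then show ?thesis using \<rho>(1) by blast
qed

lemma first_variation_scale:
  assumes "g \<in> test_fields U"
  shows "first_variation V (\<lambda>x. c *\<^sub>R g x) = c * first_variation V g"
proof -
  have der: "(g has_derivative frechet_derivative g (at x)) (at x)" for x
    using assms C_k_on_SucD(1)[of 0 g] by (simp add: test_fields_def)
  have D: "frechet_derivative (\<lambda>x. c *\<^sub>R g x) (at x) = (\<lambda>v. c *\<^sub>R frechet_derivative g (at x) v)" for x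
    by (rule frechet_derivative_at[symmetric]) (intro has_derivative_scaleR_right der)
  have lin: "linear (frechet_derivative g (at x))" for x
    by (rule has_derivative_linear[OF der])
  then have lin': "linear (\<lambda>v. c *\<^sub>R frechet_derivative g (at x) v)" for x
    by (rule linear_compose_scale_right)
  have "lin_inner (\<lambda>v. c *\<^sub>R frechet_derivative g (at x) v) P = c * lin_inner (frechet_derivative g (at x)) P"
    for x P
    unfolding lin_inner_eq[OF lin] lin_inner_eq[OF lin'] by (simp add: sum_distrib_left)
  then show ?thesis unfolding first_variation_def D by simp
qed

text \<open>\<open>total_variation\<close> tests fields of norm at most 1, so \<open>g\<close> is
  divided by \<open>r\<close>. The rescaled field competes in the supremum for every open superset
  of \<open>G\<close>, hence its value lies below the infimum.\<close>

lemma variation_measure_bound: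
  assumes \<mu>: "is_variation_measure U (first_variation V) \<mu>"
    and g: "g \<in> test_fields U" and G: "open G" "G \<subseteq> U" "closure {x. g x \<noteq> 0} \<subseteq> G"
    and r: "0 < r" "\<And>x. norm (g x) \<le> r"
  shows "ennreal (first_variation V g) \<le> ennreal r * emeasure \<mu> G"
proof -
  define g' where "g' x = (1 / r) *\<^sub>R g x" for x
  have supp: "{x. g' x \<noteq> 0} = {x. g x \<noteq> 0}" using r(1) by (simp add: g'_def)
  have g': "g' \<in> test_fields U"
    using g unfolding test_fields_def mem_Collect_eq supp
    unfolding g'_def[abs_def] by (auto intro: C_k_on_scaleR C_k_on_const)
  have n: "norm (g' x) \<le> 1" for x using r by (simp add: g'_def divide_le_eq)
  have "ennreal (first_variation V g') \<le> total_variation U (first_variation V) G"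
    unfolding total_variation_def
  proof (intro INF_greatest SUP_upper)
    fix G' assume "G' \<in> {Ga. open Ga \<and> G \<subseteq> Ga \<and> Ga \<subseteq> U}"
    then show "g' \<in> {g \<in> test_fields U. closure {x. g x \<noteq> 0} \<subseteq> G' \<and> (\<forall>x. norm (g x) \<le> 1)}"
      using g' G(3) n supp by auto
  qed
  also have "\<dots> = emeasure \<mu> G"
    using \<mu> borel_in_sets[of G] G(1,2) by (auto simp: is_variation_measure_def)
  finally have *: "ennreal (first_variation V g') \<le> emeasure \<mu> G" .
  have "first_variation V g = r * first_variation V g'"
    using first_variation_scale[OF g, of "1 / r"] r(1) by (simp add: g'_def[abs_def])
  then have "ennreal (first_variation V g) = ennreal r * ennreal (first_variation V g')"
    using r(1) by (simp add: ennreal_mult')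
  also have "\<dots> \<le> ennreal r * emeasure \<mu> G" using * by (rule mult_left_mono) simp
  finally show ?thesis .
qed

end

text \<open>Integrated over \<open>Q\<close> with an optimal \<open>\<kappa>\<close>, this takes the place of Hoelder's inequality.\<close>

lemma le_add_power_div:
  fixes a \<kappa> :: real
  assumes "a \<ge> 0" "\<kappa> > 0" "m \<ge> 1"
  shows "a \<le> \<kappa> + a ^ m / \<kappa> ^ (m - 1)"
proof (cases "a \<le> \<kappa>")
  case True
  have "0 \<le> a ^ m / \<kappa> ^ (m - 1)" using assms by simp
  then show ?thesis using True by linarith
next
  case False
  have "\<kappa> ^ (m - 1) \<le> a ^ (m - 1)" using False assms by (intro power_mono) auto
  then have "a * \<kappa> ^ (m - 1) \<le> a * a ^ (m - 1)" using assms(1) by (intro mult_left_mono)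
  also have "\<dots> = a ^ m" using assms(3) by (cases m) auto
  finally have "a \<le> a ^ m / \<kappa> ^ (m - 1)" using assms(2) by (simp add: pos_le_divide_eq)
  then show ?thesis using assms(2) by linarith
qed

theorem theorem13p2:
  fixes m :: nat
    and U :: "(real^'n) set"
    and V :: "((real^'n) \<times> (real^'n) set) measure"
    and h :: "real^'n \<Rightarrow> real^'n"
    and C :: "(real^'n) set"
    and w z :: "real^'n"
  assumes "1 \<le> m" and "m \<le> CARD('n)"
    and "open U"
    and "varifold m U V"
    and "\<exists>\<mu>. is_variation_measure U (first_variation V) \<mu> \<and> radon_measure (top_of_set U) \<mu>"
    and "AE x in weight U V. \<exists>d. has_density m (weight U V) x d \<and> d \<ge> 1"
    and "m > 1 \<Longrightarrow> generalised_mean_curvature U V h"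
    and "m > 1 \<Longrightarrow> L_loc m U (weight U V) h"
    and "m > 1 \<Longrightarrow> \<forall>g\<in>test_fields U. first_variation V g = - (\<integral>x. g x \<bullet> h x \<partial>weight U V)"
    and "C \<in> components (spt U (weight U V))"
    and "w \<in> C" and "z \<in> C"
  shows "\<exists>(a::real) (b::real) (g :: real \<Rightarrow> real^'n) L.
           a \<le> b \<and> L-lipschitz_on {a..b} g \<and> g ` {a..b} \<subseteq> spt U (weight U V) \<and>
           g a = w \<and> g b = z"
proof -
  interpret varifold_in_open m U V using assms(3,4) by unfold_locales
  have density: "AE x in W. \<exists>\<rho>>0. \<forall>r. 0 < r \<and> r < \<rho> \<longrightarrow>
      ennreal (unit_ball_vol (real m) / 2 * r ^ m) \<le> emeasure W (cball x r)"
    using assms(6)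
  proof eventually_elim
    case (elim x)
    then obtain d where "has_density m W x d" "d \<ge> 1" by blast
    then show ?case by (rule has_density_imp_lower_bound)
  qed
  have ball_in: "\<exists>R>0. cball x R \<subseteq> U" if "x \<in> T" for x
    by (rule open_contains_cball[THEN iffD1, OF open_U, rule_format]) (use that spt_subset in blast)
  have "chain_joined T w z"
  proof (cases "m = 1")
    case True
    obtain \<mu> where \<mu>: "is_variation_measure U (first_variation V) \<mu>" "radon_measure (top_of_set U) \<mu>"
      using assms(5) by blast
    have sets: "sets \<mu> = sets (borel_of (top_of_set U))"
      using \<mu>(1) by (simp add: is_variation_measure_def)
    interpret varifold_bounded_variation m U V \<mu>
    proof unfold_locales
      show "ennreal (first_variation V g) \<le> ennreal r * emeasure \<mu> G"
        if "g \<in> test_fields U" "open G" "G \<subseteq> U" "closure {x. g x \<noteq> 0} \<subseteq> G" "0 < r" "\<And>x. norm (g x) \<le> r"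
        for g G r
        by (rule variation_measure_bound[OF \<mu>(1) that])
    qed (fact assms(1) sets density)+
    \<comment> \<open>With m = 1 the exponent m - 1 is 0 and the condition reads
      \<open>measure \<mu> Q \<le> \<epsilon>\<close>, which holds on a small punctured
      ball.\<close>
    have "locally_small_variation"
      unfolding locally_small_variation_def
    proof (intro ballI allI impI)
      fix x and \<epsilon> :: real assume "x \<in> T" and \<epsilon>: "\<epsilon> > 0"
      obtain R0 where R0: "R0 > 0" "cball x R0 \<subseteq> U" using ball_in[OF \<open>x \<in> T\<close>] by blast
      have c: "emeasure \<mu> (cball x R0) < \<infinity>"
      proof -
        have "\<forall>K. compactin (top_of_set U) K \<longrightarrow> emeasure \<mu> K < \<infinity>"
          using \<mu>(2) unfolding radon_measure_def by (elim conjE)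
        moreover have "compactin (top_of_set U) (cball x R0)"
          using R0(2) by (simp add: compactin_subtopology)
        ultimately show ?thesis by blast
      qed
      have s: "ball x r \<in> sets \<mu>" "ball x r - {x} \<in> sets \<mu>" if "r \<le> R0" for r
        using that R0(2) by (intro borel_in_sets_\<nu>; force)+
      have f: "emeasure \<mu> (ball x r) < \<infinity>" if "r \<le> R0" for r
        by (rule le_less_trans[OF emeasure_mono c]) (use that R0(2) in \<open>auto intro!: borel_in_sets_\<nu>\<close>)
      have "emeasure \<mu> (ball x R0 - {x}) < \<infinity>"
        by (rule le_less_trans[OF emeasure_mono f[OF order_refl]]) (use s in auto)
      then obtain R where R: "0 < R" "R \<le> R0" "emeasure \<mu> (ball x R - {x}) < ennreal \<epsilon>"
        using punctured_ball_small[OF R0(1) s(2) _ \<epsilon>] by blast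
      have "measure \<mu> Q \<le> \<epsilon> * root m (measure W Q) ^ (m - 1)" if Q: "open Q" "Q \<subseteq> ball x R - {x}" for Q
      proof -
        have "emeasure \<mu> Q \<le> ennreal \<epsilon>"
          using emeasure_mono[OF Q(2) s(2)[OF R(2)]] R(3) by order
        then have "measure \<mu> Q \<le> \<epsilon>" unfolding measure_def using \<epsilon> by (intro enn2real_leI) auto
        then show ?thesis using True by simp
      qed
      then show "\<exists>R>0. cball x R \<subseteq> U \<and> emeasure \<mu> (ball x R) < \<infinity> \<and>
          (\<forall>Q. open Q \<longrightarrow> Q \<subseteq> ball x R - {x} \<longrightarrow>
            measure \<mu> Q \<le> \<epsilon> * root m (measure W Q) ^ (m - 1))"
        using R R0(2) f[OF R(2)] by (intro exI[of _ R]) auto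
    qed
    then show ?thesis by (rule component_chain_joined[OF _ assms(10-12)])
  next
    case False
    then have m1: "m > 1" using assms(1) by simp
    have hm: "h \<in> borel_measurable W" and
      h_int: "\<And>K. compact K \<Longrightarrow> K \<subseteq> U \<Longrightarrow> set_integrable W K (\<lambda>z. norm (h z) ^ m)"
      using assms(8)[OF m1] by (auto simp: L_loc_def)
    have fv: "\<And>g. g \<in> test_fields U \<Longrightarrow> first_variation V g = - (\<integral>x. g x \<bullet> h x \<partial>W)"
      using assms(9)[OF m1] by blast
    \<comment> \<open>\<open>\<nu>\<close> bounds the variation. The measure \<open>\<mu>\<close> is
      finite on compact sets by the integrability of |h|^m, and its smallness on punctured balls is
      converted into that of \<open>\<nu>\<close>.\<close>
    define \<nu> where "\<nu> = density W (\<lambda>x. ennreal (norm (h x)))"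
    define \<mu> where "\<mu> = density W (\<lambda>x. ennreal (norm (h x) ^ m))"
    have nm: "(\<lambda>x. ennreal (norm (h x))) \<in> borel_measurable W"
      "(\<lambda>x. ennreal (norm (h x) ^ m)) \<in> borel_measurable W"
      using hm by measurable
    have sets\<nu>: "sets \<nu> = sets W" and sets\<mu>: "sets \<mu> = sets W" by (simp_all add: \<nu>_def \<mu>_def)
    have e\<nu>: "emeasure \<nu> A = (\<integral>\<^sup>+x. ennreal (norm (h x)) * indicator A x \<partial>W)" if "A \<in> sets W" for A
      unfolding \<nu>_def by (rule emeasure_density[OF nm(1) that])
    have e\<mu>: "emeasure \<mu> A = (\<integral>\<^sup>+x. ennreal (norm (h x) ^ m) * indicator A x \<partial>W)" if "A \<in> sets W" for A
      unfolding \<mu>_def by (rule emeasure_density[OF nm(2) that])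
    \<comment> \<open>\<open>\<kappa>\<close> stays free: the value 1 gives local finiteness of
      \<open>\<nu>\<close>, and a value adapted to the mass of \<open>Q\<close> gives the
      smallness.\<close>
    have bound: "emeasure \<nu> A \<le> ennreal \<kappa> * emeasure W A + ennreal (1 / \<kappa> ^ (m - 1)) * emeasure \<mu> A"
      if A: "A \<in> sets W" and \<kappa>: "\<kappa> > 0" for A \<kappa>
    proof -
      have "emeasure \<nu> A \<le> (\<integral>\<^sup>+x. ennreal \<kappa> * indicator A x +
          ennreal (1 / \<kappa> ^ (m - 1)) * (ennreal (norm (h x) ^ m) * indicator A x) \<partial>W)"
        unfolding e\<nu>[OF A]
      proof (rule nn_integral_mono)
        fix x
        have "norm (h x) \<le> \<kappa> + 1 / \<kappa> ^ (m - 1) * norm (h x) ^ m"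
          using le_add_power_div[OF norm_ge_zero \<kappa>, of m "h x"] m1 by simp
        then have "ennreal (norm (h x)) \<le> ennreal \<kappa> + ennreal (1 / \<kappa> ^ (m - 1)) * ennreal (norm (h x) ^ m)"
          using \<kappa> by (simp add: ennreal_plus[symmetric] ennreal_mult[symmetric] ennreal_leI del: ennreal_plus)
        then show "ennreal (norm (h x)) * indicator A x \<le> ennreal \<kappa> * indicator A x +
            ennreal (1 / \<kappa> ^ (m - 1)) * (ennreal (norm (h x) ^ m) * indicator A x)"
          by (auto simp: indicator_def)
      qed
      also have "\<dots> = ennreal \<kappa> * emeasure W A + ennreal (1 / \<kappa> ^ (m - 1)) * emeasure \<mu> A"
      proof -
        have "(\<lambda>x. ennreal (norm (h x) ^ m) * indicator A x) \<in> borel_measurable W"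
          using nm(2) A by measurable
        then show ?thesis
          unfolding e\<mu>[OF A] using A by (simp add: nn_integral_add nn_integral_cmult nn_integral_cmult_indicator)
      qed
      finally show ?thesis .
    qed
    have fin\<mu>: "emeasure \<mu> K < \<infinity>" if K: "compact K" "K \<subseteq> U" for K
    proof -
      have Ks: "K \<in> sets W" using K by (intro borel_in_sets_W) (auto intro: borel_closed compact_imp_closed)
      have "(\<integral>\<^sup>+x. ennreal (norm (indicator K x *\<^sub>R norm (h x) ^ m)) \<partial>W) < \<infinity>"
        using h_int[OF K] unfolding set_integrable_def by (simp only: integrable_iff_bounded)
      moreover have "ennreal (norm (indicator K x *\<^sub>R norm (h x) ^ m)) = ennreal (norm (h x) ^ m) * indicator K x" for x
        by (auto simp: indicator_def)
      ultimately show ?thesis unfolding e\<mu>[OF Ks] by (simp only:)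
    qed
    have fin\<nu>: "emeasure \<nu> K < \<infinity>" if K: "compact K" "K \<subseteq> U" for K
    proof -
      have Ks: "K \<in> sets W" using K by (intro borel_in_sets_W) (auto intro: borel_closed compact_imp_closed)
      have "emeasure \<nu> K \<le> emeasure W K + emeasure \<mu> K" using bound[OF Ks, of 1] by simp
      also have "\<dots> < \<infinity>" using fin\<mu>[OF K] compact_emeasure_finite(1)[OF K] by simp
      finally show ?thesis .
    qed
    have variation: "ennreal (first_variation V g) \<le> ennreal r * emeasure \<nu> G"
      if g: "g \<in> test_fields U" and G: "open G" "G \<subseteq> U" "closure {x. g x \<noteq> 0} \<subseteq> G"
        and r: "0 < r" "\<And>x. norm (g x) \<le> r" for g G r
    proof -
      have Gs: "G \<in> sets W" using G by (intro borel_in_sets_W) auto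
      have pt: "norm (g x \<bullet> h x) \<le> r * norm (h x) * indicator G x" for x
      proof (cases "g x = 0")
        case False
        then have "x \<in> G" using G(3) closure_subset[of "{x. g x \<noteq> 0}"] by blast
        then show ?thesis
          using Cauchy_Schwarz_ineq2[of "g x" "h x"] mult_right_mono[OF r(2)[of x], of "norm (h x)"] by simp
      qed (use r(1) in auto)
      have "ennreal (first_variation V g) \<le> ennreal (norm (\<integral>x. g x \<bullet> h x \<partial>W))"
        unfolding fv[OF g] by (rule ennreal_leI) simp
      also have "\<dots> \<le> (\<integral>\<^sup>+x. ennreal (norm (g x \<bullet> h x)) \<partial>W)"
      \<comment> \<open>Without integrability the Bochner integral is 0 by convention, and the bound
        is trivial.\<close>
      proof (cases "integrable W (\<lambda>x. g x \<bullet> h x)")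
        case True
        then show ?thesis by (rule integral_norm_bound_ennreal)
      next
        case False
        then show ?thesis by (simp add: not_integrable_integral_eq)
      qed
      also have "\<dots> \<le> (\<integral>\<^sup>+x. ennreal r * (ennreal (norm (h x)) * indicator G x) \<partial>W)"
      proof (rule nn_integral_mono)
        fix x
        have "ennreal (norm (g x \<bullet> h x)) \<le> ennreal (r * norm (h x) * indicator G x)"
          by (rule ennreal_leI[OF pt])
        also have "\<dots> = ennreal r * (ennreal (norm (h x)) * indicator G x)"
          using r(1) by (auto simp: indicator_def ennreal_mult)
        finally show "ennreal (norm (g x \<bullet> h x)) \<le> ennreal r * (ennreal (norm (h x)) * indicator G x)" .
      qed
      also have "\<dots> = ennreal r * emeasure \<nu> G"
      proof -
        have "(\<lambda>x. ennreal (norm (h x)) * indicator G x) \<in> borel_measurable W"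
          using nm(1) Gs by measurable
        then show ?thesis unfolding e\<nu>[OF Gs] by (rule nn_integral_cmult)
      qed
      finally show ?thesis .
    qed
    interpret varifold_bounded_variation m U V \<nu>
    proof unfold_locales
      show "ennreal (first_variation V g) \<le> ennreal r * emeasure \<nu> G"
        if "g \<in> test_fields U" "open G" "G \<subseteq> U" "closure {x. g x \<noteq> 0} \<subseteq> G" "0 < r" "\<And>x. norm (g x) \<le> r"
        for g G r
        by (rule variation[OF that])
      show "sets \<nu> = sets (borel_of (top_of_set U))" by (simp only: sets\<nu> sets_W)
    qed (fact assms(1) density)+
    have "locally_small_variation"
      unfolding locally_small_variation_def
    proof (intro ballI allI impI)
      fix x and \<epsilon> :: real assume "x \<in> T" and \<epsilon>: "\<epsilon> > 0"
      obtain R0 where R0: "R0 > 0" "cball x R0 \<subseteq> U" using ball_in[OF \<open>x \<in> T\<close>] by blast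
      have cs: "cball x R0 \<in> sets W" using R0(2) by (intro borel_in_sets_W) auto
      have s: "ball x r \<in> sets W" "ball x r - {x} \<in> sets W" if "r \<le> R0" for r
        using that R0(2) by (intro borel_in_sets_W; force)+
      have sub: "ball x r \<subseteq> cball x R0" "ball x r - {x} \<subseteq> cball x R0" if "r \<le> R0" for r
        using that by auto
      have f\<nu>: "emeasure \<nu> (ball x r) < \<infinity>" if "r \<le> R0" for r
        using le_less_trans[OF emeasure_mono fin\<nu>[OF compact_cball R0(2)]] sub(1)[OF that] cs sets\<nu> by blast
      have f\<mu>: "emeasure \<mu> (ball x R0 - {x}) < \<infinity>"
        using le_less_trans[OF emeasure_mono fin\<mu>[OF compact_cball R0(2)]] sub(2)[OF order_refl] cs sets\<mu> by blast
      define \<kappa> where "\<kappa> = \<epsilon> / 2"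
      have \<kappa>: "\<kappa> > 0" using \<epsilon> by (simp add: \<kappa>_def)
      have \<kappa>m: "\<kappa> ^ m > 0" using \<kappa> by simp
      have s\<mu>: "\<And>r. 0 < r \<Longrightarrow> r \<le> R0 \<Longrightarrow> ball x r - {x} \<in> sets \<mu>" using s(2) sets\<mu> by simp
      obtain R where R: "0 < R" "R \<le> R0" "emeasure \<mu> (ball x R - {x}) < ennreal (\<kappa> ^ m)"
        using punctured_ball_small[OF R0(1) s\<mu> f\<mu> \<kappa>m] by blast
      have "measure \<nu> Q \<le> \<epsilon> * root m (measure W Q) ^ (m - 1)" if Q: "open Q" "Q \<subseteq> ball x R - {x}" for Q
      proof -
        have QU: "Q \<subseteq> cball x R0" using Q(2) sub(2)[OF R(2)] by blast
        have Qs: "Q \<in> sets W" using Q(1) QU R0(2) by (intro borel_in_sets_W) auto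
        have "emeasure W Q \<le> emeasure W (cball x R0)" by (rule emeasure_mono[OF QU cs])
        then have WQ: "emeasure W Q < \<infinity>"
          using compact_emeasure_finite(1)[OF compact_cball R0(2)] by (rule le_less_trans)
        have \<mu>Q: "emeasure \<mu> Q \<le> ennreal (\<kappa> ^ m)"
          using emeasure_mono[OF Q(2), of \<mu>] s(2)[OF R(2)] sets\<mu> R(3) by simp
        define \<rho> where "\<rho> = root m (measure W Q)"
        have m0: "m > 0" using m1 by simp
        have \<rho>: "\<rho> \<ge> 0" "\<rho> ^ m = measure W Q" using m0 by (simp_all add: \<rho>_def)
        show ?thesis
        \<comment> \<open>Dividing by \<open>\<rho>\<close> requires positive mass; if there is
          none, \<open>\<nu>\<close> vanishes on \<open>Q\<close> because it has a density with
          respect to the weight.\<close>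
        proof (cases "measure W Q = 0")
          case True
          then have "Q \<in> null_sets W" using WQ Qs by (auto simp: emeasure_eq_ennreal_measure null_sets_def)
          then have "AE x in W. x \<notin> Q" by (rule AE_not_in)
          then have "emeasure \<nu> Q = 0"
            unfolding e\<nu>[OF Qs] by (subst nn_integral_0_iff_AE) (use nm(1) Qs in \<open>auto elim!: eventually_mono\<close>)
          then have "measure \<nu> Q = 0" by (simp add: measure_def)
          then show ?thesis using \<epsilon> True m0 by simp
        next
          case False
          then have "\<rho> > 0" using m0 \<rho> by (simp add: \<rho>_def zero_less_measure_iff)
          \<comment> \<open>This value balances the two terms of \<open>bound\<close>: with weight
            \<open>\<rho> ^ m\<close> and \<open>\<mu>\<close> at most \<open>\<kappa> ^ m\<close>,
            each becomes \<open>\<kappa> * \<rho> ^ (m - 1)\<close>. Hence \<open>\<kappa>\<close>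
            was taken as half of \<open>\<epsilon>\<close>.\<close>
          define l where "l = \<kappa> / \<rho>"
          have l: "l > 0" using \<kappa> \<open>\<rho> > 0\<close> by (simp add: l_def)
          have "emeasure \<nu> Q \<le> ennreal l * emeasure W Q + ennreal (1 / l ^ (m - 1)) * emeasure \<mu> Q"
            by (rule bound[OF Qs l])
          also have "\<dots> \<le> ennreal l * ennreal (measure W Q) + ennreal (1 / l ^ (m - 1)) * ennreal (\<kappa> ^ m)"
            using WQ \<mu>Q by (intro add_mono mult_left_mono) (auto simp: emeasure_eq_ennreal_measure)
          also have "\<dots> = ennreal (l * measure W Q + 1 / l ^ (m - 1) * \<kappa> ^ m)"
            using l \<kappa> by (simp add: ennreal_plus[symmetric] ennreal_mult[symmetric] del: ennreal_plus)
          also have "l * measure W Q + 1 / l ^ (m - 1) * \<kappa> ^ m = \<epsilon> * \<rho> ^ (m - 1)"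
          proof -
            have mm: "y ^ m = y * y ^ (m - 1)" for y :: real using m0 by (cases m) auto
            have "l * measure W Q = \<kappa> * \<rho> ^ (m - 1)"
              unfolding \<rho>(2)[symmetric] l_def mm[of \<rho>] using \<open>\<rho> > 0\<close> by simp
            moreover have "1 / l ^ (m - 1) * \<kappa> ^ m = \<kappa> * \<rho> ^ (m - 1)"
              unfolding l_def mm[of \<kappa>] using \<open>\<rho> > 0\<close> \<kappa> by (simp add: power_divide)
            ultimately show ?thesis by (simp add: \<kappa>_def)
          qed
          finally have "measure \<nu> Q \<le> \<epsilon> * \<rho> ^ (m - 1)"
            unfolding measure_def using \<epsilon> \<rho>(1) by (intro enn2real_leI) auto
          then show ?thesis by (simp add: \<rho>_def)
        qed
      qed
      then show "\<exists>R>0. cball x R \<subseteq> U \<and> emeasure \<nu> (ball x R) < \<infinity> \<and>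
          (\<forall>Q. open Q \<longrightarrow> Q \<subseteq> ball x R - {x} \<longrightarrow>
            measure \<nu> Q \<le> \<epsilon> * root m (measure W Q) ^ (m - 1))"
        using R R0(2) f\<nu>[OF R(2)] by (intro exI[of _ R]) auto
    qed
    then show ?thesis by (rule component_chain_joined[OF _ assms(10-12)])
  qed
  then obtain l :: real and \<gamma> where "0 \<le> l" "1-lipschitz_on {0..l} \<gamma>" "\<gamma> ` {0..l} \<subseteq> T" "\<gamma> 0 = w" "\<gamma> l = z"
    using chain_joined_imp_lipschitz_curve by blast
  then show ?thesis by blast
qed

end
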